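(* The inclusion functors $\mathcal{M}_{cof}^{f,\mathcal{L}}\subset\mathcal{M}_{cof}\subset\mathcal{M}$ induce equivalences of categories $$\mathcal{M}_{cof}^{f,\mathcal{L}}/\!\sim_{\mathcal{L}}\ \simeq\ \mathcal{M}_{cof}[(\mathcal{W}\cup\mathcal{L})^{-1}]\ \simeq\ \mathcal{M}[\mathcal{W}_{\mathcal{L}}^{-1}].$$ The functor $\mathcal{M}[\mathcal{W}_{\mathcal{L}}^{-1}]\to\mathcal{M}_{cof}^{f,\mathcal{L}}/\!\sim_{\mathcal{L}}$ is given by the functor $R_{\mathcal{L}}\circ Q:\mathcal{M}\to\mathcal{M}_{cof}^{f,\mathcal{L}}$. Moreover, the localization functor $\mathcal{M}\to\mathcal{M}[\mathcal{W}_{\mathcal{L}}^{-1}]$ factors uniquely as a composite $$\mathcal{M}\to\mathcal{M}[\mathcal{W}^{-1}]\to\mathcal{M}[\mathcal{W}_{\mathcal{L}}^{-1}].$$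
   Context: For a set $S$ of morphisms of a cocomplete category, $\mathbf{inj}(S)$ is the class of morphisms with the right lifting property with respect to $S$, $\mathbf{cof}(S)$ the class of morphisms with the left lifting property with respect to $\mathbf{inj}(S)$, and $\mathbf{cell}(S)$ the class of transfinite compositions of pushouts of elements of $S$. A weak factorization system is cofibrantly generated if it is of the form $(\mathbf{cof}(S),\mathbf{inj}(S))$ for a set $S$ permitting the small object argument (domains small relative to $\mathbf{cell}(S)$). Setting. $\mathcal{M}$ is a complete and cocomplete category with a model structure $(\mathrm{Cof},\mathrm{Fib},\mathcal{W})$ (cofibrations, fibrations, weak equivalences; model categories in the sense of Hovey) such that the weak factorization system $(\mathrm{Cof}\cap\mathcal{W},\mathrm{Fib})$ is cofibrantly generated, by a set $J$. $(\mathcal{L},\mathcal{R})$ is a cofibrantly generated weak factorization system on $\mathcal{M}$ with $\mathrm{Cof}\cap\mathcal{W}\subset\mathcal{L}\subset\mathrm{Cof}$; thus $\mathcal{L}=\mathbf{cof}(J\cup K)$, $\mathcal{R}=\mathbf{inj}(J\cup K)$ for a set $K$ with $J\cup K$ permitting the small object argument. Fix the functorial factorization $f=\beta(f)\circ\alpha(f)$, $\alpha(f)\in\mathbf{cell}(J\cup K)$, $\beta(f)\in\mathcal{R}$, given by the small object argument. $Q:\mathcal{M}\to\mathcal{M}_{cof}$ is the functorial cofibrant replacement of $\mathcal{M}$, with natural trivial fibrations $Q(X)\to X$. Notation. $\mathcal{M}_{cof}$ is the full subcategory of cofibrant objects of $\mathcal{M}$. An object $X$ is fibrant with respect to $\mathcal{L}$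 if $X\to\mathbf{1}$ (terminal object) is in $\mathcal{R}$. $\mathcal{M}^{f,\mathcal{L}}_{cof}$ is the full subcategory of $\mathcal{M}_{cof}$ of objects fibrant with respect to $\mathcal{L}$. The functor $R_{\mathcal{L}}:\mathcal{M}_{cof}\to\mathcal{M}^{f,\mathcal{L}}_{cof}$ is given by the functorial factorization $X\to R_{\mathcal{L}}(X)\to\mathbf{1}$ of $X\to\mathbf{1}$. Homotopy. $\mathrm{Path}_{\mathcal{L}}(Y)$ is given by the functorial factorization $Y\xrightarrow{\alpha(\mathrm{Id}_Y,\mathrm{Id}_Y)}\mathrm{Path}_{\mathcal{L}}(Y)\xrightarrow{\beta(\mathrm{Id}_Y,\mathrm{Id}_Y)}Y\times Y$ of the diagonal. For $f,g:X\rightrightarrows Y$, $f\sim^r_{\mathcal{L}}g$ means that there is $H:X\to\mathrm{Path}_{\mathcal{L}}(Y)$ with $\beta(\mathrm{Id}_Y,\mathrm{Id}_Y)\circ H=(f,g)$; $\sim_{\mathcal{L}}$ is the transitive closure of $\sim^r_{\mathcal{L}}$. It is a congruence, and $\mathcal{C}/\!\sim_{\mathcal{L}}$ denotes the quotient category (same objects, hom-sets divided by $\sim_{\mathcal{L}}$). $\mathcal{W}_{\mathcal{L}}$ is the class of morphisms $f:X\to Y$ of $\mathcal{M}$ such that for every $Z\in\mathcal{M}^{f,\mathcal{L}}_{cof}$, precomposition with $R_{\mathcal{L}}(Q(f))$ induces a bijection $\mathcal{M}(R_{\mathcal{L}}(Q(Y)),Z)/\!\sim_{\mathcal{L}}\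 \cong\ \mathcal{M}(R_{\mathcal{L}}(Q(X)),Z)/\!\sim_{\mathcal{L}}$. $\mathcal{C}[\Sigma^{-1}]$ is the categorical localization of $\mathcal{C}$ inverting the morphisms of $\mathcal{C}$ belonging to $\Sigma$. *)

theory Defs
  imports Main
begin

unbundle cardinal_syntax

section \<open>Categories and functors\<close>

record ('o, 'a) cat =
  Obj :: "'o set"
  Arr :: "'a set"
  Dom :: "'a \<Rightarrow> 'o"
  Cod :: "'a \<Rightarrow> 'o"
  Id :: "'o \<Rightarrow> 'a"
  Comp :: "'a \<Rightarrow> 'a \<Rightarrow> 'a" (infixr "\<cdot>\<index>" 70)

definition hom :: "('o, 'a) cat \<Rightarrow> 'o \<Rightarrow> 'o \<Rightarrow> 'a set" where
  "hom C X Y = {f \<in> Arr C. Dom C f = X \<and> Cod C f = Y}"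

locale category =
  fixes C :: "('o, 'a) cat" (structure)
  assumes dom_obj: "f \<in> Arr C \<Longrightarrow> Dom C f \<in> Obj C"
    and cod_obj: "f \<in> Arr C \<Longrightarrow> Cod C f \<in> Obj C"
    and id_hom: "X \<in> Obj C \<Longrightarrow> Id C X \<in> hom C X X"
    and comp_hom: "f \<in> hom C X Y \<Longrightarrow> g \<in> hom C Y Z \<Longrightarrow> g \<cdot> f \<in> hom C X Z"
    and id_right: "f \<in> hom C X Y \<Longrightarrow> f \<cdot> Id C X = f"
    and id_left: "f \<in> hom C X Y \<Longrightarrow> Id C Y \<cdot> f = f"
    and assoc: "f \<in> hom C W X \<Longrightarrow> g \<in> hom C X Y \<Longrightarrow> h \<in> hom C Y Z \<Longrightarrow>
      (h \<cdot> g) \<cdot> f = h \<cdot> (g \<cdot> f)"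

record ('o, 'a, 'p, 'b) ftor =
  fo :: "'o \<Rightarrow> 'p"
  fa :: "'a \<Rightarrow> 'b"

locale is_functor = A: category A + B: category B
  for A :: "('o, 'a) cat" and B :: "('p, 'b) cat" +
  fixes F :: "('o, 'a, 'p, 'b) ftor"
  assumes fo_obj: "X \<in> Obj A \<Longrightarrow> fo F X \<in> Obj B"
    and fa_hom: "f \<in> hom A X Y \<Longrightarrow> fa F f \<in> hom B (fo F X) (fo F Y)"
    and fa_id: "X \<in> Obj A \<Longrightarrow> fa F (Id A X) = Id B (fo F X)"
    and fa_comp: "f \<in> hom A X Y \<Longrightarrow> g \<in> hom A Y Z \<Longrightarrow>
      fa F (g \<cdot>\<^bsub>A\<^esub> f) = fa F g \<cdot>\<^bsub>B\<^esub> fa F f"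

text \<open>Functors are total functions in HOL, so equality of functors is agreement on the
  objects and arrows of the source category.\<close>

definition functor_eq ::
    "('o, 'a) cat \<Rightarrow> ('o, 'a, 'p, 'b) ftor \<Rightarrow> ('o, 'a, 'p, 'b) ftor \<Rightarrow> bool" where
  "functor_eq A F G \<longleftrightarrow> (\<forall>X\<in>Obj A. fo F X = fo G X) \<and> (\<forall>f\<in>Arr A. fa F f = fa G f)"

definition id_functor :: "('o, 'a, 'o, 'a) ftor" where
  "id_functor = \<lparr>fo = (\<lambda>X. X), fa = (\<lambda>f. f)\<rparr>"

definition comp_functor ::
    "('p, 'b, 'q, 'c) ftor \<Rightarrow> ('o, 'a, 'p, 'b) ftor \<Rightarrow> ('o, 'a, 'q, 'c) ftor"
    (infixr "\<circ>\<^sub>F" 70) where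
  "G \<circ>\<^sub>F F = \<lparr>fo = fo G \<circ> fo F, fa = fa G \<circ> fa F\<rparr>"

text \<open>The inclusion functor of a full subcategory is \<open>id_functor\<close>.\<close>

definition full_sub :: "('o, 'a) cat \<Rightarrow> 'o set \<Rightarrow> ('o, 'a) cat" where
  "full_sub C P = C\<lparr>Obj := Obj C \<inter> P, Arr := {f \<in> Arr C. Dom C f \<in> P \<and> Cod C f \<in> P}\<rparr>"

definition is_iso :: "('o, 'a) cat \<Rightarrow> 'a \<Rightarrow> bool" where
  "is_iso C f \<longleftrightarrow> f \<in> Arr C \<and> (\<exists>g\<in>hom C (Cod C f) (Dom C f).
     g \<cdot>\<^bsub>C\<^esub> f = Id C (Dom C f) \<and> f \<cdot>\<^bsub>C\<^esub> g = Id C (Cod C f))"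

definition naturally_isomorphic ::
    "('o, 'a) cat \<Rightarrow> ('p, 'b) cat \<Rightarrow> ('o, 'a, 'p, 'b) ftor \<Rightarrow> ('o, 'a, 'p, 'b) ftor \<Rightarrow> bool" where
  "naturally_isomorphic A B F G \<longleftrightarrow> is_functor A B F \<and> is_functor A B G \<and>
     (\<exists>t. (\<forall>X\<in>Obj A. t X \<in> hom B (fo F X) (fo G X) \<and> is_iso B (t X)) \<and>
          (\<forall>f\<in>Arr A. t (Cod A f) \<cdot>\<^bsub>B\<^esub> fa F f = fa G f \<cdot>\<^bsub>B\<^esub> t (Dom A f)))"

definition quasi_inverse ::
    "('o, 'a) cat \<Rightarrow> ('p, 'b) cat \<Rightarrow> ('o, 'a, 'p, 'b) ftor \<Rightarrow> ('p, 'b, 'o, 'a) ftor \<Rightarrow> bool" where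
  "quasi_inverse A B F G \<longleftrightarrow> is_functor A B F \<and> is_functor B A G \<and>
     naturally_isomorphic A A (G \<circ>\<^sub>F F) id_functor \<and>
     naturally_isomorphic B B (F \<circ>\<^sub>F G) id_functor"

definition equivalence_of_categories ::
    "('o, 'a) cat \<Rightarrow> ('p, 'b) cat \<Rightarrow> ('o, 'a, 'p, 'b) ftor \<Rightarrow> bool" where
  "equivalence_of_categories A B F \<longleftrightarrow> (\<exists>G. quasi_inverse A B F G)"

text \<open>\<open>H : D \<rightarrow> E\<close> is the unique functor with \<open>H \<circ> P = F\<close>, where \<open>P : C \<rightarrow> D\<close> and \<open>F : C \<rightarrow> E\<close>.\<close>

definition is_unique_factorization ::
    "('o, 'a) cat \<Rightarrow> ('p, 'b) cat \<Rightarrow> ('q, 'c) cat \<Rightarrow>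
     ('o, 'a, 'p, 'b) ftor \<Rightarrow> ('o, 'a, 'q, 'c) ftor \<Rightarrow> ('p, 'b, 'q, 'c) ftor \<Rightarrow> bool" where
  "is_unique_factorization C D E P F H \<longleftrightarrow>
     is_functor C D P \<and> is_functor C E F \<and>
     is_functor D E H \<and> functor_eq C (H \<circ>\<^sub>F P) F \<and>
     (\<forall>H'. is_functor D E H' \<and> functor_eq C (H' \<circ>\<^sub>F P) F \<longrightarrow> functor_eq D H' H)"


section \<open>Limits and colimits\<close>

definition is_cone ::
    "('i, 'j) cat \<Rightarrow> ('o, 'a) cat \<Rightarrow> ('i, 'j, 'o, 'a) ftor \<Rightarrow> 'o \<Rightarrow> ('i \<Rightarrow> 'a) \<Rightarrow> bool" where
  "is_cone I C D L p \<longleftrightarrow> L \<in> Obj C \<and> (\<forall>i\<in>Obj I. p i \<in> hom C L (fo D i)) \<and>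
     (\<forall>a\<in>Arr I. fa D a \<cdot>\<^bsub>C\<^esub> p (Dom I a) = p (Cod I a))"

definition is_limit ::
    "('i, 'j) cat \<Rightarrow> ('o, 'a) cat \<Rightarrow> ('i, 'j, 'o, 'a) ftor \<Rightarrow> 'o \<Rightarrow> ('i \<Rightarrow> 'a) \<Rightarrow> bool" where
  "is_limit I C D L p \<longleftrightarrow> is_cone I C D L p \<and>
     (\<forall>T t. is_cone I C D T t \<longrightarrow> (\<exists>!h. h \<in> hom C T L \<and> (\<forall>i\<in>Obj I. p i \<cdot>\<^bsub>C\<^esub> h = t i)))"

definition is_cocone ::
    "('i, 'j) cat \<Rightarrow> ('o, 'a) cat \<Rightarrow> ('i, 'j, 'o, 'a) ftor \<Rightarrow> 'o \<Rightarrow> ('i \<Rightarrow> 'a) \<Rightarrow> bool" where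
  "is_cocone I C D L c \<longleftrightarrow> L \<in> Obj C \<and> (\<forall>i\<in>Obj I. c i \<in> hom C (fo D i) L) \<and>
     (\<forall>a\<in>Arr I. c (Cod I a) \<cdot>\<^bsub>C\<^esub> fa D a = c (Dom I a))"

definition is_colimit ::
    "('i, 'j) cat \<Rightarrow> ('o, 'a) cat \<Rightarrow> ('i, 'j, 'o, 'a) ftor \<Rightarrow> 'o \<Rightarrow> ('i \<Rightarrow> 'a) \<Rightarrow> bool" where
  "is_colimit I C D L c \<longleftrightarrow> is_cocone I C D L c \<and>
     (\<forall>T t. is_cocone I C D T t \<longrightarrow> (\<exists>!h. h \<in> hom C L T \<and> (\<forall>i\<in>Obj I. h \<cdot>\<^bsub>C\<^esub> c i = t i)))"

text \<open>Size. A set counts as small if its cardinality is strictly below that of a fixed set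
  \<open>U\<close>, which is required to be infinite, regular and a strong limit, as the cardinality of a
  Grothendieck universe is. (Uncountability is not demanded: \<open>|U| = \<aleph>\<^sub>0\<close> is allowed as well, just
  as the hereditarily finite sets form a Grothendieck universe.) Object and arrow sets of the
  categories under study may be arbitrarily large; up to isomorphism every small category
  has its objects and arrows in the type of \<open>U\<close>.\<close>

definition universe :: "'u set \<Rightarrow> bool" where
  "universe U \<longleftrightarrow> infinite U \<and> regularCard |U| \<and> (\<forall>A\<subseteq>U. |A| <o |U| \<longrightarrow> |Pow A| <o |U| )"

definition small :: "'u set \<Rightarrow> 'b set \<Rightarrow> bool" where
  "small U A \<longleftrightarrow> |A| <o |U|"

definition locally_small :: "'u set \<Rightarrow> ('o, 'a) cat \<Rightarrow> bool" where
  "locally_small U C \<longleftrightarrow> (\<forall>X\<in>Obj C. \<forall>Y\<in>Obj C. small U (hom C X Y))"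

definition complete :: "'u set \<Rightarrow> ('o, 'a) cat \<Rightarrow> bool" where
  "complete U C \<longleftrightarrow> (\<forall>(I :: ('u, 'u) cat) D.
     small U (Arr I) \<and> is_functor I C D \<longrightarrow> (\<exists>L p. is_limit I C D L p))"

definition cocomplete :: "'u set \<Rightarrow> ('o, 'a) cat \<Rightarrow> bool" where
  "cocomplete U C \<longleftrightarrow> (\<forall>(I :: ('u, 'u) cat) D.
     small U (Arr I) \<and> is_functor I C D \<longrightarrow> (\<exists>L c. is_colimit I C D L c))"

definition is_initial :: "('o, 'a) cat \<Rightarrow> 'o \<Rightarrow> bool" where
  "is_initial C Z \<longleftrightarrow> Z \<in> Obj C \<and> (\<forall>X\<in>Obj C. \<exists>!f. f \<in> hom C Z X)"

definition is_terminal :: "('o, 'a) cat \<Rightarrow> 'o \<Rightarrow> bool" where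
  "is_terminal C T \<longleftrightarrow> T \<in> Obj C \<and> (\<forall>X\<in>Obj C. \<exists>!f. f \<in> hom C X T)"

definition is_product :: "('o, 'a) cat \<Rightarrow> 'o \<Rightarrow> 'o \<Rightarrow> 'o \<Rightarrow> 'a \<Rightarrow> 'a \<Rightarrow> bool" where
  "is_product C X Y P p q \<longleftrightarrow> p \<in> hom C P X \<and> q \<in> hom C P Y \<and>
     (\<forall>T f g. f \<in> hom C T X \<and> g \<in> hom C T Y \<longrightarrow>
        (\<exists>!h. h \<in> hom C T P \<and> p \<cdot>\<^bsub>C\<^esub> h = f \<and> q \<cdot>\<^bsub>C\<^esub> h = g))"

definition initial_obj :: "('o, 'a) cat \<Rightarrow> 'o" where
  "initial_obj C = (SOME Z. is_initial C Z)"

definition initial_arr :: "('o, 'a) cat \<Rightarrow> 'o \<Rightarrow> 'a" where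
  "initial_arr C X = (THE f. f \<in> hom C (initial_obj C) X)"

definition terminal_obj :: "('o, 'a) cat \<Rightarrow> 'o" where
  "terminal_obj C = (SOME T. is_terminal C T)"

definition terminal_arr :: "('o, 'a) cat \<Rightarrow> 'o \<Rightarrow> 'a" where
  "terminal_arr C X = (THE f. f \<in> hom C X (terminal_obj C))"

definition product :: "('o, 'a) cat \<Rightarrow> 'o \<Rightarrow> 'o \<Rightarrow> 'o \<times> 'a \<times> 'a" where
  "product C X Y = (SOME (P, p, q). is_product C X Y P p q)"

definition product_obj :: "('o, 'a) cat \<Rightarrow> 'o \<Rightarrow> 'o \<Rightarrow> 'o" where
  "product_obj C X Y = fst (product C X Y)"

definition proj1 :: "('o, 'a) cat \<Rightarrow> 'o \<Rightarrow> 'o \<Rightarrow> 'a" where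
  "proj1 C X Y = fst (snd (product C X Y))"

definition proj2 :: "('o, 'a) cat \<Rightarrow> 'o \<Rightarrow> 'o \<Rightarrow> 'a" where
  "proj2 C X Y = snd (snd (product C X Y))"

definition pairing :: "('o, 'a) cat \<Rightarrow> 'a \<Rightarrow> 'a \<Rightarrow> 'a" where
  "pairing C f g = (THE h. h \<in> hom C (Dom C f) (product_obj C (Cod C f) (Cod C g)) \<and>
     proj1 C (Cod C f) (Cod C g) \<cdot>\<^bsub>C\<^esub> h = f \<and> proj2 C (Cod C f) (Cod C g) \<cdot>\<^bsub>C\<^esub> h = g)"


section \<open>Lifting properties and relative cell complexes\<close>

definition square :: "('o, 'a) cat \<Rightarrow> 'a \<Rightarrow> 'a \<Rightarrow> 'a \<Rightarrow> 'a \<Rightarrow> bool" where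
  "square C f g u v \<longleftrightarrow> f \<in> Arr C \<and> g \<in> Arr C \<and>
     u \<in> hom C (Dom C f) (Dom C g) \<and> v \<in> hom C (Cod C f) (Cod C g) \<and>
     g \<cdot>\<^bsub>C\<^esub> u = v \<cdot>\<^bsub>C\<^esub> f"

definition has_lifting :: "('o, 'a) cat \<Rightarrow> 'a \<Rightarrow> 'a \<Rightarrow> bool" where
  "has_lifting C f g \<longleftrightarrow> (\<forall>u v. square C f g u v \<longrightarrow>
     (\<exists>k\<in>hom C (Cod C f) (Dom C g). k \<cdot>\<^bsub>C\<^esub> f = u \<and> g \<cdot>\<^bsub>C\<^esub> k = v))"

definition rlp :: "('o, 'a) cat \<Rightarrow> 'a set \<Rightarrow> 'a set" where
  "rlp C S = {g \<in> Arr C. \<forall>f\<in>S. has_lifting C f g}"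

definition llp :: "('o, 'a) cat \<Rightarrow> 'a set \<Rightarrow> 'a set" where
  "llp C S = {f \<in> Arr C. \<forall>g\<in>S. has_lifting C f g}"

definition inj_class :: "('o, 'a) cat \<Rightarrow> 'a set \<Rightarrow> 'a set" where
  "inj_class C S = rlp C S"

definition cof_class :: "('o, 'a) cat \<Rightarrow> 'a set \<Rightarrow> 'a set" where
  "cof_class C S = llp C (inj_class C S)"

text \<open>\<open>g\<close> is the pushout of \<open>f\<close> along \<open>u\<close>.\<close>

definition is_pushout :: "('o, 'a) cat \<Rightarrow> 'a \<Rightarrow> 'a \<Rightarrow> 'a \<Rightarrow> 'a \<Rightarrow> bool" where
  "is_pushout C f g u v \<longleftrightarrow> square C f g u v \<and>
     (\<forall>T s t. s \<in> hom C (Dom C g) T \<and> t \<in> hom C (Cod C f) T \<and> s \<cdot>\<^bsub>C\<^esub> u = t \<cdot>\<^bsub>C\<^esub> f \<longrightarrow>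
        (\<exists>!h. h \<in> hom C (Cod C g) T \<and> h \<cdot>\<^bsub>C\<^esub> g = s \<and> h \<cdot>\<^bsub>C\<^esub> v = t))"

definition pushouts_of :: "('o, 'a) cat \<Rightarrow> 'a set \<Rightarrow> 'a set" where
  "pushouts_of C S = {g. \<exists>f\<in>S. \<exists>u v. is_pushout C f g u v}"

definition order_cat :: "'u rel \<Rightarrow> ('u, 'u \<times> 'u) cat" where
  "order_cat r = \<lparr>Obj = Field r, Arr = r, Dom = fst, Cod = snd,
     Id = (\<lambda>x. (x, x)), Comp = (\<lambda>b a. (fst a, snd b))\<rparr>"

definition successor :: "'u rel \<Rightarrow> 'u \<Rightarrow> 'u \<Rightarrow> bool" where
  "successor r b c \<longleftrightarrow> c \<in> aboveS r b \<and> (\<forall>x\<in>aboveS r b. (c, x) \<in> r)"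

definition limit_element :: "'u rel \<Rightarrow> 'u \<Rightarrow> bool" where
  "limit_element r l \<longleftrightarrow> l \<in> Field r \<and> underS r l \<noteq> {} \<and> (\<forall>b. \<not> successor r b l)"

text \<open>Small ordinals are rendered as small well-orders. A sequence is a functor which is
  colimit-preserving at every limit element; all its successor steps are to lie in \<open>D\<close>.\<close>

definition sequence_in ::
    "'u set \<Rightarrow> ('o, 'a) cat \<Rightarrow> 'a set \<Rightarrow> 'u rel \<Rightarrow> ('u, 'u \<times> 'u, 'o, 'a) ftor \<Rightarrow> bool" where
  "sequence_in U C D r X \<longleftrightarrow> Well_order r \<and> Field r \<noteq> {} \<and> small U (Field r) \<and>
     is_functor (order_cat r) C X \<and>
     (\<forall>l. limit_element r l \<longrightarrow>
        is_colimit (order_cat (Restr r (underS r l))) C X (fo X l) (\<lambda>b. fa X (b, l))) \<and>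
     (\<forall>b c. successor r b c \<longrightarrow> fa X (b, c) \<in> D)"

definition cell :: "'u set \<Rightarrow> ('o, 'a) cat \<Rightarrow> 'a set \<Rightarrow> 'a set" where
  "cell U C S = {f. \<exists>r X T c z. sequence_in U C (pushouts_of C S) r X \<and>
     is_colimit (order_cat r) C X T c \<and> z \<in> Field r \<and> (\<forall>x\<in>Field r. (z, x) \<in> r) \<and> f = c z}"

text \<open>\<open>r\<close> is a limit ordinal in which every subset of cardinality at most \<open>|k|\<close> is bounded.\<close>

definition filtered_ordinal :: "'u set \<Rightarrow> 'u rel \<Rightarrow> bool" where
  "filtered_ordinal k r \<longleftrightarrow> Well_order r \<and> Field r \<noteq> {} \<and> (\<forall>b\<in>Field r. aboveS r b \<noteq> {}) \<and>
     (\<forall>A\<subseteq>Field r. |A| \<le>o |k| \<longrightarrow> (\<exists>b\<in>Field r. \<forall>a\<in>A. (a, b) \<in> r))"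

text \<open>The last two conjuncts say that the canonical map from the colimit of the sets
  \<open>hom C A (X b)\<close> to \<open>hom C A (colim X)\<close> is surjective and injective: the colimit of a
  sequence of sets is the disjoint union modulo eventual equality.\<close>

definition small_relative_to :: "'u set \<Rightarrow> ('o, 'a) cat \<Rightarrow> 'a set \<Rightarrow> 'o \<Rightarrow> bool" where
  "small_relative_to U C D A \<longleftrightarrow> A \<in> Obj C \<and> (\<exists>k :: 'u set. small U k \<and>
     (\<forall>r X T c. filtered_ordinal k r \<and> sequence_in U C D r X \<and> is_colimit (order_cat r) C X T c \<longrightarrow>
        (\<forall>h\<in>hom C A T. \<exists>b\<in>Field r. \<exists>g\<in>hom C A (fo X b). c b \<cdot>\<^bsub>C\<^esub> g = h) \<and>
        (\<forall>b\<in>Field r. \<forall>b'\<in>Field r. \<forall>g\<in>hom C A (fo X b). \<forall>g'\<in>hom C A (fo X b').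
           c b \<cdot>\<^bsub>C\<^esub> g = c b' \<cdot>\<^bsub>C\<^esub> g' \<longrightarrow>
           (\<exists>d. (b, d) \<in> r \<and> (b', d) \<in> r \<and> fa X (b, d) \<cdot>\<^bsub>C\<^esub> g = fa X (b', d) \<cdot>\<^bsub>C\<^esub> g'))))"

definition permits_small_object_argument :: "'u set \<Rightarrow> ('o, 'a) cat \<Rightarrow> 'a set \<Rightarrow> bool" where
  "permits_small_object_argument U C S \<longleftrightarrow> S \<subseteq> Arr C \<and> small U S \<and>
     (\<forall>f\<in>S. small_relative_to U C (cell U C S) (Dom C f))"


section \<open>Factorization systems and model structures\<close>

definition weak_factorization_system :: "('o, 'a) cat \<Rightarrow> 'a set \<Rightarrow> 'a set \<Rightarrow> bool" where
  "weak_factorization_system C L R \<longleftrightarrow> L = llp C R \<and> R = rlp C L \<and>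
     (\<forall>f\<in>Arr C. \<exists>l\<in>L. \<exists>r\<in>R. Dom C r = Cod C l \<and> f = r \<cdot>\<^bsub>C\<^esub> l)"

definition cofibrantly_generated_by ::
    "'u set \<Rightarrow> ('o, 'a) cat \<Rightarrow> 'a set \<Rightarrow> 'a set \<Rightarrow> 'a set \<Rightarrow> bool" where
  "cofibrantly_generated_by U C L R S \<longleftrightarrow> weak_factorization_system C L R \<and>
     permits_small_object_argument U C S \<and> L = cof_class C S \<and> R = inj_class C S"

text \<open>\<open>fmid \<Phi> f g u v\<close> is the arrow between the middle objects of the factorizations of \<open>f\<close>
  and \<open>g\<close> induced by a commutative square \<open>(u, v) : f \<rightarrow> g\<close>.\<close>

record 'a factorization =
  fleft :: "'a \<Rightarrow> 'a"
  fright :: "'a \<Rightarrow> 'a"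
  fmid :: "'a \<Rightarrow> 'a \<Rightarrow> 'a \<Rightarrow> 'a \<Rightarrow> 'a"

definition functorial_factorization ::
    "('o, 'a) cat \<Rightarrow> 'a factorization \<Rightarrow> 'a set \<Rightarrow> 'a set \<Rightarrow> bool" where
  "functorial_factorization C \<Phi> L R \<longleftrightarrow>
     (\<forall>f\<in>Arr C. fleft \<Phi> f \<in> L \<inter> Arr C \<and> fright \<Phi> f \<in> R \<inter> Arr C \<and>
        Dom C (fleft \<Phi> f) = Dom C f \<and> Cod C (fright \<Phi> f) = Cod C f \<and>
        Cod C (fleft \<Phi> f) = Dom C (fright \<Phi> f) \<and> f = fright \<Phi> f \<cdot>\<^bsub>C\<^esub> fleft \<Phi> f) \<and>
     (\<forall>f g u v. square C f g u v \<longrightarrow>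
        fmid \<Phi> f g u v \<in> hom C (Cod C (fleft \<Phi> f)) (Cod C (fleft \<Phi> g)) \<and>
        fmid \<Phi> f g u v \<cdot>\<^bsub>C\<^esub> fleft \<Phi> f = fleft \<Phi> g \<cdot>\<^bsub>C\<^esub> u \<and>
        fright \<Phi> g \<cdot>\<^bsub>C\<^esub> fmid \<Phi> f g u v = v \<cdot>\<^bsub>C\<^esub> fright \<Phi> f) \<and>
     (\<forall>f\<in>Arr C. fmid \<Phi> f f (Id C (Dom C f)) (Id C (Cod C f)) = Id C (Cod C (fleft \<Phi> f))) \<and>
     (\<forall>f g h u v u' v'. square C f g u v \<and> square C g h u' v' \<longrightarrow>
        fmid \<Phi> f h (u' \<cdot>\<^bsub>C\<^esub> u) (v' \<cdot>\<^bsub>C\<^esub> v) = fmid \<Phi> g h u' v' \<cdot>\<^bsub>C\<^esub> fmid \<Phi> f g u v)"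

definition wide_subcategory :: "('o, 'a) cat \<Rightarrow> 'a set \<Rightarrow> bool" where
  "wide_subcategory C S \<longleftrightarrow> S \<subseteq> Arr C \<and> (\<forall>X\<in>Obj C. Id C X \<in> S) \<and>
     (\<forall>f\<in>S. \<forall>g\<in>S. Cod C f = Dom C g \<longrightarrow> g \<cdot>\<^bsub>C\<^esub> f \<in> S)"

definition is_retract :: "('o, 'a) cat \<Rightarrow> 'a \<Rightarrow> 'a \<Rightarrow> bool" where
  "is_retract C f g \<longleftrightarrow> (\<exists>i j r s. square C f g i j \<and> square C g f r s \<and>
     r \<cdot>\<^bsub>C\<^esub> i = Id C (Dom C f) \<and> s \<cdot>\<^bsub>C\<^esub> j = Id C (Cod C f))"

definition retract_closed :: "('o, 'a) cat \<Rightarrow> 'a set \<Rightarrow> bool" where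
  "retract_closed C S \<longleftrightarrow> (\<forall>f g. g \<in> S \<and> is_retract C f g \<longrightarrow> f \<in> S)"

definition two_out_of_three :: "('o, 'a) cat \<Rightarrow> 'a set \<Rightarrow> bool" where
  "two_out_of_three C S \<longleftrightarrow> (\<forall>f\<in>Arr C. \<forall>g\<in>Arr C. Cod C f = Dom C g \<longrightarrow>
     (f \<in> S \<and> g \<in> S \<longrightarrow> g \<cdot>\<^bsub>C\<^esub> f \<in> S) \<and>
     (f \<in> S \<and> g \<cdot>\<^bsub>C\<^esub> f \<in> S \<longrightarrow> g \<in> S) \<and>
     (g \<in> S \<and> g \<cdot>\<^bsub>C\<^esub> f \<in> S \<longrightarrow> f \<in> S))"

definition model_structure :: "('o, 'a) cat \<Rightarrow> 'a set \<Rightarrow> 'a set \<Rightarrow> 'a set \<Rightarrow> bool" where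
  "model_structure C Cof Fib W \<longleftrightarrow>
     wide_subcategory C Cof \<and> wide_subcategory C Fib \<and> wide_subcategory C W \<and>
     two_out_of_three C W \<and>
     retract_closed C Cof \<and> retract_closed C Fib \<and> retract_closed C W \<and>
     (\<forall>f\<in>Cof. \<forall>g\<in>Fib. f \<in> W \<or> g \<in> W \<longrightarrow> has_lifting C f g) \<and>
     (\<exists>\<Phi>. functorial_factorization C \<Phi> Cof (Fib \<inter> W)) \<and>
     (\<exists>\<Phi>. functorial_factorization C \<Phi> (Cof \<inter> W) Fib)"

definition model_category :: "'u set \<Rightarrow> ('o, 'a) cat \<Rightarrow> 'a set \<Rightarrow> 'a set \<Rightarrow> 'a set \<Rightarrow> bool" where
  "model_category U C Cof Fib W \<longleftrightarrow> category C \<and> locally_small U C \<and>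
     complete U C \<and> cocomplete U C \<and> model_structure C Cof Fib W"


section \<open>Cofibrant and fibrant objects, homotopy\<close>

definition cofibrant_objs :: "('o, 'a) cat \<Rightarrow> 'a set \<Rightarrow> 'o set" where
  "cofibrant_objs M Cof = {X \<in> Obj M. initial_arr M X \<in> Cof}"

definition fibrant_objs :: "('o, 'a) cat \<Rightarrow> 'a set \<Rightarrow> 'o set" where
  "fibrant_objs M R = {X \<in> Obj M. terminal_arr M X \<in> R}"

definition cof_cat :: "('o, 'a) cat \<Rightarrow> 'a set \<Rightarrow> ('o, 'a) cat" where
  "cof_cat M Cof = full_sub M (cofibrant_objs M Cof)"

definition cof_fib_cat :: "('o, 'a) cat \<Rightarrow> 'a set \<Rightarrow> 'a set \<Rightarrow> ('o, 'a) cat" where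
  "cof_fib_cat M Cof R = full_sub (cof_cat M Cof) (fibrant_objs M R)"

definition cofibrant_replacement ::
    "('o, 'a) cat \<Rightarrow> 'a set \<Rightarrow> 'a set \<Rightarrow> 'a set \<Rightarrow> ('o, 'a, 'o, 'a) ftor \<Rightarrow> ('o \<Rightarrow> 'a) \<Rightarrow> bool" where
  "cofibrant_replacement M Cof Fib W Q q \<longleftrightarrow> is_functor M (cof_cat M Cof) Q \<and>
     (\<forall>X\<in>Obj M. q X \<in> hom M (fo Q X) X \<and> q X \<in> Fib \<inter> W) \<and>
     (\<forall>f\<in>Arr M. q (Cod M f) \<cdot>\<^bsub>M\<^esub> fa Q f = f \<cdot>\<^bsub>M\<^esub> q (Dom M f))"

definition fibrant_replacement :: "('o, 'a) cat \<Rightarrow> 'a factorization \<Rightarrow> ('o, 'a, 'o, 'a) ftor" where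
  "fibrant_replacement M \<Phi> = \<lparr>
     fo = (\<lambda>X. Cod M (fleft \<Phi> (terminal_arr M X))),
     fa = (\<lambda>f. fmid \<Phi> (terminal_arr M (Dom M f)) (terminal_arr M (Cod M f))
                 f (Id M (terminal_obj M)))\<rparr>"

definition diagonal :: "('o, 'a) cat \<Rightarrow> 'o \<Rightarrow> 'a" where
  "diagonal M Y = pairing M (Id M Y) (Id M Y)"

definition path_obj :: "('o, 'a) cat \<Rightarrow> 'a factorization \<Rightarrow> 'o \<Rightarrow> 'o" where
  "path_obj M \<Phi> Y = Cod M (fleft \<Phi> (diagonal M Y))"

definition right_homotopy :: "('o, 'a) cat \<Rightarrow> 'a factorization \<Rightarrow> 'a rel" where
  "right_homotopy M \<Phi> = {(f, g). f \<in> Arr M \<and> g \<in> hom M (Dom M f) (Cod M f) \<and>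
     (\<exists>H\<in>hom M (Dom M f) (path_obj M \<Phi> (Cod M f)).
        fright \<Phi> (diagonal M (Cod M f)) \<cdot>\<^bsub>M\<^esub> H = pairing M f g)}"

definition homotopy :: "('o, 'a) cat \<Rightarrow> 'a factorization \<Rightarrow> 'a rel" where
  "homotopy M \<Phi> = (right_homotopy M \<Phi>)\<^sup>+"

text \<open>\<open>W_L\<close>: the map of quotient sets sends the class \<open>c\<close> of \<open>g\<close> to the class of
  \<open>g \<cdot> R_L(Q f)\<close>.\<close>

definition local_equivalences ::
    "('o, 'a) cat \<Rightarrow> 'a set \<Rightarrow> 'a set \<Rightarrow> 'a factorization \<Rightarrow> ('o, 'a, 'o, 'a) ftor \<Rightarrow> 'a set" where
  "local_equivalences M Cof R \<Phi> Q = {f \<in> Arr M.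
     let RQ = fibrant_replacement M \<Phi> \<circ>\<^sub>F Q in
     \<forall>Z\<in>Obj (cof_fib_cat M Cof R).
       bij_betw (\<lambda>c. homotopy M \<Phi> `` ((\<lambda>g. g \<cdot>\<^bsub>M\<^esub> fa RQ f) ` c))
         (hom M (fo RQ (Cod M f)) Z // homotopy M \<Phi>)
         (hom M (fo RQ (Dom M f)) Z // homotopy M \<Phi>)}"


section \<open>Quotient categories\<close>

text \<open>Intended for a congruence \<open>E\<close>; related arrows are then parallel, so that domain and
  codomain can be read off any representative.\<close>

definition quotient_class :: "('o, 'a) cat \<Rightarrow> 'a rel \<Rightarrow> 'a \<Rightarrow> 'a set" where
  "quotient_class C E f = {g \<in> Arr C. (f, g) \<in> E}"

definition quotient_cat :: "('o, 'a) cat \<Rightarrow> 'a rel \<Rightarrow> ('o, 'a set) cat" where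
  "quotient_cat C E = \<lparr>
     Obj = Obj C,
     Arr = quotient_class C E ` Arr C,
     Dom = (\<lambda>c. Dom C (SOME f. f \<in> c)),
     Cod = (\<lambda>c. Cod C (SOME f. f \<in> c)),
     Id = (\<lambda>X. quotient_class C E (Id C X)),
     Comp = (\<lambda>d c. quotient_class C E ((SOME g. g \<in> d) \<cdot>\<^bsub>C\<^esub> (SOME f. f \<in> c)))\<rparr>"

definition quotient_functor :: "('o, 'a) cat \<Rightarrow> 'a rel \<Rightarrow> ('o, 'a, 'o, 'a set) ftor" where
  "quotient_functor C E = \<lparr>fo = (\<lambda>X. X), fa = quotient_class C E\<rparr>"


section \<open>Localizations\<close>

text \<open>The Gabriel--Zisman construction: arrows are zigzags \<open>w\<close> of arrows of \<open>C\<close> and formal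
  inverses of arrows in \<open>S\<close>, modulo the congruence \<open>zigzag_eq\<close>. Zigzags are read in
  diagrammatic order. Only elements of \<open>S\<close> that are arrows of \<open>C\<close> are inverted.\<close>

datatype 'a step = Fwd 'a | Bwd 'a

inductive zigzag :: "('o, 'a) cat \<Rightarrow> 'a set \<Rightarrow> 'o \<Rightarrow> 'a step list \<Rightarrow> 'o \<Rightarrow> bool"
  for C S where
  nil: "X \<in> Obj C \<Longrightarrow> zigzag C S X [] X"
| fwd: "f \<in> hom C X Y \<Longrightarrow> zigzag C S Y w Z \<Longrightarrow> zigzag C S X (Fwd f # w) Z"
| bwd: "s \<in> hom C Y X \<Longrightarrow> s \<in> S \<Longrightarrow> zigzag C S Y w Z \<Longrightarrow> zigzag C S X (Bwd s # w) Z"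

inductive zigzag_eq ::
    "('o, 'a) cat \<Rightarrow> 'a set \<Rightarrow> 'o \<Rightarrow> 'o \<Rightarrow> 'a step list \<Rightarrow> 'a step list \<Rightarrow> bool"
  for C S where
  refl: "zigzag C S X w Y \<Longrightarrow> zigzag_eq C S X Y w w"
| sym: "zigzag_eq C S X Y v w \<Longrightarrow> zigzag_eq C S X Y w v"
| trans: "zigzag_eq C S X Y u v \<Longrightarrow> zigzag_eq C S X Y v w \<Longrightarrow> zigzag_eq C S X Y u w"
| append: "zigzag_eq C S X Y v v' \<Longrightarrow> zigzag_eq C S Y Z w w' \<Longrightarrow>
    zigzag_eq C S X Z (v @ w) (v' @ w')"
| ident: "X \<in> Obj C \<Longrightarrow> zigzag_eq C S X X [Fwd (Id C X)] []"
| comp: "f \<in> hom C X Y \<Longrightarrow> g \<in> hom C Y Z \<Longrightarrow>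
    zigzag_eq C S X Z [Fwd f, Fwd g] [Fwd (g \<cdot>\<^bsub>C\<^esub> f)]"
| inv_right: "s \<in> hom C X Y \<Longrightarrow> s \<in> S \<Longrightarrow> zigzag_eq C S X X [Fwd s, Bwd s] []"
| inv_left: "s \<in> hom C X Y \<Longrightarrow> s \<in> S \<Longrightarrow> zigzag_eq C S Y Y [Bwd s, Fwd s] []"

definition zigzag_class ::
    "('o, 'a) cat \<Rightarrow> 'a set \<Rightarrow> 'o \<Rightarrow> 'a step list \<Rightarrow> 'o \<Rightarrow> 'o \<times> 'a step list set \<times> 'o" where
  "zigzag_class C S X w Y = (X, {w'. zigzag_eq C S X Y w w'}, Y)"

definition localization ::
    "('o, 'a) cat \<Rightarrow> 'a set \<Rightarrow> ('o, 'o \<times> 'a step list set \<times> 'o) cat" where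
  "localization C S = \<lparr>
     Obj = Obj C,
     Arr = {zigzag_class C S X w Y |X w Y. zigzag C S X w Y},
     Dom = (\<lambda>(X, c, Y). X),
     Cod = (\<lambda>(X, c, Y). Y),
     Id = (\<lambda>X. zigzag_class C S X [] X),
     Comp = (\<lambda>(Y, d, Z) (X, c, Y').
       zigzag_class C S X ((SOME u. u \<in> c) @ (SOME v. v \<in> d)) Z)\<rparr>"

definition localization_functor ::
    "('o, 'a) cat \<Rightarrow> 'a set \<Rightarrow> ('o, 'a, 'o, 'o \<times> 'a step list set \<times> 'o) ftor" where
  "localization_functor C S = \<lparr>fo = (\<lambda>X. X),
     fa = (\<lambda>f. zigzag_class C S (Dom C f) [Fwd f] (Cod C f))\<rparr>"

end

theory Submission
  imports Defs
begin

text \<open>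
  Write \<open>\<sim>\<close> for the homotopy relation defined by the weak factorization system \<open>(L, R)\<close>, and
  \<open>Ho\<close> for the quotient of the whole category by it. Everything rests on the maps that a fixed
  object cannot distinguish: call \<open>f\<close> homotopy local if precomposition with it is a bijection on
  \<open>Ho(-, Z)\<close> for every \<open>Z\<close> that is cofibrant and fibrant with respect to \<open>L\<close>. This property satisfies
  two out of three, and it holds for two kinds of maps.

  First, it holds for every \<open>i\<close> in \<open>L\<close> (\<open>L_homotopy_local\<close>). Maps into \<open>Z\<close> extend along \<open>i\<close> because
  \<open>Z \<rightarrow> 1\<close> is in \<open>R\<close>, and a homotopy between two maps restricted along \<open>i\<close> extends because
  \<open>Path Z \<rightarrow> Z \<times> Z\<close> is in \<open>R\<close>. Second, it holds for every weak equivalence between cofibrant objects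
  (\<open>W_homotopy_local\<close>): by Ken Brown's lemma such a map is a trivial cofibration followed by a
  retraction of another trivial cofibration, and trivial cofibrations are in \<open>L\<close>.

  Comparing \<open>X\<close> with \<open>Q X\<close> and with \<open>RQ X\<close> through the zigzag \<open>X \<leftarrow> Q X \<rightarrow> RQ X\<close>, whose left leg
  is a weak equivalence and whose right leg is in \<open>L\<close>, gives that \<open>W\<close> consists of local equivalences and that
  members of \<open>L\<close> between cofibrant objects are local equivalences as well. By the Yoneda lemma
  a homotopy local map between objects that are cofibrant and fibrant is an isomorphism modulo
  \<open>\<sim>\<close>, so \<open>RQ\<close> inverts the local equivalences. Conversely, homotopic maps between cofibrant objects
  become equal once \<open>L\<close> is inverted, since both ends of a path object are then inverse to
  \<open>Y \<rightarrow> Path Y\<close>, which is in \<open>L\<close>. These facts yield all the functors of the statement by universal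
  properties.

  All the equivalences come from the same zigzag \<open>X \<leftarrow> Q X \<rightarrow> RQ X\<close>: each of the three categories
  inverts both of its legs, so it is a natural isomorphism between \<open>X\<close> and \<open>RQ X\<close> there
  (\<open>replacement_natural_iso\<close>), and going once around the triangle of functors is \<open>RQ\<close>.

  The small object argument enters only through the fact that relative cell complexes have the
  left lifting property (\<open>cell_subset_cof_class\<close>), so that the given functorial factorization is one
  into \<open>L\<close> followed by \<open>R\<close>.
\<close>

section \<open>Categories, isomorphisms and functors\<close>

context category
begin

lemma arr_in_hom: "f \<in> Arr C \<Longrightarrow> f \<in> hom C (Dom C f) (Cod C f)"
  by (simp add: hom_def)

lemma homD:
  assumes "f \<in> hom C X Y"
  shows "f \<in> Arr C" "Dom C f = X" "Cod C f = Y" "X \<in> Obj C" "Y \<in> Obj C"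
  using assms dom_obj cod_obj by (auto simp: hom_def)

lemma is_isoI:
  assumes "f \<in> hom C X Y" "g \<in> hom C Y X" "g \<cdot> f = Id C X" "f \<cdot> g = Id C Y"
  shows "is_iso C f"
  unfolding is_iso_def using assms homD by metis

lemma is_isoE:
  assumes "is_iso C f" "f \<in> hom C X Y"
  obtains g where "g \<in> hom C Y X" "g \<cdot> f = Id C X" "f \<cdot> g = Id C Y"
  using assms homD unfolding is_iso_def by metis

lemma iso_cancel_right:
  assumes f: "is_iso C f" "f \<in> hom C X Y" and g: "g \<in> hom C Y Z" "g' \<in> hom C Y Z"
    and eq: "g \<cdot> f = g' \<cdot> f"
  shows "g = g'"
proof -
  obtain i where i: "i \<in> hom C Y X" "f \<cdot> i = Id C Y" using f by (rule is_isoE)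
  have "g = (g \<cdot> f) \<cdot> i" using assoc[OF i(1) f(2) g(1)] i id_right[OF g(1)] by simp
  also have "\<dots> = g'" using assoc[OF i(1) f(2) g(2)] i id_right[OF g(2)] eq by simp
  finally show ?thesis .
qed

lemma inverse_comp:
  assumes f: "f \<in> hom C X Y" "f' \<in> hom C Y X" "f' \<cdot> f = Id C X"
    and g: "g \<in> hom C Y Z" "g' \<in> hom C Z Y" "g' \<cdot> g = Id C Y"
  shows "(f' \<cdot> g') \<cdot> (g \<cdot> f) = Id C X"
proof -
  have "(f' \<cdot> g') \<cdot> (g \<cdot> f) = f' \<cdot> (g' \<cdot> (g \<cdot> f))"
    using assoc comp_hom f g by metis
  also have "g' \<cdot> (g \<cdot> f) = f" using assoc[OF f(1) g(1) g(2)] g(3) id_left[OF f(1)] by simp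
  finally show ?thesis using f by simp
qed

lemma iso_comp:
  assumes f: "is_iso C f" "f \<in> hom C X Y" and g: "is_iso C g" "g \<in> hom C Y Z"
  shows "is_iso C (g \<cdot> f)"
proof -
  obtain f' where f': "f' \<in> hom C Y X" "f' \<cdot> f = Id C X" "f \<cdot> f' = Id C Y" using f by (rule is_isoE)
  obtain g' where g': "g' \<in> hom C Z Y" "g' \<cdot> g = Id C Y" "g \<cdot> g' = Id C Z" using g by (rule is_isoE)
  show ?thesis
    using inverse_comp[OF f(2) f'(1,2) g(2) g'(1,2)] inverse_comp[OF g'(1) g(2) g'(3) f'(1) f(2) f'(3)]
      is_isoI comp_hom f(2) g(2) f'(1) g'(1) by metis
qed

end

definition inv_arr :: "('o, 'a) cat \<Rightarrow> 'a \<Rightarrow> 'a" where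
  "inv_arr C f = (SOME g. g \<in> hom C (Cod C f) (Dom C f) \<and>
     g \<cdot>\<^bsub>C\<^esub> f = Id C (Dom C f) \<and> f \<cdot>\<^bsub>C\<^esub> g = Id C (Cod C f))"

context category
begin

lemma inv_arr:
  assumes "is_iso C f" "f \<in> hom C X Y"
  shows "inv_arr C f \<in> hom C Y X" "inv_arr C f \<cdot> f = Id C X" "f \<cdot> inv_arr C f = Id C Y"
proof -
  have "\<exists>g. g \<in> hom C (Cod C f) (Dom C f) \<and> g \<cdot> f = Id C (Dom C f) \<and> f \<cdot> g = Id C (Cod C f)"
    using assms(1) unfolding is_iso_def by blast
  from someI_ex[OF this] assms(2)
  show "inv_arr C f \<in> hom C Y X" "inv_arr C f \<cdot> f = Id C X" "f \<cdot> inv_arr C f = Id C Y"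
    unfolding inv_arr_def by (auto simp: homD)
qed

lemma inv_arr_iso:
  assumes "is_iso C f" "f \<in> hom C X Y"
  shows "is_iso C (inv_arr C f)"
  using inv_arr[OF assms] assms(2) is_isoI by metis

text \<open>The Yoneda argument: a preimage of the identity is a left inverse, and it is a right
  inverse because precomposition with the given arrow is injective.\<close>

lemma iso_if_precomposition_bij:
  assumes f: "f \<in> hom C X Y"
    and surj: "\<exists>g\<in>hom C Y X. g \<cdot> f = Id C X"
    and inj: "\<And>g g'. g \<in> hom C Y Y \<Longrightarrow> g' \<in> hom C Y Y \<Longrightarrow> g \<cdot> f = g' \<cdot> f \<Longrightarrow> g = g'"
  shows "is_iso C f"
proof -
  obtain g where g: "g \<in> hom C Y X" "g \<cdot> f = Id C X" using surj by blast
  have "(f \<cdot> g) \<cdot> f = Id C Y \<cdot> f"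
    using assoc[OF f g(1) f] g(2) id_right[OF f] id_left[OF f] by simp
  then have "f \<cdot> g = Id C Y" using inj comp_hom[OF g(1) f] id_hom homD(5)[OF f] by blast
  then show ?thesis using is_isoI f g by blast
qed

end

lemma full_sub_simps [simp]:
  "Obj (full_sub C P) = Obj C \<inter> P"
  "Arr (full_sub C P) = {f \<in> Arr C. Dom C f \<in> P \<and> Cod C f \<in> P}"
  "Dom (full_sub C P) = Dom C" "Cod (full_sub C P) = Cod C"
  "Id (full_sub C P) = Id C" "Comp (full_sub C P) = Comp C"
  by (simp_all add: full_sub_def)

lemma full_sub_UNIV: "full_sub C UNIV = C"
  by (simp add: full_sub_def)

lemma hom_full_sub: "X \<in> P \<Longrightarrow> Y \<in> P \<Longrightarrow> hom (full_sub C P) X Y = hom C X Y"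
  by (auto simp: hom_def)

lemma hom_full_subD: "f \<in> hom (full_sub C P) X Y \<Longrightarrow> f \<in> hom C X Y \<and> X \<in> P \<and> Y \<in> P"
  by (auto simp: hom_def)

lemma (in category) full_sub_category: "category (full_sub C P)"
proof
  fix f X Y g Z assume "f \<in> hom (full_sub C P) X Y" "g \<in> hom (full_sub C P) Y Z"
  then show "g \<cdot>\<^bsub>full_sub C P\<^esub> f \<in> hom (full_sub C P) X Z"
    using comp_hom[of f X Y g Z] by (auto dest!: hom_full_subD simp: hom_full_sub)
next
  fix X assume "X \<in> Obj (full_sub C P)"
  then show "Id (full_sub C P) X \<in> hom (full_sub C P) X X"
    using id_hom[of X] by (simp add: hom_full_sub)
qed (auto dest!: hom_full_subD intro: id_right id_left assoc simp: dom_obj cod_obj)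

lemma (in category) inclusion_functor:
  assumes "P \<subseteq> P'"
  shows "is_functor (full_sub C P) (full_sub C P') id_functor"
proof -
  interpret A: category "full_sub C P" by (rule full_sub_category)
  interpret B: category "full_sub C P'" by (rule full_sub_category)
  show ?thesis using assms by unfold_locales (auto simp: id_functor_def hom_def)
qed

lemma (in category) full_inclusion_functor: "is_functor (full_sub C P) C id_functor"
proof -
  interpret A: category "full_sub C P" by (rule full_sub_category)
  show ?thesis by unfold_locales (auto simp: id_functor_def hom_def)
qed

lemma (in category) id_functor: "is_functor C C id_functor"
  by unfold_locales (auto simp: id_functor_def)

lemma comp_functor_simps [simp]:
  "fo (G \<circ>\<^sub>F F) X = fo G (fo F X)" "fa (G \<circ>\<^sub>F F) f = fa G (fa F f)"
  by (simp_all add: comp_functor_def)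

lemma id_functor_simps [simp]: "fo id_functor X = X" "fa id_functor f = f"
  by (simp_all add: id_functor_def)

lemma comp_functor_assoc: "(H \<circ>\<^sub>F G) \<circ>\<^sub>F F = H \<circ>\<^sub>F (G \<circ>\<^sub>F F)"
  by (simp add: comp_functor_def o_assoc)

lemma comp_is_functor:
  assumes "is_functor A B F" "is_functor B C G"
  shows "is_functor A C (G \<circ>\<^sub>F F)"
proof -
  interpret F: is_functor A B F by fact
  interpret G: is_functor B C G by fact
  show ?thesis
  proof unfold_locales
    fix X Y Z f g assume f: "f \<in> hom A X Y" and g: "g \<in> hom A Y Z"
    show "fa (G \<circ>\<^sub>F F) (g \<cdot>\<^bsub>A\<^esub> f) = fa (G \<circ>\<^sub>F F) g \<cdot>\<^bsub>C\<^esub> fa (G \<circ>\<^sub>F F) f"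
      using F.fa_comp[OF f g] G.fa_comp F.fa_hom[OF f] F.fa_hom[OF g] by simp
  qed (simp_all add: F.fo_obj G.fo_obj F.fa_hom G.fa_hom F.fa_id G.fa_id)
qed

context is_functor
begin

lemma preserves_iso:
  assumes "is_iso A f"
  shows "is_iso B (fa F f)"
proof -
  have f: "f \<in> hom A (Dom A f) (Cod A f)" using assms by (auto simp: is_iso_def A.arr_in_hom)
  obtain g where g: "g \<in> hom A (Cod A f) (Dom A f)" "g \<cdot>\<^bsub>A\<^esub> f = Id A (Dom A f)"
    "f \<cdot>\<^bsub>A\<^esub> g = Id A (Cod A f)" using A.is_isoE[OF assms f] .
  show ?thesis
    by (rule B.is_isoI[OF fa_hom[OF f] fa_hom[OF g(1)]])
      (use fa_comp[OF f g(1)] fa_comp[OF g(1) f] g fa_id A.homD[OF f] in simp_all)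
qed

end

lemma unique_factorizationD:
  assumes "is_unique_factorization C D E P F H"
  shows "is_functor C D P" "is_functor C E F" "is_functor D E H"
    and "X \<in> Obj C \<Longrightarrow> fo H (fo P X) = fo F X" and "f \<in> Arr C \<Longrightarrow> fa H (fa P f) = fa F f"
proof -
  have *: "is_functor C D P \<and> is_functor C E F \<and> is_functor D E H \<and> functor_eq C (H \<circ>\<^sub>F P) F"
    using assms unfolding is_unique_factorization_def by blast
  then show "is_functor C D P" "is_functor C E F" "is_functor D E H" by blast+
  show "X \<in> Obj C \<Longrightarrow> fo H (fo P X) = fo F X" "f \<in> Arr C \<Longrightarrow> fa H (fa P f) = fa F f"
    using * by (simp_all add: functor_eq_def)
qed

section \<open>Gabriel-Zisman localization\<close>

context category
begin

lemma zigzag_obj: "zigzag C S X w Y \<Longrightarrow> X \<in> Obj C \<and> Y \<in> Obj C"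
  by (induction rule: zigzag.induct) (auto dest: homD)

lemma zigzag_append:
  "zigzag C S X v Y \<Longrightarrow> zigzag C S Y w Z \<Longrightarrow> zigzag C S X (v @ w) Z"
  by (induction rule: zigzag.induct) (auto intro: zigzag.intros)

lemma zigzag_Fwd: "f \<in> hom C X Y \<Longrightarrow> zigzag C S X [Fwd f] Y"
  by (auto intro!: zigzag.intros dest: homD)

lemma zigzag_Bwd: "s \<in> hom C X Y \<Longrightarrow> s \<in> S \<Longrightarrow> zigzag C S Y [Bwd s] X"
  by (auto intro!: zigzag.intros dest: homD)

lemma zigzag_eq_zigzag: "zigzag_eq C S X Y v w \<Longrightarrow> zigzag C S X v Y \<and> zigzag C S X w Y"
proof (induction rule: zigzag_eq.induct)
  case (comp f X Y g Z)
  then show ?case by (auto intro!: zigzag.intros comp_hom dest: homD)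
qed (auto intro: zigzag_append zigzag_Fwd zigzag_Bwd zigzag.intros id_hom dest: homD)

lemma zigzag_class_eq:
  assumes "zigzag_eq C S X Y v w"
  shows "zigzag_class C S X v Y = zigzag_class C S X w Y"
proof -
  have "zigzag_eq C S X Y v u \<longleftrightarrow> zigzag_eq C S X Y w u" for u
    using zigzag_eq.trans[OF zigzag_eq.sym[OF assms]] zigzag_eq.trans[OF assms] by blast
  then show ?thesis by (simp add: zigzag_class_def)
qed

lemma localization_hom:
  "hom (localization C S) X Y = {zigzag_class C S X w Y |w. zigzag C S X w Y}"
  by (auto simp: hom_def localization_def zigzag_class_def)

lemma localization_simps [simp]:
  "Obj (localization C S) = Obj C" "Id (localization C S) X = zigzag_class C S X [] X"
  "fo (localization_functor C S) X = X"
  by (simp_all add: localization_def localization_functor_def)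

text \<open>The representatives chosen by the composition are equivalent to \<open>v\<close> and \<open>w\<close>, and the
  equivalence is compatible with concatenation.\<close>

lemma localization_comp:
  assumes v: "zigzag C S X v Y" and w: "zigzag C S Y w Z"
  shows "zigzag_class C S Y w Z \<cdot>\<^bsub>localization C S\<^esub> zigzag_class C S X v Y
    = zigzag_class C S X (v @ w) Z"
proof -
  define v' where "v' = (SOME u. u \<in> {u. zigzag_eq C S X Y v u})"
  define w' where "w' = (SOME u. u \<in> {u. zigzag_eq C S Y Z w u})"
  have "zigzag_eq C S X Y v v'" "zigzag_eq C S Y Z w w'"
    unfolding v'_def w'_def using zigzag_eq.refl[OF v] zigzag_eq.refl[OF w]
    by (simp_all add: someI[of "zigzag_eq C S X Y v"] someI[of "zigzag_eq C S Y Z w"])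
  then have "zigzag_class C S X (v' @ w') Z = zigzag_class C S X (v @ w) Z"
    by (intro zigzag_class_eq zigzag_eq.sym[OF zigzag_eq.append])
  then show ?thesis
    by (simp add: localization_def zigzag_class_def v'_def w'_def)
qed

lemma zigzag_class_hom:
  "zigzag C S X w Y \<Longrightarrow> zigzag_class C S X w Y \<in> hom (localization C S) X Y"
  by (auto simp: localization_hom)

lemma localization_homE:
  assumes "a \<in> hom (localization C S) X Y"
  obtains w where "zigzag C S X w Y" "a = zigzag_class C S X w Y"
  using assms by (auto simp: localization_hom)

lemma localization_category: "category (localization C S)"
proof
  let ?L = "localization C S"
  fix f assume "f \<in> Arr ?L"
  then show "Dom ?L f \<in> Obj ?L" "Cod ?L f \<in> Obj ?L"
    by (auto simp: localization_def zigzag_class_def dest: zigzag_obj)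
next
  let ?L = "localization C S"
  fix X assume "X \<in> Obj ?L"
  then show "Id ?L X \<in> hom ?L X X" by (auto intro: zigzag_class_hom zigzag.nil)
next
  let ?L = "localization C S"
  fix f X Y assume "f \<in> hom ?L X Y"
  then obtain w where w: "zigzag C S X w Y" "f = zigzag_class C S X w Y" by (rule localization_homE)
  note nil = zigzag.nil[of X C S] zigzag.nil[of Y C S]
  show "f \<cdot>\<^bsub>?L\<^esub> Id ?L X = f" "Id ?L Y \<cdot>\<^bsub>?L\<^esub> f = f"
    using w nil zigzag_obj[OF w(1)] by (simp_all add: localization_comp)
next
  let ?L = "localization C S"
  fix f X Y g Z assume "f \<in> hom ?L X Y" "g \<in> hom ?L Y Z"
  then show "g \<cdot>\<^bsub>?L\<^esub> f \<in> hom ?L X Z"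
    by (auto elim!: localization_homE simp: localization_comp intro!: zigzag_class_hom zigzag_append)
next
  let ?L = "localization C S"
  fix f W X Y g Z h assume "f \<in> hom ?L W X" "g \<in> hom ?L X Y" "h \<in> hom ?L Y Z"
  then show "(h \<cdot>\<^bsub>?L\<^esub> g) \<cdot>\<^bsub>?L\<^esub> f = h \<cdot>\<^bsub>?L\<^esub> g \<cdot>\<^bsub>?L\<^esub> f"
    by (auto elim!: localization_homE simp: localization_comp zigzag_append)
qed

lemma localization_functor_arr:
  "f \<in> hom C X Y \<Longrightarrow> fa (localization_functor C S) f = zigzag_class C S X [Fwd f] Y"
  by (simp add: localization_functor_def homD)

lemma localization_functor: "is_functor C (localization C S) (localization_functor C S)"
proof -
  interpret L: category "localization C S" by (rule localization_category)
  show ?thesis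
  proof unfold_locales
    fix f X Y g Z assume f: "f \<in> hom C X Y" and g: "g \<in> hom C Y Z"
    show "fa (localization_functor C S) (g \<cdot> f) =
      fa (localization_functor C S) g \<cdot>\<^bsub>localization C S\<^esub> fa (localization_functor C S) f"
      using f g comp_hom[OF f g] zigzag_class_eq[OF zigzag_eq.comp[OF f g, of S]]
      by (simp add: localization_functor_arr localization_comp zigzag_Fwd)
  next
    fix X assume X: "X \<in> Obj C"
    show "fa (localization_functor C S) (Id C X) = Id (localization C S) (fo (localization_functor C S) X)"
      using X id_hom[OF X] zigzag_class_eq[OF zigzag_eq.ident[OF X]]
      by (simp add: localization_functor_arr)
  qed (auto simp: localization_functor_arr intro: zigzag_class_hom zigzag_Fwd)
qed

lemma localization_inverse:
  assumes s: "s \<in> hom C X Y" "s \<in> S"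
  defines "\<gamma>s \<equiv> fa (localization_functor C S) s" and "b \<equiv> zigzag_class C S Y [Bwd s] X"
  shows "\<gamma>s \<in> hom (localization C S) X Y" "b \<in> hom (localization C S) Y X"
    "b \<cdot>\<^bsub>localization C S\<^esub> \<gamma>s = Id (localization C S) X"
    "\<gamma>s \<cdot>\<^bsub>localization C S\<^esub> b = Id (localization C S) Y"
  using s zigzag_class_eq[OF zigzag_eq.inv_right[OF s]] zigzag_class_eq[OF zigzag_eq.inv_left[OF s]]
  by (simp_all add: \<gamma>s_def b_def localization_functor_arr localization_comp zigzag_Fwd zigzag_Bwd
      zigzag_class_hom)

lemma localization_inverts:
  assumes "s \<in> hom C X Y" "s \<in> S"
  shows "is_iso (localization C S) (fa (localization_functor C S) s)"
  using category.is_isoI[OF localization_category] localization_inverse[OF assms] by metis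

text \<open>A localization is generated by the images of the arrows and by the formal inverses;
  uniqueness of extensions and naturality can therefore be tested on the images.\<close>

lemma localization_induct [consumes 1, case_names ident arr inv comp]:
  assumes a: "a \<in> hom (localization C S) X Y"
    and ident: "\<And>X. X \<in> Obj C \<Longrightarrow> P X X (Id (localization C S) X)"
    and arr: "\<And>f X Y. f \<in> hom C X Y \<Longrightarrow> P X Y (fa (localization_functor C S) f)"
    and inv: "\<And>s b X Y. s \<in> hom C X Y \<Longrightarrow> s \<in> S \<Longrightarrow> b \<in> hom (localization C S) Y X \<Longrightarrow>
      b \<cdot>\<^bsub>localization C S\<^esub> fa (localization_functor C S) s = Id (localization C S) X \<Longrightarrow>
      fa (localization_functor C S) s \<cdot>\<^bsub>localization C S\<^esub> b = Id (localization C S) Y \<Longrightarrow> P Y X b"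
    and comp: "\<And>a b X Y Z. a \<in> hom (localization C S) X Y \<Longrightarrow> b \<in> hom (localization C S) Y Z \<Longrightarrow>
      P X Y a \<Longrightarrow> P Y Z b \<Longrightarrow> P X Z (b \<cdot>\<^bsub>localization C S\<^esub> a)"
  shows "P X Y a"
proof -
  have "P X Y (zigzag_class C S X w Y)" if "zigzag C S X w Y" for w
    using that
  proof (induction rule: zigzag.induct)
    case (nil X)
    then show ?case using ident by simp
  next
    case (fwd f X Y w Z)
    have "P X Y (zigzag_class C S X [Fwd f] Y)"
      using arr[OF fwd(1)] by (simp add: localization_functor_arr[OF fwd(1)])
    from comp[OF _ _ this fwd(3)] show ?case
      using localization_comp[OF zigzag_Fwd[OF fwd(1)] fwd(2)] zigzag_Fwd[OF fwd(1)] fwd(2)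
      by (simp add: zigzag_class_hom)
  next
    case (bwd s Y X w Z)
    have "P X Y (zigzag_class C S X [Bwd s] Y)"
      using inv[OF bwd(1,2)] localization_inverse[OF bwd(1,2)] by blast
    from comp[OF _ _ this bwd(4)] show ?case
      using localization_comp[OF zigzag_Bwd[OF bwd(1,2)] bwd(3)] zigzag_Bwd[OF bwd(1,2)] bwd(3)
      by (simp add: zigzag_class_hom)
  qed
  then show ?thesis using a by (auto elim: localization_homE)
qed

end

text \<open>The end point \<open>Y\<close> is a parameter because an empty zigzag does not determine it.\<close>

primrec zigzag_value ::
    "('p, 'b) cat \<Rightarrow> ('o, 'a, 'p, 'b) ftor \<Rightarrow> 'o \<Rightarrow> 'a step list \<Rightarrow> 'b" where
  "zigzag_value E F Y [] = Id E (fo F Y)"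
| "zigzag_value E F Y (x # w) = zigzag_value E F Y w \<cdot>\<^bsub>E\<^esub>
     (case x of Fwd f \<Rightarrow> fa F f | Bwd s \<Rightarrow> inv_arr E (fa F s))"

locale inverting_functor = is_functor A B F
  for A :: "('o, 'a) cat" and B :: "('p, 'b) cat" and F +
  fixes S :: "'a set"
  assumes inverts: "s \<in> Arr A \<Longrightarrow> s \<in> S \<Longrightarrow> is_iso B (fa F s)"
begin

lemma inverse:
  assumes "s \<in> hom A X Y" "s \<in> S"
  shows "inv_arr B (fa F s) \<in> hom B (fo F Y) (fo F X)"
    "inv_arr B (fa F s) \<cdot>\<^bsub>B\<^esub> fa F s = Id B (fo F X)"
    "fa F s \<cdot>\<^bsub>B\<^esub> inv_arr B (fa F s) = Id B (fo F Y)"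
  using B.inv_arr[OF inverts[OF A.homD(1)[OF assms(1)] assms(2)] fa_hom[OF assms(1)]] .

lemma value_hom: "zigzag A S X w Y \<Longrightarrow> zigzag_value B F Y w \<in> hom B (fo F X) (fo F Y)"
  by (induction rule: zigzag.induct) (auto intro: B.id_hom fo_obj B.comp_hom fa_hom inverse)

lemma value_append:
  "zigzag A S X v Y \<Longrightarrow> zigzag A S Y w Z \<Longrightarrow>
    zigzag_value B F Z (v @ w) = zigzag_value B F Z w \<cdot>\<^bsub>B\<^esub> zigzag_value B F Y v"
proof (induction rule: zigzag.induct)
  case (nil X)
  then show ?case using B.id_right value_hom by fastforce
next
  case (fwd f X Y w' Z')
  then show ?case using B.assoc[OF fa_hom[OF fwd(1)] value_hom[OF fwd(2)] value_hom[OF fwd(4)]] by simp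
next
  case (bwd s Y X w' Z')
  then show ?case using B.assoc[OF inverse(1)[OF bwd(1,2)] value_hom[OF bwd(3)] value_hom[OF bwd(5)]] by simp
qed

lemma value_eq: "zigzag_eq A S X Y v w \<Longrightarrow> zigzag_value B F Y v = zigzag_value B F Y w"
proof (induction rule: zigzag_eq.induct)
  case (append X Y v v' Z w w')
  then show ?case using value_append A.zigzag_eq_zigzag by metis
next
  case (ident X)
  then show ?case using fa_id B.id_right[OF B.id_hom[OF fo_obj[OF ident]]] by simp
next
  case (comp f X Y g Z)
  have "fo F Z \<in> Obj B" using A.homD(5)[OF comp(2)] fo_obj by blast
  then show ?case
    using comp fa_comp[OF comp] fa_hom B.id_left B.assoc[OF fa_hom[OF comp(1)] fa_hom[OF comp(2)] B.id_hom]
      B.comp_hom by simp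
next
  case (inv_right s X Y)
  then show ?case using inverse[OF inv_right] B.id_left by simp
next
  case (inv_left s X Y)
  then show ?case using fa_hom[OF inv_left(1)] inverse[OF inv_left] B.id_left by simp
qed auto

definition extension :: "('o, 'o \<times> 'a step list set \<times> 'o, 'p, 'b) ftor" where
  "extension = \<lparr>fo = fo F, fa = (\<lambda>(X, c, Y). zigzag_value B F Y (SOME w. w \<in> c))\<rparr>"

lemma extension_class:
  assumes "zigzag A S X w Y"
  shows "fa extension (zigzag_class A S X w Y) = zigzag_value B F Y w"
proof -
  have "zigzag_eq A S X Y w (SOME w'. w' \<in> {w'. zigzag_eq A S X Y w w'})"
    using zigzag_eq.refl[OF assms] by (simp add: someI[of "zigzag_eq A S X Y w"])
  from value_eq[OF this] show ?thesis by (simp add: extension_def zigzag_class_def)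
qed

lemma extension_functor: "is_functor (localization A S) B extension"
proof -
  interpret L: category "localization A S" by (rule A.localization_category)
  have [simp]: "fo extension X = fo F X" for X by (simp add: extension_def)
  show ?thesis
    by unfold_locales
      (auto elim!: A.localization_homE simp: A.localization_comp extension_class A.zigzag_append
        value_append zigzag.nil intro: value_hom fo_obj)
qed

text \<open>The extension is unique because a functor preserves inverses, so that its values on the
  formal inverses are determined.\<close>

lemma extension_factorization:
  "is_unique_factorization A (localization A S) B (localization_functor A S) F extension"
proof -
  interpret L: category "localization A S" by (rule A.localization_category)
  interpret \<gamma>: is_functor A "localization A S" "localization_functor A S"
    by (rule A.localization_functor)
  interpret X: is_functor "localization A S" B extension by (rule extension_functor)
  have eq: "functor_eq A (extension \<circ>\<^sub>F localization_functor A S) F"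
    unfolding functor_eq_def
  proof (intro conjI ballI)
    fix f assume "f \<in> Arr A"
    note f = A.arr_in_hom[OF this]
    show "fa (extension \<circ>\<^sub>F localization_functor A S) f = fa F f"
      using f B.id_left[OF fa_hom[OF f]]
      by (simp add: A.localization_functor_arr[OF f] extension_class[OF A.zigzag_Fwd[OF f]])
  qed (simp add: extension_def)
  have "functor_eq (localization A S) H extension"
    if H: "is_functor (localization A S) B H" "functor_eq A (H \<circ>\<^sub>F localization_functor A S) F" for H
  proof -
    interpret H: is_functor "localization A S" B H by fact
    have ob: "fo H X = fo extension X" if "X \<in> Obj A" for X
      using that H(2) by (simp add: functor_eq_def extension_def)
    have fa_eq: "fa H a = fa extension a" if "a \<in> hom (localization A S) X Y" for a X Y
      using that
    proof (induction rule: A.localization_induct)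
      case (ident X)
      then show ?case using H.fa_id[of X] X.fa_id[of X] ob[OF ident] by simp
    next
      case (arr f X Y)
      then show ?case using H(2) eq A.homD(1)[OF arr] by (simp add: functor_eq_def)
    next
      case (inv s b X Y)
      let ?s = "fa (localization_functor A S) s"
      have s: "?s \<in> hom (localization A S) X Y" using A.localization_inverse(1)[OF inv(1,2)] .
      note o = ob[OF A.homD(4)[OF inv(1)]] ob[OF A.homD(5)[OF inv(1)]]
      have same: "fa H ?s = fa extension ?s"
        using H(2) eq A.homD(1)[OF inv(1)] by (simp add: functor_eq_def)
      show ?case
      proof (rule B.iso_cancel_right)
        show "is_iso B (fa extension ?s)"
          using X.preserves_iso[OF A.localization_inverts[OF inv(1,2)]] .
        show "fa extension ?s \<in> hom B (fo extension X) (fo extension Y)" using X.fa_hom[OF s] .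
        show "fa H b \<in> hom B (fo extension Y) (fo extension X)" using H.fa_hom[OF inv(3)] o by simp
        show "fa extension b \<in> hom B (fo extension Y) (fo extension X)" using X.fa_hom[OF inv(3)] .
        have "fa H b \<cdot>\<^bsub>B\<^esub> fa H ?s = fa extension b \<cdot>\<^bsub>B\<^esub> fa extension ?s"
          using H.fa_comp[OF s inv(3)] X.fa_comp[OF s inv(3)] inv(4) H.fa_id X.fa_id o A.homD(4)[OF inv(1)]
          by simp
        then show "fa H b \<cdot>\<^bsub>B\<^esub> fa extension ?s = fa extension b \<cdot>\<^bsub>B\<^esub> fa extension ?s"
          using same by simp
      qed
    next
      case (comp a b X Y Z)
      then show ?case using H.fa_comp X.fa_comp by metis
    qed
    then have "\<forall>a\<in>Arr (localization A S). fa H a = fa extension a" using L.arr_in_hom by blast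
    then show ?thesis using ob by (simp add: functor_eq_def)
  qed
  then show ?thesis
    unfolding is_unique_factorization_def
    using eq X.is_functor_axioms is_functor_axioms \<gamma>.is_functor_axioms by blast
qed

end

lemma (in category) localization_factorization:
  assumes "is_functor C E F" "\<And>s. s \<in> Arr C \<Longrightarrow> s \<in> S \<Longrightarrow> is_iso E (fa F s)"
  shows "\<exists>H. is_unique_factorization C (localization C S) E (localization_functor C S) F H"
proof -
  interpret inverting_functor C E F S
    using assms by (simp add: inverting_functor_def inverting_functor_axioms_def)
  show ?thesis using extension_factorization by blast
qed

text \<open>The naturality square of a formal inverse follows from the one of the inverted arrow by
  cancelling the isomorphic image of that arrow.\<close>

lemma (in category) natural_on_localization:
  assumes F: "is_functor (localization C S) E F" and G: "is_functor (localization C S) E G"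
    and t: "\<And>X. X \<in> Obj C \<Longrightarrow> t X \<in> hom E (fo F X) (fo G X)"
    and iso: "\<And>X. X \<in> Obj C \<Longrightarrow> is_iso E (t X)"
    and nat: "\<And>f X Y. f \<in> hom C X Y \<Longrightarrow>
      t Y \<cdot>\<^bsub>E\<^esub> fa F (fa (localization_functor C S) f) = fa G (fa (localization_functor C S) f) \<cdot>\<^bsub>E\<^esub> t X"
  shows "naturally_isomorphic (localization C S) E F G"
proof -
  interpret F: is_functor "localization C S" E F by fact
  interpret G: is_functor "localization C S" E G by fact
  have natural: "t Y \<cdot>\<^bsub>E\<^esub> fa F a = fa G a \<cdot>\<^bsub>E\<^esub> t X" if "a \<in> hom (localization C S) X Y" for a X Y
    using that
  proof (induction rule: localization_induct)
    case (ident X)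
    then show ?case using F.fa_id[of X] G.fa_id[of X] F.B.id_left[OF t] F.B.id_right[OF t] by simp
  next
    case (arr f X Y)
    then show ?case by (rule nat)
  next
    case (inv s b X Y)
    let ?s = "fa (localization_functor C S) s"
    have s: "?s \<in> hom (localization C S) X Y" using localization_inverse(1)[OF inv(1,2)] .
    have tX: "t X \<in> hom E (fo F X) (fo G X)" and tY: "t Y \<in> hom E (fo F Y) (fo G Y)"
      using t homD(4,5)[OF inv(1)] by auto
    have isoF: "is_iso E (fa F ?s)" using F.preserves_iso[OF localization_inverts[OF inv(1,2)]] .
    have "(t X \<cdot>\<^bsub>E\<^esub> fa F b) \<cdot>\<^bsub>E\<^esub> fa F ?s = t X"
      using F.B.assoc[OF F.fa_hom[OF s] F.fa_hom[OF inv(3)] tX] F.fa_comp[OF s inv(3)] inv(4)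
        F.fa_id[of X] homD(4)[OF inv(1)] F.B.id_right[OF tX] by simp
    moreover have "(fa G b \<cdot>\<^bsub>E\<^esub> t Y) \<cdot>\<^bsub>E\<^esub> fa F ?s = fa G b \<cdot>\<^bsub>E\<^esub> (fa G ?s \<cdot>\<^bsub>E\<^esub> t X)"
      using F.B.assoc[OF F.fa_hom[OF s] tY G.fa_hom[OF inv(3)]] nat[OF inv(1)] by simp
    moreover have "\<dots> = t X"
      using F.B.assoc[OF tX G.fa_hom[OF s] G.fa_hom[OF inv(3)]] G.fa_comp[OF s inv(3)] inv(4)
        G.fa_id[of X] homD(4)[OF inv(1)] F.B.id_left[OF tX] by simp
    ultimately show ?case
      using F.B.iso_cancel_right[OF isoF F.fa_hom[OF s]] F.B.comp_hom[OF F.fa_hom[OF inv(3)] tX]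
        F.B.comp_hom[OF tY G.fa_hom[OF inv(3)]] by simp
  next
    case (comp a b X Y Z)
    have tX: "t X \<in> hom E (fo F X) (fo G X)" and tY: "t Y \<in> hom E (fo F Y) (fo G Y)"
      and tZ: "t Z \<in> hom E (fo F Z) (fo G Z)"
      using t F.A.homD(4,5)[OF comp(1)] F.A.homD(5)[OF comp(2)] by auto
    have "t Z \<cdot>\<^bsub>E\<^esub> fa F (b \<cdot>\<^bsub>localization C S\<^esub> a) = (t Z \<cdot>\<^bsub>E\<^esub> fa F b) \<cdot>\<^bsub>E\<^esub> fa F a"
      using F.fa_comp[OF comp(1,2)] F.B.assoc[OF F.fa_hom[OF comp(1)] F.fa_hom[OF comp(2)] tZ] by simp
    also have "\<dots> = fa G b \<cdot>\<^bsub>E\<^esub> (t Y \<cdot>\<^bsub>E\<^esub> fa F a)"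
      using comp(4) F.B.assoc[OF F.fa_hom[OF comp(1)] tY G.fa_hom[OF comp(2)]] by simp
    also have "\<dots> = fa G (b \<cdot>\<^bsub>localization C S\<^esub> a) \<cdot>\<^bsub>E\<^esub> t X"
      using comp(3) F.B.assoc[OF tX G.fa_hom[OF comp(1)] G.fa_hom[OF comp(2)]] G.fa_comp[OF comp(1,2)]
      by simp
    finally show ?case .
  qed
  show ?thesis
    unfolding naturally_isomorphic_def
  proof (intro conjI exI[of _ t] ballI)
    fix a assume "a \<in> Arr (localization C S)"
    then show "t (Cod (localization C S) a) \<cdot>\<^bsub>E\<^esub> fa F a = fa G a \<cdot>\<^bsub>E\<^esub> t (Dom (localization C S) a)"
      using natural F.A.arr_in_hom by blast
  qed (use F G t iso in auto)
qed

section \<open>Quotients by congruences\<close>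

locale arrow_congruence = category C for C :: "('o, 'a) cat" (structure) +
  fixes E :: "'a rel"
  assumes cong_refl: "f \<in> Arr C \<Longrightarrow> (f, f) \<in> E"
    and cong_sym: "(f, g) \<in> E \<Longrightarrow> (g, f) \<in> E"
    and cong_trans: "(f, g) \<in> E \<Longrightarrow> (g, h) \<in> E \<Longrightarrow> (f, h) \<in> E"
    and cong_parallel: "(f, g) \<in> E \<Longrightarrow> f \<in> hom C X Y \<Longrightarrow> g \<in> hom C X Y"
    and cong_comp: "(f, f') \<in> E \<Longrightarrow> f \<in> hom C X Y \<Longrightarrow> (g, g') \<in> E \<Longrightarrow> g \<in> hom C Y Z \<Longrightarrow>
      (g \<cdot> f, g' \<cdot> f') \<in> E"
begin

lemma class_eq_iff:
  assumes "f \<in> Arr C" "g \<in> Arr C"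
  shows "quotient_class C E f = quotient_class C E g \<longleftrightarrow> (f, g) \<in> E"
  using assms cong_refl cong_sym cong_trans unfolding quotient_class_def by blast

lemma representative:
  assumes "f \<in> hom C X Y"
  defines "f' \<equiv> SOME g. g \<in> quotient_class C E f"
  shows "(f, f') \<in> E" "f' \<in> hom C X Y"
proof -
  have "f \<in> quotient_class C E f" using homD(1)[OF assms(1)] cong_refl by (simp add: quotient_class_def)
  then have "f' \<in> quotient_class C E f" unfolding f'_def by (rule someI)
  then show "(f, f') \<in> E" by (simp add: quotient_class_def)
  then show "f' \<in> hom C X Y" using cong_parallel assms(1) by blast
qed

lemma quotient_simps [simp]:
  "Obj (quotient_cat C E) = Obj C" "Id (quotient_cat C E) X = quotient_class C E (Id C X)"
  "fo (quotient_functor C E) X = X" "fa (quotient_functor C E) f = quotient_class C E f"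
  by (simp_all add: quotient_cat_def quotient_functor_def)

lemma quotient_hom: "hom (quotient_cat C E) X Y = quotient_class C E ` hom C X Y"
proof -
  have "Dom (quotient_cat C E) (quotient_class C E f) = Dom C f"
    "Cod (quotient_cat C E) (quotient_class C E f) = Cod C f" if "f \<in> Arr C" for f
    using homD(2,3)[OF representative(2)[OF arr_in_hom[OF that]]] by (simp_all add: quotient_cat_def)
  moreover have "Arr (quotient_cat C E) = quotient_class C E ` Arr C" by (simp add: quotient_cat_def)
  ultimately show ?thesis unfolding hom_def by auto
qed

lemma quotient_homI: "f \<in> hom C X Y \<Longrightarrow> quotient_class C E f \<in> hom (quotient_cat C E) X Y"
  by (simp add: quotient_hom)

lemma quotient_comp:
  assumes f: "f \<in> hom C X Y" and g: "g \<in> hom C Y Z"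
  shows "quotient_class C E g \<cdot>\<^bsub>quotient_cat C E\<^esub> quotient_class C E f = quotient_class C E (g \<cdot> f)"
proof -
  note r = representative[OF f] representative[OF g]
  have "(g \<cdot> f, (SOME h. h \<in> quotient_class C E g) \<cdot> (SOME h. h \<in> quotient_class C E f)) \<in> E"
    using cong_comp[OF r(1) f r(3) g] .
  then have "((SOME h. h \<in> quotient_class C E g) \<cdot> (SOME h. h \<in> quotient_class C E f), g \<cdot> f) \<in> E"
    by (rule cong_sym)
  moreover have "g \<cdot> f \<in> Arr C"
    "(SOME h. h \<in> quotient_class C E g) \<cdot> (SOME h. h \<in> quotient_class C E f) \<in> Arr C"
    using homD(1)[OF comp_hom[OF f g]] homD(1)[OF comp_hom[OF r(2) r(4)]] by blast+
  ultimately show ?thesis using class_eq_iff by (simp add: quotient_cat_def)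
qed

lemma quotient_category: "category (quotient_cat C E)"
proof
  let ?Q = "quotient_cat C E"
  fix c assume "c \<in> Arr ?Q"
  then have "c \<in> hom ?Q (Dom ?Q c) (Cod ?Q c)" by (simp add: hom_def)
  then show "Dom ?Q c \<in> Obj ?Q" "Cod ?Q c \<in> Obj ?Q"
    by (auto simp: quotient_hom dest: homD)
next
  fix c X Y assume "c \<in> hom (quotient_cat C E) X Y"
  then obtain f where f: "f \<in> hom C X Y" "c = quotient_class C E f" by (auto simp: quotient_hom)
  then show "c \<cdot>\<^bsub>quotient_cat C E\<^esub> Id (quotient_cat C E) X = c"
    "Id (quotient_cat C E) Y \<cdot>\<^bsub>quotient_cat C E\<^esub> c = c"
    using quotient_comp[OF id_hom f(1)] quotient_comp[OF f(1) id_hom] homD[OF f(1)]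
      id_left[OF f(1)] id_right[OF f(1)] by simp_all
next
  fix c X Y d Z assume "c \<in> hom (quotient_cat C E) X Y" "d \<in> hom (quotient_cat C E) Y Z"
  then show "d \<cdot>\<^bsub>quotient_cat C E\<^esub> c \<in> hom (quotient_cat C E) X Z"
    unfolding quotient_hom using quotient_comp comp_hom by fastforce
next
  fix c W X d Y e Z
  assume "c \<in> hom (quotient_cat C E) W X" "d \<in> hom (quotient_cat C E) X Y"
    "e \<in> hom (quotient_cat C E) Y Z"
  then obtain f g h where f: "f \<in> hom C W X" "c = quotient_class C E f"
    and g: "g \<in> hom C X Y" "d = quotient_class C E g"
    and h: "h \<in> hom C Y Z" "e = quotient_class C E h" by (auto simp: quotient_hom)
  show "(e \<cdot>\<^bsub>quotient_cat C E\<^esub> d) \<cdot>\<^bsub>quotient_cat C E\<^esub> c =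
    e \<cdot>\<^bsub>quotient_cat C E\<^esub> d \<cdot>\<^bsub>quotient_cat C E\<^esub> c"
    using quotient_comp[OF f(1) g(1)] quotient_comp[OF g(1) h(1)]
      quotient_comp[OF f(1) comp_hom[OF g(1) h(1)]] quotient_comp[OF comp_hom[OF f(1) g(1)] h(1)]
      assoc[OF f(1) g(1) h(1)] f(2) g(2) h(2) by simp
next
  fix X assume "X \<in> Obj (quotient_cat C E)"
  then show "Id (quotient_cat C E) X \<in> hom (quotient_cat C E) X X"
    by (simp add: quotient_homI id_hom)
qed

lemma quotient_functor: "is_functor C (quotient_cat C E) (quotient_functor C E)"
proof -
  interpret Q: category "quotient_cat C E" by (rule quotient_category)
  show ?thesis by unfold_locales (auto simp: quotient_comp quotient_homI)
qed

lemma quotient_factorization: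
  assumes F: "is_functor C D F" and F_cong: "\<And>f g. (f, g) \<in> E \<Longrightarrow> f \<in> Arr C \<Longrightarrow> fa F f = fa F g"
  shows "\<exists>H. is_unique_factorization C (quotient_cat C E) D (quotient_functor C E) F H"
proof -
  interpret Q: category "quotient_cat C E" by (rule quotient_category)
  interpret F: is_functor C D F by fact
  define H where "H = \<lparr>fo = fo F, fa = (\<lambda>c. fa F (SOME f. f \<in> c))\<rparr>"
  have Hfo [simp]: "fo H X = fo F X" for X by (simp add: H_def)
  have H [simp]: "fa H (quotient_class C E f) = fa F f" if "f \<in> Arr C" for f
    using F_cong[OF representative(1)[OF arr_in_hom[OF that]] that] by (simp add: H_def)
  have "is_functor (quotient_cat C E) D H"
    by unfold_locales
      (auto simp: quotient_hom quotient_comp homD F.fo_obj F.fa_id F.fa_hom F.fa_comp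
        homD(1)[OF id_hom] homD(1)[OF comp_hom])
  moreover have "functor_eq C (H \<circ>\<^sub>F quotient_functor C E) F" by (simp add: functor_eq_def)
  moreover have "functor_eq (quotient_cat C E) H' H"
    if "functor_eq C (H' \<circ>\<^sub>F quotient_functor C E) F" for H'
    using that by (auto simp: functor_eq_def quotient_cat_def)
  ultimately show ?thesis
    unfolding is_unique_factorization_def using F quotient_functor by blast
qed

lemma natural_on_quotient:
  assumes F: "is_functor (quotient_cat C E) D F" and G: "is_functor (quotient_cat C E) D G"
    and t: "\<And>X. X \<in> Obj C \<Longrightarrow> t X \<in> hom D (fo F X) (fo G X)"
    and iso: "\<And>X. X \<in> Obj C \<Longrightarrow> is_iso D (t X)"
    and nat: "\<And>f X Y. f \<in> hom C X Y \<Longrightarrow>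
      t Y \<cdot>\<^bsub>D\<^esub> fa F (quotient_class C E f) = fa G (quotient_class C E f) \<cdot>\<^bsub>D\<^esub> t X"
  shows "naturally_isomorphic (quotient_cat C E) D F G"
  unfolding naturally_isomorphic_def
proof (intro conjI exI[of _ t] ballI)
  interpret Q: category "quotient_cat C E" by (rule quotient_category)
  fix c assume "c \<in> Arr (quotient_cat C E)"
  from Q.arr_in_hom[OF this] show "t (Cod (quotient_cat C E) c) \<cdot>\<^bsub>D\<^esub> fa F c =
    fa G c \<cdot>\<^bsub>D\<^esub> t (Dom (quotient_cat C E) c)"
    unfolding quotient_hom using nat by auto
qed (use F G t iso in auto)

end

lemma (in arrow_congruence) full_sub_congruence: "arrow_congruence (full_sub C P) E"
proof -
  interpret S: category "full_sub C P" by (rule full_sub_category)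
  show ?thesis
  proof
    show "(f, f') \<in> E \<Longrightarrow> f \<in> hom (full_sub C P) X Y \<Longrightarrow> (g, g') \<in> E \<Longrightarrow>
      g \<in> hom (full_sub C P) Y Z \<Longrightarrow> (g \<cdot>\<^bsub>full_sub C P\<^esub> f, g' \<cdot>\<^bsub>full_sub C P\<^esub> f') \<in> E" for f f' X Y g g' Z
      using cong_comp by (auto dest!: hom_full_subD)
    show "(f, g) \<in> E \<Longrightarrow> f \<in> hom (full_sub C P) X Y \<Longrightarrow> g \<in> hom (full_sub C P) X Y" for f g X Y
      using cong_parallel by (auto dest!: hom_full_subD simp: hom_full_sub)
  qed (auto intro: cong_refl cong_sym cong_trans)
qed

section \<open>Finite products and coproducts\<close>

definition discrete_cat :: "'u set \<Rightarrow> ('u, 'u) cat" where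
  "discrete_cat A = \<lparr>Obj = A, Arr = A, Dom = (\<lambda>x. x), Cod = (\<lambda>x. x), Id = (\<lambda>x. x), Comp = (\<lambda>x y. x)\<rparr>"

lemma discrete_cat_simps [simp]:
  "Obj (discrete_cat A) = A" "Arr (discrete_cat A) = A" "Dom (discrete_cat A) x = x"
  "Cod (discrete_cat A) x = x" "Id (discrete_cat A) x = x" "x \<cdot>\<^bsub>discrete_cat A\<^esub> y = x"
  by (simp_all add: discrete_cat_def)

text \<open>Products and coproducts are limits and colimits over discrete index categories. The index
  set lives in the type of the universe, which offers two distinct indices since it is infinite.\<close>

lemma finite_small: "finite A \<Longrightarrow> infinite U \<Longrightarrow> small U A"
  unfolding small_def
  by (rule Cfinite_ordLess_Cinfinite) (auto simp: cfinite_def cinfinite_def card_of_card_order_on Field_card_of)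

lemma infinite_two_elements:
  fixes U :: "'u set"
  assumes "infinite U"
  obtains a b :: 'u where "a \<noteq> b"
  using assms
  by (metis finite.simps infinite_imp_nonempty insertI1 is_singletonI' is_singleton_the_elem)

definition is_coproduct :: "('o, 'a) cat \<Rightarrow> 'o \<Rightarrow> 'o \<Rightarrow> 'o \<Rightarrow> 'a \<Rightarrow> 'a \<Rightarrow> bool" where
  "is_coproduct C X Y P i j \<longleftrightarrow> i \<in> hom C X P \<and> j \<in> hom C Y P \<and>
     (\<forall>T f g. f \<in> hom C X T \<and> g \<in> hom C Y T \<longrightarrow>
        (\<exists>!h. h \<in> hom C P T \<and> h \<cdot>\<^bsub>C\<^esub> i = f \<and> h \<cdot>\<^bsub>C\<^esub> j = g))"

context category
begin

lemma discrete_functor: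
  assumes "\<And>x. x \<in> A \<Longrightarrow> F x \<in> Obj C"
  shows "is_functor (discrete_cat A) C \<lparr>fo = F, fa = (\<lambda>x. Id C (F x))\<rparr>"
  by unfold_locales (use assms in \<open>auto simp: hom_def[of "discrete_cat A"] id_hom id_left[OF id_hom]\<close>)

lemma discrete_cone:
  "is_cone (discrete_cat A) C \<lparr>fo = F, fa = (\<lambda>x. Id C (F x))\<rparr> L p \<longleftrightarrow>
    L \<in> Obj C \<and> (\<forall>x\<in>A. p x \<in> hom C L (F x))"
  by (auto simp: is_cone_def id_left)

lemma discrete_cocone:
  "is_cocone (discrete_cat A) C \<lparr>fo = F, fa = (\<lambda>x. Id C (F x))\<rparr> L p \<longleftrightarrow>
    L \<in> Obj C \<and> (\<forall>x\<in>A. p x \<in> hom C (F x) L)"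
  by (auto simp: is_cocone_def id_right)

lemma finite_product_exists:
  fixes U A :: "'u set"
  assumes U: "complete U C" "infinite U" and A: "finite A" and F: "\<forall>x\<in>A. F x \<in> Obj C"
  shows "\<exists>L p. L \<in> Obj C \<and> (\<forall>x\<in>A. p x \<in> hom C L (F x)) \<and>
    (\<forall>T t. T \<in> Obj C \<and> (\<forall>x\<in>A. t x \<in> hom C T (F x)) \<longrightarrow>
      (\<exists>!h. h \<in> hom C T L \<and> (\<forall>x\<in>A. p x \<cdot> h = t x)))"
proof -
  let ?D = "\<lparr>fo = F, fa = (\<lambda>x. Id C (F x))\<rparr>"
  have "is_functor (discrete_cat A) C ?D" using F by (intro discrete_functor) blast
  moreover have "small U (Arr (discrete_cat A))"
    using finite_small[OF A U(2)] by simp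
  ultimately obtain L p where "is_limit (discrete_cat A) C ?D L p"
    using U(1) unfolding complete_def by blast
  then show ?thesis unfolding is_limit_def discrete_cone discrete_cat_simps by blast
qed

lemma finite_coproduct_exists:
  fixes U A :: "'u set"
  assumes U: "cocomplete U C" "infinite U" and A: "finite A" and F: "\<forall>x\<in>A. F x \<in> Obj C"
  shows "\<exists>L p. L \<in> Obj C \<and> (\<forall>x\<in>A. p x \<in> hom C (F x) L) \<and>
    (\<forall>T t. T \<in> Obj C \<and> (\<forall>x\<in>A. t x \<in> hom C (F x) T) \<longrightarrow>
      (\<exists>!h. h \<in> hom C L T \<and> (\<forall>x\<in>A. h \<cdot> p x = t x)))"
proof -
  let ?D = "\<lparr>fo = F, fa = (\<lambda>x. Id C (F x))\<rparr>"
  have "is_functor (discrete_cat A) C ?D" using F by (intro discrete_functor) blast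
  moreover have "small U (Arr (discrete_cat A))"
    using finite_small[OF A U(2)] by simp
  ultimately obtain L p where "is_colimit (discrete_cat A) C ?D L p"
    using U(1) unfolding cocomplete_def by blast
  then show ?thesis unfolding is_colimit_def discrete_cocone discrete_cat_simps by blast
qed

lemma terminal_obj:
  assumes "complete U C" "infinite U"
  shows "is_terminal C (terminal_obj C)"
proof -
  obtain L where "L \<in> Obj C" "\<And>T. T \<in> Obj C \<Longrightarrow> \<exists>!h. h \<in> hom C T L"
    using finite_product_exists[OF assms finite.emptyI] by auto
  then have "\<exists>T. is_terminal C T" unfolding is_terminal_def by blast
  then show ?thesis unfolding terminal_obj_def by (rule someI_ex)
qed

lemma initial_obj:
  assumes "cocomplete U C" "infinite U"
  shows "is_initial C (initial_obj C)"
proof -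
  obtain L where "L \<in> Obj C" "\<And>T. T \<in> Obj C \<Longrightarrow> \<exists>!h. h \<in> hom C L T"
    using finite_coproduct_exists[OF assms finite.emptyI] by auto
  then have "\<exists>T. is_initial C T" unfolding is_initial_def by blast
  then show ?thesis unfolding initial_obj_def by (rule someI_ex)
qed

lemma product_obj:
  assumes U: "complete U C" "infinite U" and XY: "X \<in> Obj C" "Y \<in> Obj C"
  shows "is_product C X Y (product_obj C X Y) (proj1 C X Y) (proj2 C X Y)"
proof -
  obtain a b :: 'b where ab: "a \<noteq> b" using infinite_two_elements[OF U(2)] .
  let ?F = "\<lambda>x. if x = a then X else Y"
  have fin: "finite {a, b}" by simp
  have F: "\<forall>x\<in>{a, b}. ?F x \<in> Obj C" using XY by simp
  obtain L p where L: "L \<in> Obj C" "\<forall>x\<in>{a, b}. p x \<in> hom C L (?F x)"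
    "\<forall>T t. T \<in> Obj C \<and> (\<forall>x\<in>{a, b}. t x \<in> hom C T (?F x)) \<longrightarrow>
      (\<exists>!h. h \<in> hom C T L \<and> (\<forall>x\<in>{a, b}. p x \<cdot> h = t x))"
    using finite_product_exists[of U "{a, b}" ?F, OF U fin F] by (elim exE conjE) (rule that)
  have "is_product C X Y L (p a) (p b)"
    unfolding is_product_def
  proof (intro conjI allI impI)
    fix T f g assume fg: "f \<in> hom C T X \<and> g \<in> hom C T Y"
    then have "T \<in> Obj C" using homD by blast
    with L(3)[rule_format, of T "\<lambda>x. if x = a then f else g"] fg ab
    show "\<exists>!h. h \<in> hom C T L \<and> p a \<cdot> h = f \<and> p b \<cdot> h = g" by auto
  qed (use L(2) ab in auto)
  then have "\<exists>z. case z of (P, p, q) \<Rightarrow> is_product C X Y P p q" by auto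
  from someI_ex[OF this] show ?thesis
    unfolding product_obj_def proj1_def proj2_def product_def[symmetric] by (simp add: case_prod_unfold)
qed

lemma coproduct_exists:
  assumes U: "cocomplete U C" "infinite U" and XY: "X \<in> Obj C" "Y \<in> Obj C"
  shows "\<exists>P i j. is_coproduct C X Y P i j"
proof -
  obtain a b :: 'b where ab: "a \<noteq> b" using infinite_two_elements[OF U(2)] .
  let ?F = "\<lambda>x. if x = a then X else Y"
  have fin: "finite {a, b}" by simp
  have F: "\<forall>x\<in>{a, b}. ?F x \<in> Obj C" using XY by simp
  obtain L p where L: "L \<in> Obj C" "\<forall>x\<in>{a, b}. p x \<in> hom C (?F x) L"
    "\<forall>T t. T \<in> Obj C \<and> (\<forall>x\<in>{a, b}. t x \<in> hom C (?F x) T) \<longrightarrow>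
      (\<exists>!h. h \<in> hom C L T \<and> (\<forall>x\<in>{a, b}. h \<cdot> p x = t x))"
    using finite_coproduct_exists[of U "{a, b}" ?F, OF U fin F] by (elim exE conjE) (rule that)
  have "is_coproduct C X Y L (p a) (p b)"
    unfolding is_coproduct_def
  proof (intro conjI allI impI)
    fix T f g assume fg: "f \<in> hom C X T \<and> g \<in> hom C Y T"
    then have "T \<in> Obj C" using homD by blast
    with L(3)[rule_format, of T "\<lambda>x. if x = a then f else g"] fg ab
    show "\<exists>!h. h \<in> hom C L T \<and> h \<cdot> p a = f \<and> h \<cdot> p b = g" by auto
  qed (use L(2) ab in auto)
  then show ?thesis by blast
qed

end

section \<open>Lifting properties and cell complexes\<close>

context category
begin

lemma has_liftingD:
  assumes "has_lifting C f g" "f \<in> hom C A B" "g \<in> hom C X Y"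
    "u \<in> hom C A X" "v \<in> hom C B Y" "g \<cdot> u = v \<cdot> f"
  obtains k where "k \<in> hom C B X" "k \<cdot> f = u" "g \<cdot> k = v"
proof -
  have "square C f g u v" using assms(2-) by (simp add: square_def homD)
  then show thesis using assms(1) that by (auto simp: has_lifting_def homD[OF assms(2)] homD[OF assms(3)])
qed

lemma has_liftingI:
  assumes f: "f \<in> hom C A B" and g: "g \<in> hom C X Y"
    and lift: "\<And>u v. u \<in> hom C A X \<Longrightarrow> v \<in> hom C B Y \<Longrightarrow> g \<cdot> u = v \<cdot> f \<Longrightarrow>
      \<exists>k\<in>hom C B X. k \<cdot> f = u \<and> g \<cdot> k = v"
  shows "has_lifting C f g"
  using lift by (simp add: has_lifting_def square_def homD[OF f] homD[OF g])

lemma rlp_comp: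
  assumes g: "g \<in> rlp C S" "g \<in> hom C X Y" and h: "h \<in> rlp C S" "h \<in> hom C Y Z"
  shows "h \<cdot> g \<in> rlp C S"
proof -
  have hg: "h \<cdot> g \<in> hom C X Z" using comp_hom g(2) h(2) by blast
  have "has_lifting C f (h \<cdot> g)" if "f \<in> S" for f
  proof (cases "f \<in> Arr C")
    case True
    note f = arr_in_hom[OF True]
    have lift: "has_lifting C f g" "has_lifting C f h" using g(1) h(1) that by (auto simp: rlp_def)
    show ?thesis
    proof (rule has_liftingI[OF f hg])
      fix u v assume u: "u \<in> hom C (Dom C f) X" and v: "v \<in> hom C (Cod C f) Z"
        and eq: "(h \<cdot> g) \<cdot> u = v \<cdot> f"
      have "h \<cdot> (g \<cdot> u) = v \<cdot> f" using eq assoc[OF u g(2) h(2)] by simp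
      then obtain k where k: "k \<in> hom C (Cod C f) Y" "k \<cdot> f = g \<cdot> u" "h \<cdot> k = v"
        using has_liftingD[OF lift(2) f h(2) comp_hom[OF u g(2)] v] by blast
      obtain l where l: "l \<in> hom C (Cod C f) X" "l \<cdot> f = u" "g \<cdot> l = k"
        using has_liftingD[OF lift(1) f g(2) u k(1) k(2)[symmetric]] by blast
      have "(h \<cdot> g) \<cdot> l = v" using assoc[OF l(1) g(2) h(2)] l(3) k(3) by simp
      then show "\<exists>k\<in>hom C (Cod C f) X. k \<cdot> f = u \<and> (h \<cdot> g) \<cdot> k = v" using l by blast
    qed
  qed (simp add: has_lifting_def square_def)
  then show ?thesis using homD(1)[OF hg] by (simp add: rlp_def)
qed

text \<open>The retract argument.\<close>

lemma retract_of_left_factor: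
  assumes i: "i \<in> hom C A E" and p: "p \<in> hom C E B" and lift: "has_lifting C (p \<cdot> i) p"
  shows "is_retract C (p \<cdot> i) i"
proof -
  have f: "p \<cdot> i \<in> hom C A B" using comp_hom[OF i p] .
  have A: "Id C A \<in> hom C A A" and B: "Id C B \<in> hom C B B" using homD[OF i] homD[OF p] id_hom by auto
  have "p \<cdot> i = Id C B \<cdot> (p \<cdot> i)" using id_left[OF f] by simp
  then obtain k where k: "k \<in> hom C B E" "k \<cdot> (p \<cdot> i) = i" "p \<cdot> k = Id C B"
    using has_liftingD[OF lift f p i B] by blast
  have "square C (p \<cdot> i) i (Id C A) k" "square C i (p \<cdot> i) (Id C A) p"
    using k(1,2) A i p by (auto simp: square_def homD[OF i] homD[OF f] id_right[OF i] id_right[OF f])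
  then show ?thesis
    unfolding is_retract_def using k(3) id_left[OF A] by (fastforce simp: homD[OF f])
qed

lemma pushout_has_lifting:
  assumes po: "is_pushout C f p u v" and f: "has_lifting C f g" and g: "g \<in> hom C E B"
  shows "has_lifting C p g"
proof -
  have fh: "f \<in> hom C (Dom C f) (Cod C f)" and ph: "p \<in> hom C (Dom C p) (Cod C p)"
    and u: "u \<in> hom C (Dom C f) (Dom C p)" and v: "v \<in> hom C (Cod C f) (Cod C p)"
    and pu: "p \<cdot> u = v \<cdot> f"
    and uni: "\<And>T s t. s \<in> hom C (Dom C p) T \<Longrightarrow> t \<in> hom C (Cod C f) T \<Longrightarrow> s \<cdot> u = t \<cdot> f \<Longrightarrow>
        \<exists>!h. h \<in> hom C (Cod C p) T \<and> h \<cdot> p = s \<and> h \<cdot> v = t"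
    using po by (auto simp: is_pushout_def square_def arr_in_hom)
  show ?thesis
  proof (rule has_liftingI[OF ph g])
    fix a b assume a: "a \<in> hom C (Dom C p) E" and b: "b \<in> hom C (Cod C p) B" and eq: "g \<cdot> a = b \<cdot> p"
    have bpu: "(b \<cdot> p) \<cdot> u = (b \<cdot> v) \<cdot> f"
      using assoc[OF u ph b] assoc[OF fh v b] pu by simp
    then have "g \<cdot> (a \<cdot> u) = (b \<cdot> v) \<cdot> f" using assoc[OF u a g] eq by simp
    then obtain k where k: "k \<in> hom C (Cod C f) E" "k \<cdot> f = a \<cdot> u" "g \<cdot> k = b \<cdot> v"
      using has_liftingD[OF f fh g comp_hom[OF u a] comp_hom[OF v b]] by blast
    obtain h where h: "h \<in> hom C (Cod C p) E" "h \<cdot> p = a" "h \<cdot> v = k"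
      using uni[OF a k(1) k(2)[symmetric]] by blast
    have "g \<cdot> h = b"
      using uni[OF comp_hom[OF ph b] comp_hom[OF v b] bpu] assoc[OF ph h(1) g] assoc[OF v h(1) g]
        h k(3) eq b comp_hom[OF h(1) g] by auto
    then show "\<exists>k\<in>hom C (Cod C p) E. k \<cdot> p = a \<and> g \<cdot> k = b" using h by blast
  qed
qed

lemma colimit_arrows_eq:
  assumes col: "is_colimit I C D L c"
    and D: "\<And>a. a \<in> Arr I \<Longrightarrow> Dom I a \<in> Obj I \<and> Cod I a \<in> Obj I \<and>
      fa D a \<in> hom C (fo D (Dom I a)) (fo D (Cod I a))"
    and s: "s \<in> hom C L T" "s' \<in> hom C L T" and eq: "\<And>i. i \<in> Obj I \<Longrightarrow> s \<cdot> c i = s' \<cdot> c i"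
  shows "s = s'"
proof -
  have c: "\<And>i. i \<in> Obj I \<Longrightarrow> c i \<in> hom C (fo D i) L"
    and c_nat: "\<And>a. a \<in> Arr I \<Longrightarrow> c (Cod I a) \<cdot> fa D a = c (Dom I a)"
    using col by (auto simp: is_colimit_def is_cocone_def)
  have "is_cocone I C D T (\<lambda>i. s \<cdot> c i)"
    unfolding is_cocone_def
  proof (intro conjI ballI)
    fix a assume a: "a \<in> Arr I"
    have "Cod I a \<in> Obj I" and Da: "fa D a \<in> hom C (fo D (Dom I a)) (fo D (Cod I a))"
      using D[OF a] by auto
    then show "(s \<cdot> c (Cod I a)) \<cdot> fa D a = s \<cdot> c (Dom I a)"
      using assoc[OF Da c s(1)] c_nat[OF a] by simp
  qed (use homD(5)[OF s(1)] comp_hom[OF c s(1)] in auto)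
  then have "\<exists>!h. h \<in> hom C L T \<and> (\<forall>i\<in>Obj I. h \<cdot> c i = s \<cdot> c i)"
    using col by (auto simp: is_colimit_def)
  then show ?thesis using s eq by metis
qed

end

lemma order_cat_simps [simp]:
  "Obj (order_cat r) = Field r" "Arr (order_cat r) = r" "Dom (order_cat r) a = fst a"
  "Cod (order_cat r) a = snd a" "Id (order_cat r) x = (x, x)"
  "b \<cdot>\<^bsub>order_cat r\<^esub> a = (fst a, snd b)"
  by (simp_all add: order_cat_def)

lemma hom_order_cat: "hom (order_cat r) x y = {a. a = (x, y) \<and> a \<in> r}"
  by (auto simp: hom_def)

text \<open>A lift against a transfinite composition is built by well-founded recursion: at a
  successor stage by the lifting property of the step, at a limit stage by the universal
  property of the colimit.\<close>

lemma (in category) transfinite_composition_has_lifting: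
  assumes seq: "sequence_in U C D r X" and col: "is_colimit (order_cat r) C X T c"
    and z: "z \<in> Field r" and least: "\<And>x. x \<in> Field r \<Longrightarrow> (z, x) \<in> r"
    and g: "g \<in> hom C E B" and D: "\<And>d. d \<in> D \<Longrightarrow> has_lifting C d g"
  shows "has_lifting C (c z) g"
proof -
  have wo: "Well_order r" and X: "is_functor (order_cat r) C X"
    and limit: "\<And>l. limit_element r l \<Longrightarrow>
        is_colimit (order_cat (Restr r (underS r l))) C X (fo X l) (\<lambda>b. fa X (b, l))"
    and succ: "\<And>b d. successor r b d \<Longrightarrow> fa X (b, d) \<in> D"
    using seq by (auto simp: sequence_in_def)
  interpret X: is_functor "order_cat r" C X by fact
  have lin: "Linear_order r" using wo by (simp add: well_order_on_def)
  have refl: "(x, x) \<in> r" if "x \<in> Field r" for x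
    using lin that by (auto simp: order_on_defs refl_on_def)
  have trans: "(x, w) \<in> r" if "(x, y) \<in> r" "(y, w) \<in> r" for x y w
    using lin that by (auto simp: order_on_defs dest: transD)
  have antisym: "x = y" if "(x, y) \<in> r" "(y, x) \<in> r" for x y
    using lin that by (auto simp: order_on_defs dest: antisymD)
  have total: "(x, y) \<in> r \<or> (y, x) \<in> r" if "x \<in> Field r" "y \<in> Field r" for x y
    using lin that refl by (cases "x = y") (auto simp: order_on_defs total_on_def)
  have field: "x \<in> Field r" "y \<in> Field r" if "(x, y) \<in> r" for x y
    using that by (auto simp: Field_def)
  have Xh: "fa X (x, y) \<in> hom C (fo X x) (fo X y)" if "(x, y) \<in> r" for x y
    using X.fa_hom[of "(x, y)" x y] that by (simp add: hom_order_cat)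
  have X_id: "fa X (x, x) = Id C (fo X x)" if "x \<in> Field r" for x
    using X.fa_id[of x] that by simp
  have X_comp: "fa X (x, w) = fa X (y, w) \<cdot> fa X (x, y)" if "(x, y) \<in> r" "(y, w) \<in> r" for x y w
    using X.fa_comp[of "(x, y)" x y "(y, w)" w] that by (simp add: hom_order_cat)
  have c: "c x \<in> hom C (fo X x) T" if "x \<in> Field r" for x
    using col that by (simp add: is_colimit_def is_cocone_def)
  have c_nat: "c y \<cdot> fa X (x, y) = c x" if "(x, y) \<in> r" for x y
    using col that unfolding is_colimit_def is_cocone_def by fastforce
  show ?thesis
  proof (rule has_liftingI[OF c[OF z] g])
    fix u v assume u: "u \<in> hom C (fo X z) E" and v: "v \<in> hom C T B" and uv: "g \<cdot> u = v \<cdot> c z"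
    define P where "P = (\<lambda>f x e. x \<in> Field r \<longrightarrow> e \<in> hom C (fo X x) E \<and> g \<cdot> e = v \<cdot> c x \<and>
      (x = z \<longrightarrow> e = u) \<and> (\<forall>a\<in>underS r x. e \<cdot> fa X (a, x) = f a))"
    have compat: "f y \<cdot> fa X (x, y) = f x" if "P f y (f y)" "(x, y) \<in> r" for f x y
    proof (cases "x = y")
      case True
      then show ?thesis
        using that field[OF that(2)] X_id[of x] by (auto simp: P_def intro: id_right)
    next
      case False
      then show ?thesis using that field[OF that(2)] by (auto simp: P_def underS_def)
    qed
    have "\<exists>k. \<forall>x. P k x (k x)"
    proof (rule dependent_wf_choice)
      show "wf (r - Relation.Id)" using wo by (simp add: well_order_on_def)
    next
      fix f g' :: "'b \<Rightarrow> 'a" and x e assume "\<And>a. (a, x) \<in> r - Relation.Id \<Longrightarrow> f a = g' a"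
      then show "P f x e = P g' x e" unfolding P_def underS_def by auto
    next
      fix x and f :: "'b \<Rightarrow> 'a"
      assume "\<And>y. (y, x) \<in> r - Relation.Id \<Longrightarrow> P f y (f y)"
      then have IH: "P f y (f y)" if "y \<in> underS r x" for y using that by (auto simp: underS_def)
      have fh: "f y \<in> hom C (fo X y) E" and gf: "g \<cdot> f y = v \<cdot> c y" if "y \<in> underS r x" for y
        using IH[OF that] that by (auto simp: P_def underS_def Field_def)
      show "\<exists>e. P f x e"
      proof (cases "x \<in> Field r \<and> x \<noteq> z")
        \<comment> \<open>The least stage, where the given map \<open>u\<close> starts the recursion; outside the field \<open>P\<close> is vacuous.\<close>
        case False
        have "a \<notin> underS r z" for a using least[OF field(1)] antisym unfolding underS_def by blast
        then have "P f x u" using False u uv by (auto simp: P_def)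
        then show ?thesis ..
      next
        case True
        then have x: "x \<in> Field r" and xz: "x \<noteq> z" by auto
        show ?thesis
        proof (cases "\<exists>b. successor r b x")
          case True
          then obtain b where b: "successor r b x" ..
          then have bx: "(b, x) \<in> r" "b \<noteq> x" and bU: "b \<in> underS r x"
            by (auto simp: successor_def aboveS_def underS_def)
          have "g \<cdot> f b = (v \<cdot> c x) \<cdot> fa X (b, x)"
            using gf[OF bU] assoc[OF Xh[OF bx(1)] c[OF x] v] c_nat[OF bx(1)] by simp
          then obtain e where e: "e \<in> hom C (fo X x) E" "e \<cdot> fa X (b, x) = f b" "g \<cdot> e = v \<cdot> c x"
            using has_liftingD[OF D[OF succ[OF b]] Xh[OF bx(1)] g fh[OF bU] comp_hom[OF c[OF x] v]]
            by blast
          \<comment> \<open>Every earlier stage is at or before the predecessor \<open>b\<close>, so that compatibility with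
            \<open>b\<close> suffices.\<close>
          have "e \<cdot> fa X (a, x) = f a" if "a \<in> underS r x" for a
          proof -
            have ax: "(a, x) \<in> r" "a \<noteq> x" using that by (auto simp: underS_def)
            have ab: "(a, b) \<in> r"
            proof (rule ccontr)
              assume "(a, b) \<notin> r"
              then have "a \<in> aboveS r b"
                using total[OF field(1)[OF ax(1)] field(1)[OF bx(1)]] refl[OF field(1)[OF ax(1)]]
                by (auto simp: aboveS_def)
              then have "(x, a) \<in> r" using b by (simp add: successor_def)
              then show False using antisym ax by blast
            qed
            then have "e \<cdot> fa X (a, x) = (e \<cdot> fa X (b, x)) \<cdot> fa X (a, b)"
              using X_comp[OF ab bx(1)] assoc[OF Xh[OF ab] Xh[OF bx(1)] e(1)] by simp
            then show ?thesis using e(2) compat[OF IH[OF bU] ab] by simp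
          qed
          then have "P f x e" using e xz by (simp add: P_def)
          then show ?thesis ..
        next
          case False
          let ?r = "Restr r (underS r x)"
          have zU: "z \<in> underS r x" using least[OF x] xz by (auto simp: underS_def)
          have lim: "limit_element r x" using False x zU by (auto simp: limit_element_def)
          have Fr: "Field ?r = underS r x"
            using refl field unfolding Field_def underS_def by blast
          have "is_cocone (order_cat ?r) C X E f"
            unfolding is_cocone_def using fh compat[OF IH] homD(4)[OF g] by (auto simp: Fr)
          then obtain e where e: "e \<in> hom C (fo X x) E" "\<And>a. a \<in> underS r x \<Longrightarrow> e \<cdot> fa X (a, x) = f a"
            using limit[OF lim] unfolding is_colimit_def order_cat_simps Fr by blast
          have "g \<cdot> e = v \<cdot> c x"
          proof (rule colimit_arrows_eq[OF limit[OF lim]])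
            fix a assume "a \<in> Arr (order_cat ?r)"
            then show "Dom (order_cat ?r) a \<in> Obj (order_cat ?r) \<and> Cod (order_cat ?r) a \<in> Obj (order_cat ?r) \<and>
              fa X a \<in> hom C (fo X (Dom (order_cat ?r) a)) (fo X (Cod (order_cat ?r) a))"
              using Xh by (cases a) (auto simp: Fr)
          next
            fix a assume "a \<in> Obj (order_cat ?r)"
            then have aU: "a \<in> underS r x" by (simp add: Fr)
            then have ax: "(a, x) \<in> r" by (simp add: underS_def)
            show "(g \<cdot> e) \<cdot> fa X (a, x) = (v \<cdot> c x) \<cdot> fa X (a, x)"
              using assoc[OF Xh[OF ax] e(1) g] assoc[OF Xh[OF ax] c[OF x] v] e(2)[OF aU] gf[OF aU] c_nat[OF ax]
              by simp
          qed (use comp_hom[OF e(1) g] comp_hom[OF c[OF x] v] in auto)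
          then have "P f x e" using e xz by (simp add: P_def)
          then show ?thesis ..
        qed
      qed
    qed
    then obtain k where k: "\<And>x. P k x (k x)" by blast
    have kh: "k x \<in> hom C (fo X x) E" and gk: "g \<cdot> k x = v \<cdot> c x" if "x \<in> Field r" for x
      using k[of x] that by (auto simp: P_def)
    have "is_cocone (order_cat r) C X E k"
      unfolding is_cocone_def using kh compat[OF k] homD(4)[OF g] by auto
    then obtain h where h: "h \<in> hom C T E" "\<And>x. x \<in> Field r \<Longrightarrow> h \<cdot> c x = k x"
      using col unfolding is_colimit_def order_cat_simps by blast
    have "g \<cdot> h = v"
    proof (rule colimit_arrows_eq[OF col])
      fix a assume "a \<in> Arr (order_cat r)"
      then show "Dom (order_cat r) a \<in> Obj (order_cat r) \<and> Cod (order_cat r) a \<in> Obj (order_cat r) \<and>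
        fa X a \<in> hom C (fo X (Dom (order_cat r) a)) (fo X (Cod (order_cat r) a))"
        using Xh field by (cases a) auto
    next
      fix x assume "x \<in> Obj (order_cat r)"
      then show "(g \<cdot> h) \<cdot> c x = v \<cdot> c x" using assoc[OF c h(1) g] h(2) gk by simp
    qed (use comp_hom[OF h(1) g] v in auto)
    moreover have "h \<cdot> c z = u" using h(2)[OF z] k[of z] z by (simp add: P_def)
    ultimately show "\<exists>k\<in>hom C T E. k \<cdot> c z = u \<and> g \<cdot> k = v" using h(1) by blast
  qed
qed

lemma (in category) cell_subset_cof_class: "cell U C S \<subseteq> cof_class C S"
proof
  fix f assume "f \<in> cell U C S"
  then obtain r X T c z where seq: "sequence_in U C (pushouts_of C S) r X"
    and col: "is_colimit (order_cat r) C X T c" and z: "z \<in> Field r" "\<forall>x\<in>Field r. (z, x) \<in> r"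
    and f: "f = c z"
    unfolding cell_def by blast
  have "f \<in> hom C (fo X z) T" using col z(1) f by (simp add: is_colimit_def is_cocone_def)
  moreover have "has_lifting C f g" if "g \<in> inj_class C S" for g
  proof -
    have g: "g \<in> hom C (Dom C g) (Cod C g)" using that by (simp add: inj_class_def rlp_def arr_in_hom)
    have "has_lifting C d g" if "d \<in> pushouts_of C S" for d
      using that pushout_has_lifting[OF _ _ g] \<open>g \<in> inj_class C S\<close>
      by (auto simp: pushouts_of_def inj_class_def rlp_def)
    then show ?thesis using transfinite_composition_has_lifting[OF seq col z(1) _ g] z(2) f by blast
  qed
  ultimately show "f \<in> cof_class C S" using homD(1) by (simp add: cof_class_def llp_def)
qed

section \<open>Homotopy with respect to a weak factorization system\<close>

text \<open>The small object argument is represented by what it yields: a functorial factorization of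
  every arrow into a member of \<open>L\<close> followed by a member of \<open>R\<close>.\<close>

locale relative_model_category = category M for M :: "('o, 'a) cat" (structure) +
  fixes U :: "'u set" and Cof Fib W L R :: "'a set" and \<Phi> :: "'a factorization"
    and Q :: "('o, 'a, 'o, 'a) ftor" and q :: "'o \<Rightarrow> 'a"
  assumes infinite_universe: "infinite U"
    and model_category: "model_category U M Cof Fib W"
    and wfs: "weak_factorization_system M L R"
    and trivial_cofibrations_subset: "Cof \<inter> W \<subseteq> L"
    and subset_cofibrations: "L \<subseteq> Cof"
    and factorization: "functorial_factorization M \<Phi> L R"
    and replacement: "cofibrant_replacement M Cof Fib W Q q"
begin

lemma complete: "complete U M" and cocomplete: "cocomplete U M"
  and model_structure: "model_structure M Cof Fib W"
  using model_category by (auto simp: model_category_def)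

lemma terminal_arr_hom:
  assumes "X \<in> Obj M"
  shows "terminal_arr M X \<in> hom M X (terminal_obj M)"
proof -
  have "\<exists>!f. f \<in> hom M X (terminal_obj M)"
    using terminal_obj[OF complete infinite_universe] assms by (simp add: is_terminal_def)
  then show ?thesis unfolding terminal_arr_def by (rule theI')
qed

lemma terminal_arr_unique:
  "f \<in> hom M X (terminal_obj M) \<Longrightarrow> g \<in> hom M X (terminal_obj M) \<Longrightarrow> f = g"
  using terminal_obj[OF complete infinite_universe] homD(4) unfolding is_terminal_def by blast

lemma terminal_obj_in: "terminal_obj M \<in> Obj M"
  using terminal_obj[OF complete infinite_universe] by (simp add: is_terminal_def)

lemma initial_arr_hom:
  assumes "X \<in> Obj M"
  shows "initial_arr M X \<in> hom M (initial_obj M) X"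
proof -
  have "\<exists>!f. f \<in> hom M (initial_obj M) X"
    using initial_obj[OF cocomplete infinite_universe] assms by (simp add: is_initial_def)
  then show ?thesis unfolding initial_arr_def by (rule theI')
qed

lemma initial_arr_unique:
  "f \<in> hom M (initial_obj M) X \<Longrightarrow> g \<in> hom M (initial_obj M) X \<Longrightarrow> f = g"
  using initial_obj[OF cocomplete infinite_universe] homD(5) unfolding is_initial_def by blast

lemma proj_hom:
  assumes "X \<in> Obj M" "Y \<in> Obj M"
  shows "proj1 M X Y \<in> hom M (product_obj M X Y) X" "proj2 M X Y \<in> hom M (product_obj M X Y) Y"
  using product_obj[OF complete infinite_universe assms] by (auto simp: is_product_def)

lemma into_product_eq:
  assumes "h \<in> hom M T (product_obj M X Y)" "h' \<in> hom M T (product_obj M X Y)"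
    and "X \<in> Obj M" "Y \<in> Obj M"
    and "proj1 M X Y \<cdot> h = proj1 M X Y \<cdot> h'" "proj2 M X Y \<cdot> h = proj2 M X Y \<cdot> h'"
  shows "h = h'"
  using product_obj[OF complete infinite_universe assms(3,4)] comp_hom[OF assms(1)] assms
  unfolding is_product_def by metis

lemma pairing:
  assumes f: "f \<in> hom M T X" and g: "g \<in> hom M T Y"
  shows "pairing M f g \<in> hom M T (product_obj M X Y)"
    "proj1 M X Y \<cdot> pairing M f g = f" "proj2 M X Y \<cdot> pairing M f g = g"
proof -
  have "\<exists>!h. h \<in> hom M T (product_obj M X Y) \<and> proj1 M X Y \<cdot> h = f \<and> proj2 M X Y \<cdot> h = g"
    using product_obj[OF complete infinite_universe homD(5)[OF f] homD(5)[OF g]] f g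
    by (auto simp: is_product_def)
  from theI'[OF this]
  show "pairing M f g \<in> hom M T (product_obj M X Y)"
    "proj1 M X Y \<cdot> pairing M f g = f" "proj2 M X Y \<cdot> pairing M f g = g"
    by (auto simp: pairing_def homD[OF f] homD[OF g])
qed

lemma pairing_eq_iff:
  assumes f: "f \<in> hom M T X" and g: "g \<in> hom M T Y" and h: "h \<in> hom M T (product_obj M X Y)"
  shows "h = pairing M f g \<longleftrightarrow> proj1 M X Y \<cdot> h = f \<and> proj2 M X Y \<cdot> h = g"
  using into_product_eq[OF h pairing(1)[OF f g]] pairing[OF f g] homD(5)[OF f] homD(5)[OF g] by auto

lemma factorization_hom:
  assumes "f \<in> hom M X Y"
  shows "fleft \<Phi> f \<in> hom M X (Cod M (fleft \<Phi> f))" "fright \<Phi> f \<in> hom M (Cod M (fleft \<Phi> f)) Y"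
    "fright \<Phi> f \<cdot> fleft \<Phi> f = f" "fleft \<Phi> f \<in> L" "fright \<Phi> f \<in> R"
  using factorization assms homD[OF assms] unfolding functorial_factorization_def
  by (auto simp: hom_def)

lemma factorization_mid:
  assumes f: "f \<in> hom M X Y" and g: "g \<in> hom M X' Y'" and u: "u \<in> hom M X X'" and v: "v \<in> hom M Y Y'"
    and eq: "g \<cdot> u = v \<cdot> f"
  shows "fmid \<Phi> f g u v \<in> hom M (Cod M (fleft \<Phi> f)) (Cod M (fleft \<Phi> g))"
    "fmid \<Phi> f g u v \<cdot> fleft \<Phi> f = fleft \<Phi> g \<cdot> u"
    "fright \<Phi> g \<cdot> fmid \<Phi> f g u v = v \<cdot> fright \<Phi> f"
proof -
  have "square M f g u v" using assms by (simp add: square_def homD[OF f] homD[OF g])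
  then show "fmid \<Phi> f g u v \<in> hom M (Cod M (fleft \<Phi> f)) (Cod M (fleft \<Phi> g))"
    "fmid \<Phi> f g u v \<cdot> fleft \<Phi> f = fleft \<Phi> g \<cdot> u"
    "fright \<Phi> g \<cdot> fmid \<Phi> f g u v = v \<cdot> fright \<Phi> f"
    using factorization unfolding functorial_factorization_def by blast+
qed

text \<open>The two components of \<open>Path Y \<rightarrow> Y \<times> Y\<close> and their common section.\<close>

definition start :: "'o \<Rightarrow> 'a" where
  "start Y = proj1 M Y Y \<cdot> fright \<Phi> (diagonal M Y)"

definition finish :: "'o \<Rightarrow> 'a" where
  "finish Y = proj2 M Y Y \<cdot> fright \<Phi> (diagonal M Y)"

definition constant_path :: "'o \<Rightarrow> 'a" where
  "constant_path Y = fleft \<Phi> (diagonal M Y)"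

lemma diagonal:
  assumes "Y \<in> Obj M"
  shows "diagonal M Y \<in> hom M Y (product_obj M Y Y)"
    "proj1 M Y Y \<cdot> diagonal M Y = Id M Y" "proj2 M Y Y \<cdot> diagonal M Y = Id M Y"
  using pairing[OF id_hom[OF assms] id_hom[OF assms]] by (simp_all add: diagonal_def)

lemma path_ends_hom:
  assumes "Y \<in> Obj M"
  shows "fright \<Phi> (diagonal M Y) \<in> hom M (path_obj M \<Phi> Y) (product_obj M Y Y)"
  using factorization_hom(2)[OF diagonal(1)[OF assms]] by (simp add: path_obj_def)

lemma path_hom:
  assumes "Y \<in> Obj M"
  shows "start Y \<in> hom M (path_obj M \<Phi> Y) Y" "finish Y \<in> hom M (path_obj M \<Phi> Y) Y"
    "constant_path Y \<in> hom M Y (path_obj M \<Phi> Y)" "constant_path Y \<in> L"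
    "start Y \<cdot> constant_path Y = Id M Y" "finish Y \<cdot> constant_path Y = Id M Y"
proof -
  note fac = factorization_hom[OF diagonal(1)[OF assms], folded path_obj_def constant_path_def]
  note pr = proj_hom[OF assms assms]
  show "start Y \<in> hom M (path_obj M \<Phi> Y) Y" "finish Y \<in> hom M (path_obj M \<Phi> Y) Y"
    unfolding start_def finish_def using comp_hom[OF fac(2)] pr by blast+
  show "constant_path Y \<in> hom M Y (path_obj M \<Phi> Y)" "constant_path Y \<in> L" using fac by blast+
  show "start Y \<cdot> constant_path Y = Id M Y" "finish Y \<cdot> constant_path Y = Id M Y"
    unfolding start_def finish_def
    using assoc[OF fac(1,2)] pr fac(3) diagonal[OF assms] by simp_all
qed

lemma right_homotopy_iff:
  assumes f: "f \<in> hom M X Y" and g: "g \<in> hom M X Y"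
  shows "(f, g) \<in> right_homotopy M \<Phi> \<longleftrightarrow>
    (\<exists>H\<in>hom M X (path_obj M \<Phi> Y). start Y \<cdot> H = f \<and> finish Y \<cdot> H = g)"
proof -
  have Y: "Y \<in> Obj M" using homD(5)[OF f] .
  note e = path_ends_hom[OF Y]
  have "fright \<Phi> (diagonal M Y) \<cdot> H = pairing M f g \<longleftrightarrow> start Y \<cdot> H = f \<and> finish Y \<cdot> H = g"
    if H: "H \<in> hom M X (path_obj M \<Phi> Y)" for H
    using pairing_eq_iff[OF f g comp_hom[OF H e]] assoc[OF H e proj_hom(1)[OF Y Y]]
      assoc[OF H e proj_hom(2)[OF Y Y]] by (simp add: start_def finish_def)
  then show ?thesis using g by (auto simp: right_homotopy_def homD[OF f])
qed

lemma right_homotopy_parallel: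
  "(f, g) \<in> right_homotopy M \<Phi> \<Longrightarrow> f \<in> hom M X Y \<Longrightarrow> g \<in> hom M X Y"
  by (auto simp: right_homotopy_def hom_def)

lemma right_homotopy_arr: "(f, g) \<in> right_homotopy M \<Phi> \<Longrightarrow> f \<in> Arr M"
  by (auto simp: right_homotopy_def)

lemma right_homotopy_refl:
  assumes f: "f \<in> hom M X Y"
  shows "(f, f) \<in> right_homotopy M \<Phi>"
proof -
  note p = path_hom[OF homD(5)[OF f]]
  have "start Y \<cdot> (constant_path Y \<cdot> f) = f" "finish Y \<cdot> (constant_path Y \<cdot> f) = f"
    using assoc[OF f p(3) p(1)] assoc[OF f p(3) p(2)] p(5,6) id_left[OF f] by simp_all
  then show ?thesis using right_homotopy_iff[OF f f] comp_hom[OF f p(3)] by blast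
qed

text \<open>Functoriality of the factorization lets the swap of the two factors of \<open>Y \<times> Y\<close> act on
  the path object, and likewise it makes path objects functorial.\<close>

lemma right_homotopy_sym:
  assumes "(f, g) \<in> right_homotopy M \<Phi>"
  shows "(g, f) \<in> right_homotopy M \<Phi>"
proof -
  obtain X Y where f: "f \<in> hom M X Y" using right_homotopy_arr[OF assms] arr_in_hom by blast
  have g: "g \<in> hom M X Y" using right_homotopy_parallel[OF assms f] .
  have Y: "Y \<in> Obj M" using homD(5)[OF f] .
  obtain H where H: "H \<in> hom M X (path_obj M \<Phi> Y)" "start Y \<cdot> H = f" "finish Y \<cdot> H = g"
    using assms right_homotopy_iff[OF f g] by blast
  define s where "s = pairing M (proj2 M Y Y) (proj1 M Y Y)"
  note pr = proj_hom[OF Y Y]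
  note s = pairing[OF pr(2) pr(1), folded s_def]
  note d = diagonal[OF Y] and e = path_ends_hom[OF Y]
  have "diagonal M Y \<cdot> Id M Y = s \<cdot> diagonal M Y"
    by (rule into_product_eq[OF comp_hom[OF id_hom[OF Y] d(1)] comp_hom[OF d(1) s(1)] Y Y])
      (use assoc[OF d(1) s(1) pr(1)] assoc[OF d(1) s(1) pr(2)] s d id_right[OF d(1)] in simp_all)
  note \<sigma> = factorization_mid[OF d(1) d(1) id_hom[OF Y] s(1) this, folded path_obj_def]
  let ?\<sigma> = "fmid \<Phi> (diagonal M Y) (diagonal M Y) (Id M Y) s"
  have "start Y \<cdot> ?\<sigma> = finish Y" "finish Y \<cdot> ?\<sigma> = start Y"
    unfolding start_def finish_def
    using assoc[OF \<sigma>(1) e pr(1)] assoc[OF \<sigma>(1) e pr(2)] \<sigma>(3) assoc[OF e s(1) pr(1)]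
      assoc[OF e s(1) pr(2)] s(2,3) by simp_all
  then have "start Y \<cdot> (?\<sigma> \<cdot> H) = g" "finish Y \<cdot> (?\<sigma> \<cdot> H) = f"
    using assoc[OF H(1) \<sigma>(1) path_hom(1)[OF Y]] assoc[OF H(1) \<sigma>(1) path_hom(2)[OF Y]] H(2,3) by simp_all
  then show ?thesis using right_homotopy_iff[OF g f] comp_hom[OF H(1) \<sigma>(1)] by blast
qed

lemma right_homotopy_precomp:
  assumes fg: "(f, g) \<in> right_homotopy M \<Phi>" and f: "f \<in> hom M X Y" and k: "k \<in> hom M V X"
  shows "(f \<cdot> k, g \<cdot> k) \<in> right_homotopy M \<Phi>"
proof -
  have g: "g \<in> hom M X Y" using right_homotopy_parallel[OF fg f] .
  note p = path_hom[OF homD(5)[OF f]]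
  obtain H where H: "H \<in> hom M X (path_obj M \<Phi> Y)" "start Y \<cdot> H = f" "finish Y \<cdot> H = g"
    using fg right_homotopy_iff[OF f g] by blast
  have "start Y \<cdot> (H \<cdot> k) = f \<cdot> k" "finish Y \<cdot> (H \<cdot> k) = g \<cdot> k"
    using assoc[OF k H(1) p(1)] assoc[OF k H(1) p(2)] H(2,3) by simp_all
  then show ?thesis
    using right_homotopy_iff[OF comp_hom[OF k f] comp_hom[OF k g]] comp_hom[OF k H(1)] by blast
qed

lemma right_homotopy_postcomp:
  assumes fg: "(f, g) \<in> right_homotopy M \<Phi>" and f: "f \<in> hom M X Y" and h: "h \<in> hom M Y Z"
  shows "(h \<cdot> f, h \<cdot> g) \<in> right_homotopy M \<Phi>"
proof -
  have g: "g \<in> hom M X Y" using right_homotopy_parallel[OF fg f] .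
  have Y: "Y \<in> Obj M" and Z: "Z \<in> Obj M" using homD(4,5)[OF h] .
  obtain H where H: "H \<in> hom M X (path_obj M \<Phi> Y)" "start Y \<cdot> H = f" "finish Y \<cdot> H = g"
    using fg right_homotopy_iff[OF f g] by blast
  note pr = proj_hom[OF Y Y] and prZ = proj_hom[OF Z Z]
  define s where "s = pairing M (h \<cdot> proj1 M Y Y) (h \<cdot> proj2 M Y Y)"
  note s = pairing[OF comp_hom[OF pr(1) h] comp_hom[OF pr(2) h], folded s_def]
  note d = diagonal[OF Y] and dZ = diagonal[OF Z] and e = path_ends_hom[OF Y] and eZ = path_ends_hom[OF Z]
  have "diagonal M Z \<cdot> h = s \<cdot> diagonal M Y"
    by (rule into_product_eq[OF comp_hom[OF h dZ(1)] comp_hom[OF d(1) s(1)] Z Z])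
      (use assoc[OF d(1) s(1) prZ(1)] assoc[OF d(1) s(1) prZ(2)] assoc[OF d(1) pr(1) h]
        assoc[OF d(1) pr(2) h] assoc[OF h dZ(1) prZ(1)] assoc[OF h dZ(1) prZ(2)] s d dZ
        id_left[OF h] id_right[OF h] in simp_all)
  note \<rho> = factorization_mid[OF d(1) dZ(1) h s(1) this, folded path_obj_def]
  let ?\<rho> = "fmid \<Phi> (diagonal M Y) (diagonal M Z) h s"
  have "start Z \<cdot> ?\<rho> = h \<cdot> start Y" "finish Z \<cdot> ?\<rho> = h \<cdot> finish Y"
    unfolding start_def finish_def
    using assoc[OF \<rho>(1) eZ prZ(1)] assoc[OF \<rho>(1) eZ prZ(2)] \<rho>(3) assoc[OF e s(1) prZ(1)]
      assoc[OF e s(1) prZ(2)] s(2,3) assoc[OF e pr(1) h] assoc[OF e pr(2) h] by simp_all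
  then have "start Z \<cdot> (?\<rho> \<cdot> H) = h \<cdot> f" "finish Z \<cdot> (?\<rho> \<cdot> H) = h \<cdot> g"
    using assoc[OF H(1) \<rho>(1) path_hom(1)[OF Z]] assoc[OF H(1) \<rho>(1) path_hom(2)[OF Z]] H(2,3)
      assoc[OF H(1) path_hom(1)[OF Y] h] assoc[OF H(1) path_hom(2)[OF Y] h] by simp_all
  then show ?thesis
    using right_homotopy_iff[OF comp_hom[OF f h] comp_hom[OF g h]] comp_hom[OF H(1) \<rho>(1)] by blast
qed

lemma homotopy_parallel:
  "(f, g) \<in> homotopy M \<Phi> \<Longrightarrow> f \<in> hom M X Y \<Longrightarrow> g \<in> hom M X Y"
  unfolding homotopy_def by (induction rule: trancl_induct) (auto intro: right_homotopy_parallel)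

text \<open>An operation that preserves right homotopies preserves chains of them.\<close>

lemma homotopy_image:
  assumes fg: "(f, g) \<in> homotopy M \<Phi>" and f: "f \<in> hom M X Y"
    and T: "\<And>f g. (f, g) \<in> right_homotopy M \<Phi> \<Longrightarrow> f \<in> hom M X Y \<Longrightarrow> (T f, T g) \<in> right_homotopy M \<Phi>"
  shows "(T f, T g) \<in> homotopy M \<Phi>"
  using fg unfolding homotopy_def
proof (induction rule: trancl_induct)
  case (base g)
  then show ?case using T f by blast
next
  case (step g h)
  then have "g \<in> hom M X Y" using homotopy_parallel f unfolding homotopy_def by blast
  then show ?case using step T by (meson trancl.trancl_into_trancl)
qed

lemma homotopy_congruence: "arrow_congruence M (homotopy M \<Phi>)"
proof
  fix f assume "f \<in> Arr M"
  then show "(f, f) \<in> homotopy M \<Phi>"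
    using right_homotopy_refl[OF arr_in_hom] by (auto simp: homotopy_def)
next
  have "sym (right_homotopy M \<Phi>)" using right_homotopy_sym by (auto intro: symI)
  then have "sym (homotopy M \<Phi>)" unfolding homotopy_def by (rule sym_trancl)
  then show "(f, g) \<in> homotopy M \<Phi> \<Longrightarrow> (g, f) \<in> homotopy M \<Phi>" for f g by (auto dest: symD)
next
  show trans: "(f, g) \<in> homotopy M \<Phi> \<Longrightarrow> (g, h) \<in> homotopy M \<Phi> \<Longrightarrow> (f, h) \<in> homotopy M \<Phi>" for f g h
    unfolding homotopy_def by (rule trancl_trans)
  fix f f' X Y g g' Z
  assume ff': "(f, f') \<in> homotopy M \<Phi>" and f: "f \<in> hom M X Y"
    and gg': "(g, g') \<in> homotopy M \<Phi>" and g: "g \<in> hom M Y Z"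
  have "(g \<cdot> f, g \<cdot> f') \<in> homotopy M \<Phi>"
    using homotopy_image[OF ff' f, of "\<lambda>f. g \<cdot> f"] right_homotopy_postcomp g by blast
  moreover have "(g \<cdot> f', g' \<cdot> f') \<in> homotopy M \<Phi>"
    using homotopy_image[OF gg' g, of "\<lambda>g. g \<cdot> f'"] right_homotopy_precomp
      homotopy_parallel[OF ff' f] by blast
  ultimately show "(g \<cdot> f, g' \<cdot> f') \<in> homotopy M \<Phi>" by (rule trans)
qed (rule homotopy_parallel)

sublocale Ho: arrow_congruence M "homotopy M \<Phi>"
  by (rule homotopy_congruence)

abbreviation Ho :: "('o, 'a set) cat" where
  "Ho \<equiv> quotient_cat M (homotopy M \<Phi>)"

abbreviation hclass :: "'a \<Rightarrow> 'a set" where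
  "hclass \<equiv> quotient_class M (homotopy M \<Phi>)"

sublocale HoC: category Ho
  by (rule Ho.quotient_category)

subsection \<open>Lifting along the left class\<close>

lemma L_has_lifting: "i \<in> L \<Longrightarrow> p \<in> R \<Longrightarrow> has_lifting M i p"
  using wfs unfolding weak_factorization_system_def llp_def by blast

lemma L_arr: "L \<subseteq> Arr M"
  using wfs unfolding weak_factorization_system_def llp_def by blast

lemma extend_along_L:
  assumes i: "i \<in> L" "i \<in> hom M A B" and Z: "Z \<in> fibrant_objs M R" and f: "f \<in> hom M A Z"
  shows "\<exists>k\<in>hom M B Z. k \<cdot> i = f"
proof -
  have Z': "Z \<in> Obj M" "terminal_arr M Z \<in> R" using Z by (auto simp: fibrant_objs_def)
  note t = terminal_arr_hom[OF Z'(1)] terminal_arr_hom[OF homD(5)[OF i(2)]]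
  have "terminal_arr M Z \<cdot> f = terminal_arr M B \<cdot> i"
    using terminal_arr_unique comp_hom[OF f t(1)] comp_hom[OF i(2) t(2)] by blast
  then show ?thesis using has_liftingD[OF L_has_lifting[OF i(1) Z'(2)] i(2) t(1) f t(2)] by blast
qed

text \<open>The homotopy is a lift of \<open>i\<close> against \<open>Path Z \<rightarrow> Z \<times> Z\<close>.\<close>

lemma right_homotopy_reflected:
  assumes i: "i \<in> L" "i \<in> hom M A B" and f: "f \<in> hom M B Z" and g: "g \<in> hom M B Z"
    and hom: "(f \<cdot> i, g \<cdot> i) \<in> right_homotopy M \<Phi>"
  shows "(f, g) \<in> right_homotopy M \<Phi>"
proof -
  have Z: "Z \<in> Obj M" using homD(5)[OF f] .
  note e = path_ends_hom[OF Z] and fg = pairing[OF f g]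
  obtain H where H: "H \<in> hom M A (path_obj M \<Phi> Z)" "start Z \<cdot> H = f \<cdot> i" "finish Z \<cdot> H = g \<cdot> i"
    using hom right_homotopy_iff[OF comp_hom[OF i(2) f] comp_hom[OF i(2) g]] by blast
  note pr = proj_hom[OF Z Z]
  have "fright \<Phi> (diagonal M Z) \<cdot> H = pairing M f g \<cdot> i"
    by (rule into_product_eq[OF comp_hom[OF H(1) e] comp_hom[OF i(2) fg(1)] Z Z])
      (use assoc[OF H(1) e pr(1)] assoc[OF H(1) e pr(2)] assoc[OF i(2) fg(1) pr(1)]
        assoc[OF i(2) fg(1) pr(2)] fg(2,3) H(2,3) in \<open>simp_all add: start_def finish_def\<close>)
  then obtain K where K: "K \<in> hom M B (path_obj M \<Phi> Z)" "fright \<Phi> (diagonal M Z) \<cdot> K = pairing M f g"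
    using has_liftingD[OF L_has_lifting[OF i(1) factorization_hom(5)[OF diagonal(1)[OF Z]]] i(2) e H(1) fg(1)]
    by blast
  then show ?thesis using g by (auto simp: right_homotopy_def homD[OF f])
qed

text \<open>The intermediate maps of a chain of right homotopies are extended along \<open>i\<close> one by one.\<close>

lemma homotopy_reflected:
  assumes i: "i \<in> L" "i \<in> hom M A B" and Z: "Z \<in> fibrant_objs M R"
    and f: "f \<in> hom M B Z" and g: "g \<in> hom M B Z" and hom: "(f \<cdot> i, g \<cdot> i) \<in> homotopy M \<Phi>"
  shows "(f, g) \<in> homotopy M \<Phi>"
proof -
  have "\<forall>g\<in>hom M B Z. g \<cdot> i = g' \<longrightarrow> (f, g) \<in> homotopy M \<Phi>" if "(f \<cdot> i, g') \<in> (right_homotopy M \<Phi>)\<^sup>+" for g'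
    using that
  proof (induction rule: trancl_induct)
    case (base g')
    then show ?case using right_homotopy_reflected[OF i f] by (auto simp: homotopy_def)
  next
    case (step h g')
    have "h \<in> hom M A Z"
      using homotopy_parallel[OF _ comp_hom[OF i(2) f]] step(1) by (simp add: homotopy_def)
    then obtain k where k: "k \<in> hom M B Z" "k \<cdot> i = h" using extend_along_L[OF i Z] by blast
    then have "(f, k) \<in> homotopy M \<Phi>" using step(3) by blast
    moreover have "(k, g) \<in> right_homotopy M \<Phi>" if "g \<in> hom M B Z" "g \<cdot> i = g'" for g
      using right_homotopy_reflected[OF i k(1) that(1)] k(2) that(2) step(2) by simp
    ultimately show ?case unfolding homotopy_def by (meson trancl.trancl_into_trancl)
  qed
  then show ?thesis using hom g unfolding homotopy_def by blast
qed

end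

section \<open>Local equivalences\<close>

context category
begin

definition precomp_bij :: "'a \<Rightarrow> 'o \<Rightarrow> bool" where
  "precomp_bij f Z \<longleftrightarrow> bij_betw (\<lambda>g. g \<cdot> f) (hom C (Cod C f) Z) (hom C (Dom C f) Z)"

lemma precomp_bij_comp:
  assumes f: "f \<in> hom C X Y" and g: "g \<in> hom C Y V"
  shows "precomp_bij f Z \<Longrightarrow> precomp_bij (g \<cdot> f) Z \<longleftrightarrow> precomp_bij g Z"
    and "precomp_bij g Z \<Longrightarrow> precomp_bij (g \<cdot> f) Z \<longleftrightarrow> precomp_bij f Z"
proof -
  have "precomp_bij (g \<cdot> f) Z \<longleftrightarrow> bij_betw ((\<lambda>h. h \<cdot> f) \<circ> (\<lambda>h. h \<cdot> g)) (hom C V Z) (hom C X Z)"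
    unfolding precomp_bij_def homD[OF comp_hom[OF f g]]
    by (rule bij_betw_cong) (simp add: assoc[OF f g])
  then show "precomp_bij f Z \<Longrightarrow> precomp_bij (g \<cdot> f) Z \<longleftrightarrow> precomp_bij g Z"
    "precomp_bij g Z \<Longrightarrow> precomp_bij (g \<cdot> f) Z \<longleftrightarrow> precomp_bij f Z"
    unfolding precomp_bij_def homD[OF f] homD[OF g]
    using bij_betw_comp_iff2[of "\<lambda>h. h \<cdot> f" "hom C Y Z" "hom C X Z" "\<lambda>h. h \<cdot> g" "hom C V Z"]
      bij_betw_comp_iff[of "\<lambda>h. h \<cdot> g" "hom C V Z" "hom C Y Z" "\<lambda>h. h \<cdot> f" "hom C X Z"] comp_hom[OF g]
    by auto
qed

lemma precomp_bij_id: "X \<in> Obj C \<Longrightarrow> precomp_bij (Id C X) Z"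
  unfolding precomp_bij_def homD(2,3)[OF id_hom]
  by (rule iffD2[OF bij_betw_cong bij_betw_id]) (simp add: id_right)

end

context relative_model_category
begin

abbreviation "Mcof \<equiv> cof_cat M Cof"
abbreviation "Mcf \<equiv> cof_fib_cat M Cof R"

text \<open>Orthogonality, in the homotopy category, to all fibrant and cofibrant objects.\<close>

definition homotopy_local :: "'a \<Rightarrow> bool" where
  "homotopy_local f \<longleftrightarrow> (\<forall>Z\<in>Obj Mcf. HoC.precomp_bij (hclass f) Z)"

lemma Mcof_full: "Mcof = full_sub M (cofibrant_objs M Cof)"
  by (simp add: cof_cat_def)

lemma Mcf_full: "Mcf = full_sub M (cofibrant_objs M Cof \<inter> fibrant_objs M R)"
  by (simp add: cof_fib_cat_def cof_cat_def full_sub_def Int_assoc conj_ac)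

lemma Obj_Mcof [simp]: "X \<in> Obj Mcof \<longleftrightarrow> X \<in> cofibrant_objs M Cof"
  by (auto simp: Mcof_full cofibrant_objs_def)

lemma Obj_Mcf [simp]: "X \<in> Obj Mcf \<longleftrightarrow> X \<in> cofibrant_objs M Cof \<and> X \<in> fibrant_objs M R"
  by (auto simp: Mcf_full cofibrant_objs_def)

lemma homotopy_local_comp:
  assumes f: "f \<in> hom M X Y" and g: "g \<in> hom M Y V"
  shows "homotopy_local f \<Longrightarrow> homotopy_local (g \<cdot> f) \<longleftrightarrow> homotopy_local g"
    and "homotopy_local g \<Longrightarrow> homotopy_local (g \<cdot> f) \<longleftrightarrow> homotopy_local f"
  unfolding homotopy_local_def Ho.quotient_comp[OF f g, symmetric]
  using HoC.precomp_bij_comp[OF Ho.quotient_homI[OF f] Ho.quotient_homI[OF g]] by blast+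

lemma homotopy_local_square:
  assumes f: "f \<in> hom M X Y" and g: "g \<in> hom M Y V" and f': "f' \<in> hom M X Y'" and g': "g' \<in> hom M Y' V"
    and eq: "g \<cdot> f = g' \<cdot> f'" and loc: "homotopy_local g" "homotopy_local f'"
  shows "homotopy_local f \<longleftrightarrow> homotopy_local g'"
  using homotopy_local_comp(2)[OF f g loc(1)] homotopy_local_comp(1)[OF f' g' loc(2)] eq by simp

lemma homotopy_local_id: "X \<in> Obj M \<Longrightarrow> homotopy_local (Id M X)"
  using HoC.precomp_bij_id[of X] by (simp add: homotopy_local_def)

text \<open>Extension along \<open>i\<close> gives surjectivity, reflection of homotopies gives injectivity.\<close>

lemma L_homotopy_local:
  assumes "i \<in> L"
  shows "homotopy_local i"
  unfolding homotopy_local_def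
proof
  fix Z assume "Z \<in> Obj Mcf"
  then have Z: "Z \<in> fibrant_objs M R" by simp
  define A B where "A = Dom M i" and "B = Cod M i"
  have i: "i \<in> hom M A B" using assms L_arr arr_in_hom by (auto simp: A_def B_def)
  note ci = Ho.quotient_homI[OF i]
  have "inj_on (\<lambda>c. c \<cdot>\<^bsub>Ho\<^esub> hclass i) (hom Ho B Z)"
  proof (rule inj_onI)
    fix c d assume "c \<in> hom Ho B Z" "d \<in> hom Ho B Z" and eq: "c \<cdot>\<^bsub>Ho\<^esub> hclass i = d \<cdot>\<^bsub>Ho\<^esub> hclass i"
    then obtain f g where f: "f \<in> hom M B Z" "c = hclass f" and g: "g \<in> hom M B Z" "d = hclass g"
      by (auto simp: Ho.quotient_hom)
    have "(f \<cdot> i, g \<cdot> i) \<in> homotopy M \<Phi>"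
      using eq f g Ho.quotient_comp[OF i] Ho.class_eq_iff homD(1)[OF comp_hom[OF i]] by simp
    then have "(f, g) \<in> homotopy M \<Phi>" using homotopy_reflected[OF assms i Z f(1) g(1)] by blast
    then show "c = d" using f g Ho.class_eq_iff homD(1) by simp
  qed
  moreover have "(\<lambda>c. c \<cdot>\<^bsub>Ho\<^esub> hclass i) ` hom Ho B Z = hom Ho A Z"
  proof
    show "(\<lambda>c. c \<cdot>\<^bsub>Ho\<^esub> hclass i) ` hom Ho B Z \<subseteq> hom Ho A Z" using HoC.comp_hom[OF ci] by blast
    show "hom Ho A Z \<subseteq> (\<lambda>c. c \<cdot>\<^bsub>Ho\<^esub> hclass i) ` hom Ho B Z"
    proof
      fix d assume "d \<in> hom Ho A Z"
      then obtain f where f: "f \<in> hom M A Z" "d = hclass f" by (auto simp: Ho.quotient_hom)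
      obtain k where k: "k \<in> hom M B Z" "k \<cdot> i = f" using extend_along_L[OF assms i Z f(1)] by blast
      show "d \<in> (\<lambda>c. c \<cdot>\<^bsub>Ho\<^esub> hclass i) ` hom Ho B Z"
        using Ho.quotient_comp[OF i k(1)] k Ho.quotient_homI[OF k(1)] f(2) by (intro image_eqI[of _ _ "hclass k"]) auto
    qed
  qed
  ultimately show "HoC.precomp_bij (hclass i) Z"
    unfolding HoC.precomp_bij_def HoC.homD[OF ci] by (simp add: bij_betw_def)
qed

subsection \<open>Weak equivalences between cofibrant objects\<close>

lemma model_facts:
  shows Cof_comp: "f \<in> Cof \<Longrightarrow> g \<in> Cof \<Longrightarrow> Cod M f = Dom M g \<Longrightarrow> g \<cdot> f \<in> Cof"
    and W_arr: "W \<subseteq> Arr M" and Fib_arr: "Fib \<subseteq> Arr M"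
    and W_id: "X \<in> Obj M \<Longrightarrow> Id M X \<in> W"
    and Cof_retract: "f \<in> Cof \<Longrightarrow> is_retract M g f \<Longrightarrow> g \<in> Cof"
    and Cof_lifting: "f \<in> Cof \<Longrightarrow> p \<in> Fib \<Longrightarrow> p \<in> W \<Longrightarrow> has_lifting M f p"
proof -
  have "wide_subcategory M Cof" "wide_subcategory M Fib" "wide_subcategory M W" "retract_closed M Cof"
    "\<forall>f\<in>Cof. \<forall>g\<in>Fib. f \<in> W \<or> g \<in> W \<longrightarrow> has_lifting M f g"
    using model_structure by (simp_all add: model_structure_def)
  then show "f \<in> Cof \<Longrightarrow> g \<in> Cof \<Longrightarrow> Cod M f = Dom M g \<Longrightarrow> g \<cdot> f \<in> Cof"
    "W \<subseteq> Arr M" "Fib \<subseteq> Arr M" "X \<in> Obj M \<Longrightarrow> Id M X \<in> W"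
    "f \<in> Cof \<Longrightarrow> is_retract M g f \<Longrightarrow> g \<in> Cof"
    "f \<in> Cof \<Longrightarrow> p \<in> Fib \<Longrightarrow> p \<in> W \<Longrightarrow> has_lifting M f p"
    by (simp_all add: wide_subcategory_def retract_closed_def) blast
qed

lemma W_cancel:
  assumes "f \<in> hom M X Y" "g \<in> hom M Y Z"
  shows W_comp: "f \<in> W \<Longrightarrow> g \<in> W \<Longrightarrow> g \<cdot> f \<in> W"
    and W_right: "g \<in> W \<Longrightarrow> g \<cdot> f \<in> W \<Longrightarrow> f \<in> W"
proof -
  have "two_out_of_three M W" using model_structure by (simp add: model_structure_def)
  then show "f \<in> W \<Longrightarrow> g \<in> W \<Longrightarrow> g \<cdot> f \<in> W" "g \<in> W \<Longrightarrow> g \<cdot> f \<in> W \<Longrightarrow> f \<in> W"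
    using homD[OF assms(1)] homD[OF assms(2)] unfolding two_out_of_three_def by metis+
qed

lemma cofibration_trivial_fibration_factorization:
  assumes f: "f \<in> hom M X Y"
  obtains i p E where "i \<in> Cof" "p \<in> Fib" "p \<in> W" "i \<in> hom M X E" "p \<in> hom M E Y" "f = p \<cdot> i"
proof -
  obtain \<Psi> where \<Psi>: "functorial_factorization M \<Psi> Cof (Fib \<inter> W)"
    using model_structure unfolding model_structure_def by blast
  have *: "fleft \<Psi> f \<in> Cof \<inter> Arr M \<and> fright \<Psi> f \<in> Fib \<inter> W \<inter> Arr M \<and>
    Dom M (fleft \<Psi> f) = Dom M f \<and> Cod M (fright \<Psi> f) = Cod M f \<and>
    Cod M (fleft \<Psi> f) = Dom M (fright \<Psi> f) \<and> f = fright \<Psi> f \<cdot> fleft \<Psi> f"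
    using \<Psi> homD(1)[OF f] unfolding functorial_factorization_def by blast
  show thesis
    by (rule that[of "fleft \<Psi> f" "fright \<Psi> f" "Cod M (fleft \<Psi> f)"])
      (use * homD[OF f] in \<open>auto simp: hom_def\<close>)
qed

text \<open>Such a map is a retract of the cofibration in its factorization.\<close>

lemma cofibration_if_lifting:
  assumes f: "f \<in> Arr M" and lift: "\<And>p. p \<in> Fib \<Longrightarrow> p \<in> W \<Longrightarrow> has_lifting M f p"
  shows "f \<in> Cof"
proof -
  obtain i p E where ip: "i \<in> Cof" "p \<in> Fib" "p \<in> W" "i \<in> hom M (Dom M f) E" "p \<in> hom M E (Cod M f)" "f = p \<cdot> i"
    using cofibration_trivial_fibration_factorization[OF arr_in_hom[OF f]] .
  then have "is_retract M f i" using retract_of_left_factor[OF ip(4,5)] lift by simp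
  then show ?thesis using Cof_retract ip(1) by blast
qed

lemma trivial_fibration_in_R:
  assumes "p \<in> Fib" "p \<in> W"
  shows "p \<in> R"
proof -
  have "R = rlp M L" using wfs unfolding weak_factorization_system_def by blast
  moreover have "p \<in> rlp M L"
    unfolding rlp_def using assms Fib_arr Cof_lifting subset_cofibrations by blast
  ultimately show ?thesis by simp
qed

lemma cofibrantD:
  assumes "X \<in> cofibrant_objs M Cof"
  shows "X \<in> Obj M" "initial_arr M X \<in> Cof" "initial_arr M X \<in> hom M (initial_obj M) X"
  using assms initial_arr_hom by (auto simp: cofibrant_objs_def)

lemma cofibrant_target:
  assumes X: "X \<in> cofibrant_objs M Cof" and i: "i \<in> Cof" "i \<in> hom M X Y"
  shows "Y \<in> cofibrant_objs M Cof"
proof -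
  note x = cofibrantD[OF X]
  have Y: "Y \<in> Obj M" using homD(5)[OF i(2)] .
  have "i \<cdot> initial_arr M X = initial_arr M Y"
    using initial_arr_unique[OF comp_hom[OF x(3) i(2)] initial_arr_hom[OF Y]] .
  then show ?thesis
    using Cof_comp[OF x(2) i(1)] homD[OF x(3)] homD[OF i(2)] Y by (simp add: cofibrant_objs_def)
qed

text \<open>The inclusion is a pushout of the cofibration from the initial object to \<open>Y\<close>.\<close>

lemma coproduct_inclusion_cofibration:
  assumes cop: "is_coproduct M X Y P i j" and Y: "Y \<in> cofibrant_objs M Cof"
  shows "i \<in> Cof"
proof (rule cofibration_if_lifting)
  have i: "i \<in> hom M X P" and j: "j \<in> hom M Y P"
    and uni: "\<And>T f g. f \<in> hom M X T \<Longrightarrow> g \<in> hom M Y T \<Longrightarrow> \<exists>!h. h \<in> hom M P T \<and> h \<cdot> i = f \<and> h \<cdot> j = g"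
    using cop by (auto simp: is_coproduct_def)
  show "i \<in> Arr M" using homD(1)[OF i] .
  fix p assume pFib: "p \<in> Fib" and pW: "p \<in> W"
  then have p: "p \<in> hom M (Dom M p) (Cod M p)" using Fib_arr arr_in_hom by blast
  note y = cofibrantD[OF Y]
  show "has_lifting M i p"
  proof (rule has_liftingI[OF i p])
    fix a b assume a: "a \<in> hom M X (Dom M p)" and b: "b \<in> hom M P (Cod M p)" and eq: "p \<cdot> a = b \<cdot> i"
    have bj: "b \<cdot> j \<in> hom M Y (Cod M p)" using comp_hom[OF j b] .
    note z = initial_arr_hom[OF homD(4)[OF p]]
    have "p \<cdot> initial_arr M (Dom M p) = (b \<cdot> j) \<cdot> initial_arr M Y"
      using initial_arr_unique comp_hom[OF z p] comp_hom[OF y(3) bj] by blast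
    then obtain k where k: "k \<in> hom M Y (Dom M p)" "p \<cdot> k = b \<cdot> j"
      using has_liftingD[OF Cof_lifting[OF y(2) pFib pW] y(3) p z bj] by blast
    obtain h where h: "h \<in> hom M P (Dom M p)" "h \<cdot> i = a" "h \<cdot> j = k" using uni[OF a k(1)] by blast
    have "p \<cdot> h = b"
      using uni[OF comp_hom[OF i b] bj] comp_hom[OF h(1) p] b assoc[OF i h(1) p] assoc[OF j h(1) p]
        h(2,3) k(2) eq by auto
    then show "\<exists>k\<in>hom M P (Dom M p). k \<cdot> i = a \<and> p \<cdot> k = b" using h by blast
  qed
qed

text \<open>Ken Brown's lemma: factoring \<open>[w, id]\<close> through a trivial fibration \<open>p\<close> exhibits \<open>w\<close> as
  \<open>p\<close> after a trivial cofibration, where \<open>p\<close> has a trivial cofibration as a section.\<close>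

lemma W_homotopy_local:
  assumes w: "w \<in> W" "w \<in> hom M X Y" and X: "X \<in> cofibrant_objs M Cof" and Y: "Y \<in> cofibrant_objs M Cof"
  shows "homotopy_local w"
proof -
  have XY: "X \<in> Obj M" "Y \<in> Obj M" using cofibrantD(1) X Y by auto
  obtain P i j where cop: "is_coproduct M X Y P i j"
    using coproduct_exists[OF cocomplete infinite_universe XY] by blast
  then have cop': "is_coproduct M Y X P j i" unfolding is_coproduct_def by (metis (no_types, lifting))
  have i: "i \<in> hom M X P" "i \<in> Cof" and j: "j \<in> hom M Y P" "j \<in> Cof"
    using cop coproduct_inclusion_cofibration[OF cop Y] coproduct_inclusion_cofibration[OF cop' X]
    by (auto simp: is_coproduct_def)
  obtain h where h: "h \<in> hom M P Y" "h \<cdot> i = w" "h \<cdot> j = Id M Y"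
    using cop w(2) id_hom[OF XY(2)] unfolding is_coproduct_def by blast
  obtain k p E where k: "k \<in> Cof" "k \<in> hom M P E" and p: "p \<in> W" "p \<in> hom M E Y" and hpk: "h = p \<cdot> k"
    using cofibration_trivial_fibration_factorization[OF h(1)] by blast
  have ki: "k \<cdot> i \<in> hom M X E" "k \<cdot> i \<in> Cof" and kj: "k \<cdot> j \<in> hom M Y E" "k \<cdot> j \<in> Cof"
    using comp_hom[OF i(1) k(2)] comp_hom[OF j(1) k(2)] Cof_comp[OF i(2) k(1)] Cof_comp[OF j(2) k(1)]
      homD[OF i(1)] homD[OF j(1)] homD[OF k(2)] by simp_all
  have pki: "p \<cdot> (k \<cdot> i) = w" and pkj: "p \<cdot> (k \<cdot> j) = Id M Y"
    using assoc[OF i(1) k(2) p(2)] assoc[OF j(1) k(2) p(2)] h(2,3) hpk by simp_all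
  have "k \<cdot> i \<in> W" "k \<cdot> j \<in> W"
    using W_right[OF ki(1) p(2) p(1)] W_right[OF kj(1) p(2) p(1)] pki pkj w(1) W_id[OF XY(2)] by simp_all
  then have "homotopy_local (k \<cdot> i)" "homotopy_local (k \<cdot> j)"
    using L_homotopy_local trivial_cofibrations_subset ki kj by blast+
  moreover from this have "homotopy_local p"
    using homotopy_local_comp(1)[OF kj(1) p(2)] pkj homotopy_local_id[OF XY(2)] by simp
  ultimately show ?thesis using homotopy_local_comp(1)[OF ki(1) p(2)] pki by simp
qed

subsection \<open>Cofibrant and fibrant replacement\<close>

abbreviation "RL \<equiv> fibrant_replacement M \<Phi>"
abbreviation "RQ \<equiv> fibrant_replacement M \<Phi> \<circ>\<^sub>F Q"

definition unit :: "'o \<Rightarrow> 'a" where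
  "unit X = fleft \<Phi> (terminal_arr M X)"

lemma unit_hom:
  assumes "X \<in> Obj M"
  shows "unit X \<in> hom M X (fo RL X)" "unit X \<in> L" "fo RL X \<in> fibrant_objs M R"
proof -
  note fac = factorization_hom[OF terminal_arr_hom[OF assms]]
  show u: "unit X \<in> hom M X (fo RL X)" and "unit X \<in> L"
    using fac by (simp_all add: unit_def fibrant_replacement_def)
  have "terminal_arr M (fo RL X) = fright \<Phi> (terminal_arr M X)"
    by (rule terminal_arr_unique[OF terminal_arr_hom[OF homD(5)[OF u]]])
      (use fac(2) in \<open>simp add: fibrant_replacement_def\<close>)
  then show "fo RL X \<in> fibrant_objs M R" using fac(5) homD(5)[OF u] by (simp add: fibrant_objs_def)
qed

lemma RL_cofibrant:
  assumes "X \<in> cofibrant_objs M Cof"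
  shows "fo RL X \<in> cofibrant_objs M Cof"
  using cofibrant_target[OF assms _ unit_hom(1)] unit_hom(2) subset_cofibrations cofibrantD(1)[OF assms] by blast

lemma RL_hom:
  assumes f: "f \<in> hom M X Y"
  shows "fa RL f \<in> hom M (fo RL X) (fo RL Y)" "fa RL f \<cdot> unit X = unit Y \<cdot> f"
proof -
  note t = terminal_arr_hom[OF homD(4)[OF f]] terminal_arr_hom[OF homD(5)[OF f]]
  have "terminal_arr M Y \<cdot> f = Id M (terminal_obj M) \<cdot> terminal_arr M X"
    using terminal_arr_unique[OF comp_hom[OF f t(2)] comp_hom[OF t(1) id_hom[OF terminal_obj_in]]] .
  from factorization_mid[OF t f id_hom[OF terminal_obj_in] this]
  show "fa RL f \<in> hom M (fo RL X) (fo RL Y)" "fa RL f \<cdot> unit X = unit Y \<cdot> f"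
    by (simp_all add: fibrant_replacement_def unit_def homD[OF f])
qed

lemma RL_functor: "is_functor Mcof Mcf RL"
proof -
  interpret A: category Mcof unfolding Mcof_full by (rule full_sub_category)
  interpret B: category Mcf unfolding Mcf_full by (rule full_sub_category)
  have objs: "fo RL X \<in> cofibrant_objs M Cof \<inter> fibrant_objs M R" if "X \<in> cofibrant_objs M Cof" for X
    using RL_cofibrant[OF that] unit_hom(3) cofibrantD(1)[OF that] by blast
  note one = id_hom[OF terminal_obj_in]
  show ?thesis
  proof unfold_locales
    fix X assume "X \<in> Obj Mcof"
    then show "fo RL X \<in> Obj Mcf" using objs by simp
  next
    fix X assume "X \<in> Obj Mcof"
    then have X: "X \<in> Obj M" using cofibrantD(1) by simp
    note t = terminal_arr_hom[OF X]
    have "\<forall>f\<in>Arr M. fmid \<Phi> f f (Id M (Dom M f)) (Id M (Cod M f)) = Id M (Cod M (fleft \<Phi> f))"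
      using factorization by (simp add: functorial_factorization_def)
    from bspec[OF this homD(1)[OF t]] show "fa RL (Id Mcof X) = Id Mcf (fo RL X)"
      by (simp add: fibrant_replacement_def Mcof_full Mcf_full homD(2,3)[OF t] homD(2,3)[OF id_hom[OF X]])
  next
    fix f X Y assume "f \<in> hom Mcof X Y"
    then show "fa RL f \<in> hom Mcf (fo RL X) (fo RL Y)"
      unfolding Mcof_full Mcf_full using RL_hom(1) objs by (auto dest!: hom_full_subD simp: hom_full_sub)
  next
    fix f X Y g Z assume "f \<in> hom Mcof X Y" "g \<in> hom Mcof Y Z"
    then have f: "f \<in> hom M X Y" and g: "g \<in> hom M Y Z"
      unfolding Mcof_full by (auto dest!: hom_full_subD)
    note t = terminal_arr_hom[OF homD(4)[OF f]] terminal_arr_hom[OF homD(5)[OF f]]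
      terminal_arr_hom[OF homD(5)[OF g]]
    have "terminal_arr M Y \<cdot> f = Id M (terminal_obj M) \<cdot> terminal_arr M X"
      "terminal_arr M Z \<cdot> g = Id M (terminal_obj M) \<cdot> terminal_arr M Y"
      using terminal_arr_unique[OF comp_hom[OF f t(2)] comp_hom[OF t(1) one]]
        terminal_arr_unique[OF comp_hom[OF g t(3)] comp_hom[OF t(2) one]] .
    then have "square M (terminal_arr M X) (terminal_arr M Y) f (Id M (terminal_obj M))"
      "square M (terminal_arr M Y) (terminal_arr M Z) g (Id M (terminal_obj M))"
      using f g one by (simp_all add: square_def homD[OF t(1)] homD[OF t(2)] homD[OF t(3)])
    then have "fmid \<Phi> (terminal_arr M X) (terminal_arr M Z) (g \<cdot> f) (Id M (terminal_obj M) \<cdot> Id M (terminal_obj M))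
      = fmid \<Phi> (terminal_arr M Y) (terminal_arr M Z) g (Id M (terminal_obj M)) \<cdot>
        fmid \<Phi> (terminal_arr M X) (terminal_arr M Y) f (Id M (terminal_obj M))"
      using factorization unfolding functorial_factorization_def by blast
    then show "fa RL (g \<cdot>\<^bsub>Mcof\<^esub> f) = fa RL g \<cdot>\<^bsub>Mcf\<^esub> fa RL f"
      using id_left[OF one] homD[OF f] homD[OF g] homD[OF comp_hom[OF f g]]
      by (simp add: fibrant_replacement_def Mcof_full Mcf_full)
  qed
qed

lemma Q_functor: "is_functor M Mcof Q"
  using replacement by (simp add: cofibrant_replacement_def)

lemma RQ_functor: "is_functor M Mcf RQ"
  using comp_is_functor[OF Q_functor RL_functor] .

lemma Q_obj: "X \<in> Obj M \<Longrightarrow> fo Q X \<in> cofibrant_objs M Cof"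
  using is_functor.fo_obj[OF Q_functor] by simp

lemma Q_hom: "f \<in> hom M X Y \<Longrightarrow> fa Q f \<in> hom M (fo Q X) (fo Q Y)"
  using is_functor.fa_hom[OF Q_functor, of f X Y] by (auto simp: Mcof_full dest: hom_full_subD)

lemma q_hom:
  assumes "X \<in> Obj M"
  shows "q X \<in> hom M (fo Q X) X" "q X \<in> Fib" "q X \<in> W"
  using replacement assms by (auto simp: cofibrant_replacement_def)

lemma q_natural: "f \<in> hom M X Y \<Longrightarrow> q Y \<cdot> fa Q f = f \<cdot> q X"
  using replacement homD(1-3)[of f X Y] unfolding cofibrant_replacement_def by metis

text \<open>A trivial fibration belongs to the right class, so \<open>Q\<close> preserves fibrancy.\<close>

lemma Q_fibrant:
  assumes "X \<in> fibrant_objs M R"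
  shows "fo Q X \<in> fibrant_objs M R"
proof -
  have X: "X \<in> Obj M" "terminal_arr M X \<in> R" using assms by (auto simp: fibrant_objs_def)
  note qX = q_hom[OF X(1)] and t = terminal_arr_hom[OF X(1)]
  have QX: "fo Q X \<in> Obj M" using homD(4)[OF qX(1)] .
  have R: "R = rlp M L" using wfs unfolding weak_factorization_system_def by blast
  have "terminal_arr M X \<cdot> q X \<in> R"
    using rlp_comp[OF _ qX(1) _ t, of L] trivial_fibration_in_R[OF qX(2,3)] X(2) R by blast
  moreover have "terminal_arr M X \<cdot> q X = terminal_arr M (fo Q X)"
    using terminal_arr_unique[OF comp_hom[OF qX(1) t] terminal_arr_hom[OF QX]] .
  ultimately show ?thesis using QX by (simp add: fibrant_objs_def)
qed

text \<open>Compare \<open>RQ f\<close> with \<open>Q f\<close> by the units \<open>Q X \<rightarrow> RQ X\<close>, which are in \<open>L\<close>.\<close>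

lemma homotopy_local_RQ:
  assumes f: "f \<in> hom M X Y"
  shows "homotopy_local (fa RQ f) \<longleftrightarrow> homotopy_local (fa Q f)"
proof -
  note Qf = Q_hom[OF f]
  note u = unit_hom[OF homD(4)[OF Qf]] unit_hom[OF homD(5)[OF Qf]]
  show ?thesis
    using homotopy_local_square[OF Qf u(4) u(1) RL_hom(1)[OF Qf]] RL_hom(2)[OF Qf] L_homotopy_local u(2,5)
    by simp
qed

text \<open>Compare \<open>Q f\<close> with \<open>f\<close> by the maps \<open>Q X \<rightarrow> X\<close> and \<open>Q Y \<rightarrow> Y\<close>. Cofibrancy of \<open>X\<close> and \<open>Y\<close> makes them
  weak equivalences between cofibrant objects, to which Ken Brown's lemma applies.\<close>

lemma homotopy_local_Q:
  assumes f: "f \<in> hom M X Y" and X: "X \<in> cofibrant_objs M Cof" and Y: "Y \<in> cofibrant_objs M Cof"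
  shows "homotopy_local (fa Q f) \<longleftrightarrow> homotopy_local f"
proof -
  note qX = q_hom[OF homD(4)[OF f]] and qY = q_hom[OF homD(5)[OF f]]
  have "homotopy_local (q X)" "homotopy_local (q Y)"
    using W_homotopy_local[OF qX(3,1) Q_obj[OF homD(4)[OF f]] X]
      W_homotopy_local[OF qY(3,1) Q_obj[OF homD(5)[OF f]] Y] .
  then show ?thesis
    using homotopy_local_square[OF Q_hom[OF f] qY(1) qX(1) f q_natural[OF f]] by blast
qed

lemma Q_weak_equivalence:
  assumes f: "f \<in> hom M X Y" and w: "f \<in> W"
  shows "fa Q f \<in> W"
proof -
  note qX = q_hom[OF homD(4)[OF f]] and qY = q_hom[OF homD(5)[OF f]]
  have "f \<cdot> q X \<in> W" using W_comp[OF qX(1) f qX(3) w] .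
  then show ?thesis using W_right[OF Q_hom[OF f] qY(1) qY(3)] q_natural[OF f] by simp
qed

abbreviation "WL \<equiv> local_equivalences M Cof R \<Phi> Q"

text \<open>The set of homotopy classes of maps is a hom-set of \<open>Ho\<close>, and the map of quotient sets that
  defines the local equivalences is composition in \<open>Ho\<close>.\<close>

lemma local_equivalences_iff:
  assumes f: "f \<in> hom M X Y"
  shows "f \<in> WL \<longleftrightarrow> homotopy_local (fa RQ f)"
proof -
  have RQf: "fa RQ f \<in> hom M (fo RQ X) (fo RQ Y)"
    using RL_hom(1)[OF Q_hom[OF f]] by simp
  have class_Image: "hclass k = homotopy M \<Phi> `` {k}" if "k \<in> hom M V Z" for k V Z
    using homD(1)[OF homotopy_parallel[OF _ that]] by (auto simp: quotient_class_def)
  have quot: "hom M V Z // homotopy M \<Phi> = hom Ho V Z" for V Z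
    using class_Image unfolding Ho.quotient_hom quotient_def by blast
  have "homotopy M \<Phi> `` ((\<lambda>g. g \<cdot> fa RQ f) ` c) = c \<cdot>\<^bsub>Ho\<^esub> hclass (fa RQ f)"
    if c: "c \<in> hom Ho (fo RQ Y) Z" for c Z
  proof -
    obtain k where k: "k \<in> hom M (fo RQ Y) Z" "c = hclass k"
      using c unfolding Ho.quotient_hom by blast
    have kc: "k \<in> c" using k Ho.cong_refl homD(1)[OF k(1)] by (simp add: quotient_class_def)
    have "(k \<cdot> fa RQ f, g \<cdot> fa RQ f) \<in> homotopy M \<Phi>" if "g \<in> c" for g
      using that k Ho.cong_comp[OF Ho.cong_refl[OF homD(1)[OF RQf]] RQf _ k(1)] by (simp add: quotient_class_def)
    then have "homotopy M \<Phi> `` ((\<lambda>g. g \<cdot> fa RQ f) ` c) = homotopy M \<Phi> `` {k \<cdot> fa RQ f}"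
      using kc Ho.cong_trans by blast
    then show ?thesis
      using class_Image[OF comp_hom[OF RQf k(1)]] Ho.quotient_comp[OF RQf k(1)] k(2) by simp
  qed
  then have "bij_betw (\<lambda>c. homotopy M \<Phi> `` ((\<lambda>g. g \<cdot> fa RQ f) ` c)) (hom Ho (fo RQ Y) Z) (hom Ho (fo RQ X) Z)
    \<longleftrightarrow> HoC.precomp_bij (hclass (fa RQ f)) Z" for Z
    unfolding HoC.precomp_bij_def HoC.homD[OF Ho.quotient_homI[OF RQf]] by (intro bij_betw_cong) simp
  then show ?thesis
    by (simp add: local_equivalences_def homotopy_local_def quot homD[OF f] Let_def)
qed

lemma W_subset_WL: "W \<subseteq> WL"
proof
  fix f assume f: "f \<in> W"
  then have fh: "f \<in> hom M (Dom M f) (Cod M f)" using W_arr arr_in_hom by blast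
  have "homotopy_local (fa Q f)"
    using W_homotopy_local[OF Q_weak_equivalence[OF fh f] Q_hom[OF fh]] Q_obj homD(4,5)[OF fh] by blast
  then show "f \<in> WL" using local_equivalences_iff[OF fh] homotopy_local_RQ[OF fh] by blast
qed

lemma L_cofibrant_WL:
  assumes "f \<in> L" "f \<in> hom M X Y" "X \<in> cofibrant_objs M Cof" "Y \<in> cofibrant_objs M Cof"
  shows "f \<in> WL"
  using assms L_homotopy_local homotopy_local_Q homotopy_local_RQ local_equivalences_iff by blast

end

context relative_model_category
begin

section \<open>Inverting the local equivalences\<close>

lemma Mcof_category: "category Mcof"
  unfolding Mcof_full by (rule full_sub_category)

sublocale HoMcf: arrow_congruence Mcf "homotopy M \<Phi>"
  unfolding Mcf_full by (rule Ho.full_sub_congruence)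

abbreviation "A \<equiv> quotient_cat Mcf (homotopy M \<Phi>)"
abbreviation "\<pi> \<equiv> quotient_functor Mcf (homotopy M \<Phi>)"
abbreviation "B \<equiv> localization Mcof (W \<union> L)"
abbreviation "\<gamma>B \<equiv> localization_functor Mcof (W \<union> L)"
abbreviation "C \<equiv> localization M WL"
abbreviation "\<gamma>C \<equiv> localization_functor M WL"

lemma hom_Mcof: "X \<in> cofibrant_objs M Cof \<Longrightarrow> Y \<in> cofibrant_objs M Cof \<Longrightarrow> hom Mcof X Y = hom M X Y"
  unfolding Mcof_full by (rule hom_full_sub)

lemma hom_McofD:
  "f \<in> hom Mcof X Y \<Longrightarrow> f \<in> hom M X Y \<and> X \<in> cofibrant_objs M Cof \<and> Y \<in> cofibrant_objs M Cof"
  unfolding Mcof_full by (rule hom_full_subD)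

lemma hom_Mcf: "X \<in> Obj Mcf \<Longrightarrow> Y \<in> Obj Mcf \<Longrightarrow> hom Mcf X Y = hom M X Y"
  unfolding Mcf_full by (rule hom_full_sub) (auto simp: Mcf_full)

lemma hom_McfD: "f \<in> hom Mcf X Y \<Longrightarrow> f \<in> hom M X Y \<and> X \<in> Obj Mcf \<and> Y \<in> Obj Mcf"
  using HoMcf.homD(4,5) hom_Mcf by blast

lemma Comp_Mcof [simp]: "Comp Mcof = Comp M" and Comp_Mcf [simp]: "Comp Mcf = Comp M"
  and Id_Mcof [simp]: "Id Mcof = Id M" and Id_Mcf [simp]: "Id Mcf = Id M"
  by (simp_all add: Mcof_full Mcf_full)

text \<open>Homotopy classes do not depend on the ambient category, because homotopic maps are parallel.\<close>

lemma hclass_Mcf: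
  assumes "f \<in> hom Mcf X Y"
  shows "quotient_class Mcf (homotopy M \<Phi>) f = hclass f"
  using HoMcf.cong_parallel[OF _ assms] HoMcf.homD(1) Ho.cong_parallel[of f _ X Y] hom_McfD[OF assms] homD(1)
  unfolding quotient_class_def by blast

lemma hom_A:
  assumes "X \<in> Obj Mcf" "Y \<in> Obj Mcf"
  shows "hom A X Y = hom Ho X Y"
  unfolding HoMcf.quotient_hom Ho.quotient_hom hom_Mcf[OF assms, symmetric]
  using hclass_Mcf by (intro image_cong) auto

lemma comp_A:
  assumes f: "f \<in> hom Mcf X Y" and d: "d \<in> hom A Y Z"
  shows "d \<cdot>\<^bsub>A\<^esub> quotient_class Mcf (homotopy M \<Phi>) f = d \<cdot>\<^bsub>Ho\<^esub> hclass f"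
proof -
  obtain g where g: "g \<in> hom Mcf Y Z" "d = quotient_class Mcf (homotopy M \<Phi>) g"
    using d unfolding HoMcf.quotient_hom by blast
  show ?thesis
    using HoMcf.quotient_comp[OF f g(1)] Ho.quotient_comp[of f X Y g Z] hclass_Mcf[OF g(1)]
      hclass_Mcf[OF HoMcf.comp_hom[OF f g(1)]] g(2) hom_McfD[OF f] hom_McfD[OF g(1)] by simp
qed

text \<open>The Whitehead theorem, by the Yoneda argument: source and target are among the objects that
  a homotopy local map is tested against.\<close>

lemma homotopy_local_iso:
  assumes f: "f \<in> hom Mcf X Y" and loc: "homotopy_local f"
  shows "is_iso A (fa \<pi> f)"
proof -
  interpret A: category A by (rule HoMcf.quotient_category)
  have XY: "X \<in> Obj Mcf" "Y \<in> Obj Mcf" and fM: "f \<in> hom M X Y" using hom_McfD[OF f] by auto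
  have bij: "bij_betw (\<lambda>c. c \<cdot>\<^bsub>Ho\<^esub> hclass f) (hom A Y Z) (hom A X Z)" if "Z \<in> Obj Mcf" for Z
    using loc that HoC.homD(2,3)[OF Ho.quotient_homI[OF fM]] hom_A[OF XY(1) that] hom_A[OF XY(2) that]
    unfolding homotopy_local_def HoC.precomp_bij_def by simp
  have "is_iso A (quotient_class Mcf (homotopy M \<Phi>) f)"
  proof (rule A.iso_if_precomposition_bij[OF HoMcf.quotient_homI[OF f]])
    have "Id A X \<in> (\<lambda>c. c \<cdot>\<^bsub>Ho\<^esub> hclass f) ` hom A Y X"
      using bij_betw_imp_surj_on[OF bij[OF XY(1)]] A.id_hom[of X] XY(1) by simp
    then show "\<exists>g\<in>hom A Y X. g \<cdot>\<^bsub>A\<^esub> quotient_class Mcf (homotopy M \<Phi>) f = Id A X"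
      using comp_A[OF f] by auto
  next
    fix g g' assume "g \<in> hom A Y Y" "g' \<in> hom A Y Y"
      "g \<cdot>\<^bsub>A\<^esub> quotient_class Mcf (homotopy M \<Phi>) f = g' \<cdot>\<^bsub>A\<^esub> quotient_class Mcf (homotopy M \<Phi>) f"
    then show "g = g'"
      using inj_onD[OF bij_betw_imp_inj_on[OF bij[OF XY(2)]]] comp_A[OF f] by simp
  qed
  then show ?thesis by simp
qed

lemma WL_inverted:
  assumes "f \<in> Arr M" "f \<in> WL"
  shows "is_iso A (fa (\<pi> \<circ>\<^sub>F RQ) f)"
  using homotopy_local_iso[OF is_functor.fa_hom[OF RQ_functor arr_in_hom[OF assms(1)]]]
    local_equivalences_iff[OF arr_in_hom[OF assms(1)]] assms(2) by simp

lemma Mcof_inverted: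
  assumes "f \<in> Arr Mcof" "f \<in> W \<union> L"
  shows "f \<in> hom M (Dom M f) (Cod M f)" "f \<in> WL"
proof -
  have f: "f \<in> Arr M" "Dom M f \<in> cofibrant_objs M Cof" "Cod M f \<in> cofibrant_objs M Cof"
    using assms(1) by (auto simp: Mcof_full)
  then show "f \<in> hom M (Dom M f) (Cod M f)" by (simp add: arr_in_hom)
  then show "f \<in> WL" using assms(2) W_subset_WL L_cofibrant_WL f by blast
qed

text \<open>The two ends of a path have the common section \<open>constant_path\<close>, which is inverted;
  hence they become equal, and so do homotopic maps.\<close>

lemma homotopic_equal_in_localization:
  assumes fg: "(f, g) \<in> homotopy M \<Phi>" and f: "f \<in> hom Mcof X Y"
  shows "fa \<gamma>B f = fa \<gamma>B g"
proof -
  interpret cof: category Mcof by (rule Mcof_category)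
  interpret loc: category B by (rule cof.localization_category)
  interpret \<gamma>: is_functor Mcof B \<gamma>B by (rule cof.localization_functor)
  have fM: "f \<in> hom M X Y" and X: "X \<in> cofibrant_objs M Cof" and Y: "Y \<in> cofibrant_objs M Cof"
    using hom_McofD[OF f] by auto
  note p = path_hom[OF cofibrantD(1)[OF Y]]
  have P: "path_obj M \<Phi> Y \<in> cofibrant_objs M Cof"
    using cofibrant_target[OF Y _ p(3)] p(4) subset_cofibrations by blast
  have c: "constant_path Y \<in> hom Mcof Y (path_obj M \<Phi> Y)"
    and s: "start Y \<in> hom Mcof (path_obj M \<Phi> Y) Y" and e: "finish Y \<in> hom Mcof (path_obj M \<Phi> Y) Y"
    using p(1-3) hom_Mcof[OF Y P] hom_Mcof[OF P Y] by auto
  have ends: "fa \<gamma>B (start Y) = fa \<gamma>B (finish Y)"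
  proof (rule loc.iso_cancel_right[OF _ \<gamma>.fa_hom[OF c] \<gamma>.fa_hom[OF s] \<gamma>.fa_hom[OF e]])
    show "is_iso B (fa \<gamma>B (constant_path Y))" using cof.localization_inverts[OF c] p(4) by blast
    show "fa \<gamma>B (start Y) \<cdot>\<^bsub>B\<^esub> fa \<gamma>B (constant_path Y) = fa \<gamma>B (finish Y) \<cdot>\<^bsub>B\<^esub> fa \<gamma>B (constant_path Y)"
      using \<gamma>.fa_comp[OF c s] \<gamma>.fa_comp[OF c e] p(5,6) by simp
  qed
  have right: "fa \<gamma>B h = fa \<gamma>B k" if hk: "(h, k) \<in> right_homotopy M \<Phi>" and h: "h \<in> hom M X Y" for h k
  proof -
    obtain H where H: "H \<in> hom M X (path_obj M \<Phi> Y)" "start Y \<cdot> H = h" "finish Y \<cdot> H = k"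
      using hk right_homotopy_iff[OF h right_homotopy_parallel[OF hk h]] by blast
    have Hc: "H \<in> hom Mcof X (path_obj M \<Phi> Y)" using H(1) hom_Mcof[OF X P] by simp
    show ?thesis using \<gamma>.fa_comp[OF Hc s] \<gamma>.fa_comp[OF Hc e] H(2,3) ends by simp
  qed
  show ?thesis
    using fg unfolding homotopy_def
  proof (induction rule: trancl_induct)
    case (base g)
    then show ?case using right fM by blast
  next
    case (step g h)
    have "g \<in> hom M X Y" using homotopy_parallel[OF _ fM] step(1) by (simp add: homotopy_def)
    then show ?case using right step(2,3) by simp
  qed
qed

text \<open>The zigzag \<open>X \<leftarrow> Q X \<rightarrow> RQ X\<close> of replacement maps is a natural isomorphism wherever
  these maps are inverted.\<close>

lemma replacement_natural_iso:
  assumes T: "is_functor (full_sub M P) D T"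
    and closed: "\<forall>X\<in>Obj M \<inter> P. fo Q X \<in> P \<and> fo RQ X \<in> P"
    and inverted: "\<forall>X\<in>Obj M \<inter> P. is_iso D (fa T (q X)) \<and> is_iso D (fa T (unit (fo Q X)))"
  defines "t \<equiv> \<lambda>X. fa T (q X) \<cdot>\<^bsub>D\<^esub> inv_arr D (fa T (unit (fo Q X)))"
  shows "X \<in> Obj M \<Longrightarrow> X \<in> P \<Longrightarrow> t X \<in> hom D (fo T (fo RQ X)) (fo T X)"
    and "X \<in> Obj M \<Longrightarrow> X \<in> P \<Longrightarrow> is_iso D (t X)"
    and "f \<in> hom M X Y \<Longrightarrow> X \<in> P \<Longrightarrow> Y \<in> P \<Longrightarrow> t Y \<cdot>\<^bsub>D\<^esub> fa T (fa RQ f) = fa T f \<cdot>\<^bsub>D\<^esub> t X"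
proof -
  interpret T: is_functor "full_sub M P" D T by fact
  have P: "fo Q X \<in> P" "fo RQ X \<in> P"
    and iso_q: "is_iso D (fa T (q X))" and iso_unit: "is_iso D (fa T (unit (fo Q X)))"
    if "X \<in> Obj M" "X \<in> P" for X
    using closed inverted that by blast+
  have qT: "fa T (q X) \<in> hom D (fo T (fo Q X)) (fo T X)"
    and uT: "fa T (unit (fo Q X)) \<in> hom D (fo T (fo Q X)) (fo T (fo RQ X))"
    if "X \<in> Obj M" "X \<in> P" for X
    using that T.fa_hom q_hom(1)[of X] unit_hom(1)[of "fo Q X"] P[OF that] homD(4)[OF q_hom(1)[of X]]
    by (simp_all add: hom_full_sub)
  have iT: "inv_arr D (fa T (unit (fo Q X))) \<in> hom D (fo T (fo RQ X)) (fo T (fo Q X))"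
    "inv_arr D (fa T (unit (fo Q X))) \<cdot>\<^bsub>D\<^esub> fa T (unit (fo Q X)) = Id D (fo T (fo Q X))"
    "is_iso D (inv_arr D (fa T (unit (fo Q X))))"
    if "X \<in> Obj M" "X \<in> P" for X
    using T.B.inv_arr[OF iso_unit[OF that] uT[OF that]] T.B.inv_arr_iso[OF iso_unit[OF that] uT[OF that]]
    by auto
  show tT: "t X \<in> hom D (fo T (fo RQ X)) (fo T X)" if "X \<in> Obj M" "X \<in> P" for X
    unfolding t_def using T.B.comp_hom[OF iT(1) qT] that by blast
  show "is_iso D (t X)" if "X \<in> Obj M" "X \<in> P" for X
    unfolding t_def using T.B.iso_comp[OF iT(3,1) iso_q qT] that by blast
  assume f: "f \<in> hom M X Y" and X: "X \<in> P" and Y: "Y \<in> P"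
  note oX = homD(4)[OF f] and oY = homD(5)[OF f]
  note Qf = Q_hom[OF f]
  have RQf: "fa RQ f \<in> hom M (fo RQ X) (fo RQ Y)" using RL_hom(1)[OF Qf] by simp
  have uX: "unit (fo Q X) \<in> hom (full_sub M P) (fo Q X) (fo RQ X)"
    and uY: "unit (fo Q Y) \<in> hom (full_sub M P) (fo Q Y) (fo RQ Y)"
    and qX: "q X \<in> hom (full_sub M P) (fo Q X) X" and qY: "q Y \<in> hom (full_sub M P) (fo Q Y) Y"
    and Qf': "fa Q f \<in> hom (full_sub M P) (fo Q X) (fo Q Y)"
    and RQf': "fa RQ f \<in> hom (full_sub M P) (fo RQ X) (fo RQ Y)"
    and f': "f \<in> hom (full_sub M P) X Y"
    using q_hom(1)[OF oX] q_hom(1)[OF oY] unit_hom(1)[OF homD(4)[OF Qf]] unit_hom(1)[OF homD(5)[OF Qf]]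
      Qf RQf f X Y P[OF oX X] P[OF oY Y] by (simp_all add: hom_full_sub)
  let ?iY = "inv_arr D (fa T (unit (fo Q Y)))" and ?uX = "fa T (unit (fo Q X))"
  let ?uY = "fa T (unit (fo Q Y))"
  note iX = iT[OF oX X] and iY = iT[OF oY Y]
  have "fa T (fa RQ f) \<cdot>\<^bsub>D\<^esub> ?uX = ?uY \<cdot>\<^bsub>D\<^esub> fa T (fa Q f)"
    using T.fa_comp[OF uX RQf'] T.fa_comp[OF Qf' uY] RL_hom(2)[OF Qf] by simp
  then have "?iY \<cdot>\<^bsub>D\<^esub> (fa T (fa RQ f) \<cdot>\<^bsub>D\<^esub> ?uX) = fa T (fa Q f)"
    using T.B.assoc[OF T.fa_hom[OF Qf'] T.fa_hom[OF uY] iY(1)] iY(2) T.B.id_left[OF T.fa_hom[OF Qf']] by simp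
  then have "(t Y \<cdot>\<^bsub>D\<^esub> fa T (fa RQ f)) \<cdot>\<^bsub>D\<^esub> ?uX = fa T (q Y) \<cdot>\<^bsub>D\<^esub> fa T (fa Q f)"
    unfolding t_def
    using T.B.assoc[OF T.fa_hom[OF uX] T.fa_hom[OF RQf'] tT[OF oY Y]]
      T.B.assoc[OF T.B.comp_hom[OF T.fa_hom[OF uX] T.fa_hom[OF RQf']] iY(1) qT[OF oY Y]]
    by (simp add: t_def)
  also have "\<dots> = fa T f \<cdot>\<^bsub>D\<^esub> fa T (q X)"
    using T.fa_comp[OF Qf' qY] T.fa_comp[OF qX f'] q_natural[OF f] by simp
  also have "\<dots> = (fa T f \<cdot>\<^bsub>D\<^esub> t X) \<cdot>\<^bsub>D\<^esub> ?uX"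
    using T.B.assoc[OF T.fa_hom[OF uX] tT[OF oX X] T.fa_hom[OF f']]
      T.B.assoc[OF T.fa_hom[OF uX] iX(1) qT[OF oX X]] iX(2) T.B.id_right[OF qT[OF oX X]]
    by (simp add: t_def)
  finally show "t Y \<cdot>\<^bsub>D\<^esub> fa T (fa RQ f) = fa T f \<cdot>\<^bsub>D\<^esub> t X"
    using T.B.iso_cancel_right[OF iso_unit[OF oX X] uT[OF oX X] T.B.comp_hom[OF T.fa_hom[OF RQf'] tT[OF oY Y]]
      T.B.comp_hom[OF tT[OF oX X] T.fa_hom[OF f']]] by blast
qed

text \<open>The functors are those of the universal properties. On objects \<open>F\<close> and \<open>G\<close> are identities and
  \<open>H\<close> is \<open>RQ\<close>, so each of the three composites around the triangle is \<open>RQ\<close> on representatives, and the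
  replacement zigzag makes it isomorphic to the identity. Hence \<open>H \<circ> G\<close>, \<open>F \<circ> H\<close> and \<open>H\<close> are
  quasi-inverse to \<open>F\<close>, \<open>G\<close> and \<open>G \<circ> F\<close>.\<close>

lemma localization_equivalences:
  "(\<exists>F G H.
      is_unique_factorization Mcf A B \<pi> (\<gamma>B \<circ>\<^sub>F id_functor) F \<and>
      equivalence_of_categories A B F \<and>
      is_unique_factorization Mcof B C \<gamma>B (\<gamma>C \<circ>\<^sub>F id_functor) G \<and>
      equivalence_of_categories B C G \<and>
      is_unique_factorization M C A \<gamma>C (\<pi> \<circ>\<^sub>F RQ) H \<and>
      quasi_inverse A C (G \<circ>\<^sub>F F) H) \<and>
   (\<exists>N. is_unique_factorization M (localization M W) C (localization_functor M W) \<gamma>C N)"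
proof
  interpret cof: category Mcof by (rule Mcof_category)
  have \<gamma>B: "is_functor Mcof B \<gamma>B" by (rule cof.localization_functor)
  have \<gamma>C: "is_functor M C \<gamma>C" by (rule localization_functor)
  have \<pi>: "is_functor Mcf A \<pi>" by (rule HoMcf.quotient_functor)
  have "is_functor Mcf Mcof id_functor"
    unfolding Mcf_full Mcof_full by (rule inclusion_functor) blast
  note FB = comp_is_functor[OF this \<gamma>B]
  have "is_functor Mcof M id_functor" unfolding Mcof_full by (rule full_inclusion_functor)
  note GC = comp_is_functor[OF this \<gamma>C]

  have "fa (\<gamma>B \<circ>\<^sub>F id_functor) f = fa (\<gamma>B \<circ>\<^sub>F id_functor) g" if "(f, g) \<in> homotopy M \<Phi>" "f \<in> Arr Mcf" for f g
  proof -
    have "f \<in> hom Mcof (Dom M f) (Cod M f)"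
      using that(2) by (simp add: Mcf_full Mcof_full hom_def)
    then show ?thesis using homotopic_equal_in_localization[OF that(1)] by simp
  qed
  from HoMcf.quotient_factorization[OF FB this]
  obtain F where F: "is_unique_factorization Mcf A B \<pi> (\<gamma>B \<circ>\<^sub>F id_functor) F" by blast

  have "is_iso C (fa (\<gamma>C \<circ>\<^sub>F id_functor) s)" if "s \<in> Arr Mcof" "s \<in> W \<union> L" for s
    using localization_inverts[OF Mcof_inverted[OF that]] by simp
  from cof.localization_factorization[OF GC this]
  obtain G where G: "is_unique_factorization Mcof B C \<gamma>B (\<gamma>C \<circ>\<^sub>F id_functor) G" by blast

  from localization_factorization[OF comp_is_functor[OF RQ_functor \<pi>] WL_inverted]
  obtain H where H: "is_unique_factorization M C A \<gamma>C (\<pi> \<circ>\<^sub>F RQ) H" by blast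

  have "is_iso C (fa \<gamma>C s)" if "s \<in> Arr M" "s \<in> W" for s
    using localization_inverts[OF arr_in_hom[OF that(1)]] W_subset_WL that(2) by blast
  from localization_factorization[OF \<gamma>C this]
  show "\<exists>N. is_unique_factorization M (localization M W) C (localization_functor M W) \<gamma>C N" by blast

  note F' = unique_factorizationD[OF F] and G' = unique_factorizationD[OF G] and H' = unique_factorizationD[OF H]
  note FF = F'(3) and GG = G'(3) and HH = H'(3)
  note GF = comp_is_functor[OF FF GG] and HG = comp_is_functor[OF GG HH] and FH = comp_is_functor[OF HH FF]

  have Fo: "fo F X = X" if "X \<in> Obj Mcf" for X using F'(4)[OF that] by (simp add: localization_functor_def)
  have Go: "fo G X = X" if "X \<in> Obj Mcof" for X using G'(4)[OF that] by (simp add: localization_functor_def)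
  have Ho: "fo H X = fo RQ X" if "X \<in> Obj M" for X using H'(4)[OF that] by (simp add: localization_functor_def)
  have Fa: "fa F (fa \<pi> f) = fa \<gamma>B f" if "f \<in> hom Mcf X Y" for f X Y
    using F'(5)[OF HoMcf.homD(1)[OF that]] by simp
  have Ga: "fa G (fa \<gamma>B f) = fa \<gamma>C f" if "f \<in> hom Mcof X Y" for f X Y
    using G'(5)[OF cof.homD(1)[OF that]] by simp
  have Ha: "fa H (fa \<gamma>C f) = fa \<pi> (fa RQ f)" if "f \<in> hom M X Y" for f X Y
    using H'(5)[OF homD(1)[OF that]] by simp
  have obj: "X \<in> Obj M" "fo Q X \<in> cofibrant_objs M Cof" "fo RQ X \<in> Obj Mcf" if "X \<in> Obj M" for X
    using that Q_obj is_functor.fo_obj[OF RQ_functor] by auto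
  have RQa: "fa RQ f \<in> hom Mcf (fo RQ X) (fo RQ Y)" if "f \<in> hom M X Y" for f X Y
    using is_functor.fa_hom[OF RQ_functor that] .
  have cf_cof: "f \<in> hom Mcof X Y" if "f \<in> hom Mcf X Y" for f X Y
    using hom_McfD[OF that] hom_Mcof by simp

  have HGF: "naturally_isomorphic A A (H \<circ>\<^sub>F (G \<circ>\<^sub>F F)) id_functor"
  proof -
    let ?P = "cofibrant_objs M Cof \<inter> fibrant_objs M R"
    let ?t = "\<lambda>X. fa \<pi> (q X) \<cdot>\<^bsub>A\<^esub> inv_arr A (fa \<pi> (unit (fo Q X)))"
    have T: "is_functor (full_sub M ?P) A \<pi>" using \<pi> by (simp add: Mcf_full)
    have P: "fo Q X \<in> ?P" "fo RQ X \<in> ?P" if "X \<in> Obj M" "X \<in> ?P" for X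
      using that obj(2,3)[OF that(1)] Q_fibrant by auto
    have iso: "is_iso A (fa \<pi> (q X))" "is_iso A (fa \<pi> (unit (fo Q X)))" if "X \<in> Obj M" "X \<in> ?P" for X
    proof -
      have "q X \<in> hom Mcf (fo Q X) X" "unit (fo Q X) \<in> hom Mcf (fo Q X) (fo RQ X)"
        using q_hom(1)[OF that(1)] unit_hom(1)[OF cofibrantD(1)[OF obj(2)[OF that(1)]]] P[OF that] that hom_Mcf
        by auto
      then show "is_iso A (fa \<pi> (q X))" "is_iso A (fa \<pi> (unit (fo Q X)))"
        using homotopy_local_iso W_homotopy_local[OF q_hom(3,1)[OF that(1)]] P[OF that] that(2)
          L_homotopy_local[OF unit_hom(2)[OF cofibrantD(1)[OF obj(2)[OF that(1)]]]] by blast+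
    qed
    have "\<forall>X\<in>Obj M \<inter> ?P. fo Q X \<in> ?P \<and> fo RQ X \<in> ?P"
      and "\<forall>X\<in>Obj M \<inter> ?P. is_iso A (fa \<pi> (q X)) \<and> is_iso A (fa \<pi> (unit (fo Q X)))"
      using P iso by blast+
    note t = replacement_natural_iso[OF T this]
    show ?thesis
    proof (rule HoMcf.natural_on_quotient[of _ _ _ ?t])
      show "is_functor A A (H \<circ>\<^sub>F (G \<circ>\<^sub>F F))" using comp_is_functor[OF GF HH] .
      show "is_functor A A id_functor"
        using category.id_functor[OF HoMcf.quotient_category] .
    next
      fix X assume X: "X \<in> Obj Mcf"
      then have X': "X \<in> Obj M" "X \<in> ?P" "X \<in> Obj Mcof" using cofibrantD(1) by auto
      show "?t X \<in> hom A (fo (H \<circ>\<^sub>F (G \<circ>\<^sub>F F)) X) (fo id_functor X)" "is_iso A (?t X)"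
        using t(1,2)[OF X'(1,2)] Fo[OF X] Go[OF X'(3)] Ho[OF X'(1)] by simp_all
    next
      fix f X Y assume f: "f \<in> hom Mcf X Y"
      have fM: "f \<in> hom M X Y" and XY: "X \<in> ?P" "Y \<in> ?P" using hom_McfD[OF f] by auto
      show "?t Y \<cdot>\<^bsub>A\<^esub> fa (H \<circ>\<^sub>F (G \<circ>\<^sub>F F)) (quotient_class Mcf (homotopy M \<Phi>) f)
        = fa id_functor (quotient_class Mcf (homotopy M \<Phi>) f) \<cdot>\<^bsub>A\<^esub> ?t X"
        using t(3)[OF fM XY] Fa[OF f] Ga[OF cf_cof[OF f]] Ha[OF fM] by simp
    qed
  qed

  have FHG: "naturally_isomorphic B B (F \<circ>\<^sub>F (H \<circ>\<^sub>F G)) id_functor"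
  proof -
    let ?P = "cofibrant_objs M Cof"
    let ?t = "\<lambda>X. fa \<gamma>B (q X) \<cdot>\<^bsub>B\<^esub> inv_arr B (fa \<gamma>B (unit (fo Q X)))"
    have T: "is_functor (full_sub M ?P) B \<gamma>B" using \<gamma>B by (simp add: Mcof_full)
    have P: "fo Q X \<in> ?P" "fo RQ X \<in> ?P" if "X \<in> Obj M" "X \<in> ?P" for X
      using obj(2,3)[OF that(1)] by auto
    have iso: "is_iso B (fa \<gamma>B (q X))" "is_iso B (fa \<gamma>B (unit (fo Q X)))" if "X \<in> Obj M" "X \<in> ?P" for X
    proof -
      have "q X \<in> hom Mcof (fo Q X) X" "unit (fo Q X) \<in> hom Mcof (fo Q X) (fo RQ X)"
        using q_hom(1)[OF that(1)] unit_hom(1)[OF cofibrantD(1)[OF obj(2)[OF that(1)]]] P[OF that] that hom_Mcof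
        by auto
      then show "is_iso B (fa \<gamma>B (q X))" "is_iso B (fa \<gamma>B (unit (fo Q X)))"
        using cof.localization_inverts q_hom(3)[OF that(1)]
          unit_hom(2)[OF cofibrantD(1)[OF obj(2)[OF that(1)]]] by blast+
    qed
    have "\<forall>X\<in>Obj M \<inter> ?P. fo Q X \<in> ?P \<and> fo RQ X \<in> ?P"
      and "\<forall>X\<in>Obj M \<inter> ?P. is_iso B (fa \<gamma>B (q X)) \<and> is_iso B (fa \<gamma>B (unit (fo Q X)))"
      using P iso by blast+
    note t = replacement_natural_iso[OF T this]
    show ?thesis
    proof (rule cof.natural_on_localization[of _ _ _ _ ?t])
      show "is_functor B B (F \<circ>\<^sub>F (H \<circ>\<^sub>F G))" using comp_is_functor[OF HG FF] .
      show "is_functor B B id_functor"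
        using category.id_functor[OF cof.localization_category] .
    next
      fix X assume X: "X \<in> Obj Mcof"
      then have X': "X \<in> Obj M" "X \<in> ?P" using cofibrantD(1) by auto
      show "?t X \<in> hom B (fo (F \<circ>\<^sub>F (H \<circ>\<^sub>F G)) X) (fo id_functor X)" "is_iso B (?t X)"
        using t(1,2)[OF X'] Fo[OF obj(3)[OF X'(1)]] Go[OF X] Ho[OF X'(1)]
        by (simp_all add: localization_functor_def)
    next
      fix f X Y assume f: "f \<in> hom Mcof X Y"
      have fM: "f \<in> hom M X Y" and XY: "X \<in> ?P" "Y \<in> ?P" using hom_McofD[OF f] by auto
      show "?t Y \<cdot>\<^bsub>B\<^esub> fa (F \<circ>\<^sub>F (H \<circ>\<^sub>F G)) (fa \<gamma>B f) = fa id_functor (fa \<gamma>B f) \<cdot>\<^bsub>B\<^esub> ?t X"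
        using t(3)[OF fM XY] Fa[OF RQa[OF fM]] Ga[OF f] Ha[OF fM] by simp
    qed
  qed

  have GFH: "naturally_isomorphic C C ((G \<circ>\<^sub>F F) \<circ>\<^sub>F H) id_functor"
  proof -
    let ?t = "\<lambda>X. fa \<gamma>C (q X) \<cdot>\<^bsub>C\<^esub> inv_arr C (fa \<gamma>C (unit (fo Q X)))"
    have T: "is_functor (full_sub M UNIV) C \<gamma>C" using \<gamma>C by (simp add: full_sub_UNIV)
    have iso: "is_iso C (fa \<gamma>C (q X))" "is_iso C (fa \<gamma>C (unit (fo Q X)))" if X: "X \<in> Obj M" for X
    proof -
      note u = unit_hom(1,2)[OF cofibrantD(1)[OF obj(2)[OF X]]]
      show "is_iso C (fa \<gamma>C (q X))"
        using localization_inverts[OF q_hom(1)[OF X]] q_hom(3)[OF X] W_subset_WL by blast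
      show "is_iso C (fa \<gamma>C (unit (fo Q X)))"
        using localization_inverts[OF u(1) L_cofibrant_WL[OF u(2,1) obj(2)[OF X] RL_cofibrant[OF obj(2)[OF X]]]] .
    qed
    \<comment> \<open>The whole category is the full subcategory on all objects.\<close>
    have "\<forall>X\<in>Obj M \<inter> UNIV. fo Q X \<in> UNIV \<and> fo RQ X \<in> UNIV"
      and "\<forall>X\<in>Obj M \<inter> UNIV. is_iso C (fa \<gamma>C (q X)) \<and> is_iso C (fa \<gamma>C (unit (fo Q X)))"
      using iso by blast+
    note t = replacement_natural_iso[OF T this]
    show ?thesis
    proof (rule natural_on_localization[of _ _ _ _ ?t])
      show "is_functor C C ((G \<circ>\<^sub>F F) \<circ>\<^sub>F H)" using comp_is_functor[OF HH GF] .
      show "is_functor C C id_functor"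
        using category.id_functor[OF localization_category] .
    next
      fix X assume X: "X \<in> Obj M"
      note o = obj(3)[OF X]
      have "fo RQ X \<in> Obj Mcof" using o by simp
      then show "?t X \<in> hom C (fo ((G \<circ>\<^sub>F F) \<circ>\<^sub>F H) X) (fo id_functor X)" "is_iso C (?t X)"
        using t(1,2)[OF X UNIV_I] Fo[OF o] Go Ho[OF X]
        by (simp_all add: localization_functor_def)
    next
      fix f X Y assume f: "f \<in> hom M X Y"
      show "?t Y \<cdot>\<^bsub>C\<^esub> fa ((G \<circ>\<^sub>F F) \<circ>\<^sub>F H) (fa \<gamma>C f) = fa id_functor (fa \<gamma>C f) \<cdot>\<^bsub>C\<^esub> ?t X"
        using t(3)[OF f UNIV_I UNIV_I] Fa[OF RQa[OF f]] Ga[OF cf_cof[OF RQa[OF f]]] Ha[OF f] by simp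
    qed
  qed

  have "quasi_inverse A B F (H \<circ>\<^sub>F G)"
    unfolding quasi_inverse_def using FF HG HGF FHG by (simp add: comp_functor_assoc)
  moreover have "quasi_inverse B C G (F \<circ>\<^sub>F H)"
    unfolding quasi_inverse_def using GG FH FHG GFH by (simp add: comp_functor_assoc)
  moreover have "quasi_inverse A C (G \<circ>\<^sub>F F) H"
    unfolding quasi_inverse_def using GF HH HGF GFH by simp
  ultimately show "\<exists>F G H.
      is_unique_factorization Mcf A B \<pi> (\<gamma>B \<circ>\<^sub>F id_functor) F \<and>
      equivalence_of_categories A B F \<and>
      is_unique_factorization Mcof B C \<gamma>B (\<gamma>C \<circ>\<^sub>F id_functor) G \<and>
      equivalence_of_categories B C G \<and>
      is_unique_factorization M C A \<gamma>C (\<pi> \<circ>\<^sub>F RQ) H \<and>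
      quasi_inverse A C (G \<circ>\<^sub>F F) H"
    unfolding equivalence_of_categories_def using F G H by blast
qed

end

theorem theorem2:
  fixes U :: "'u set"
    and M :: "('o, 'a) cat"
    and Cof Fib W J L R K :: "'a set"
    and \<Phi> :: "'a factorization"
    and Q :: "('o, 'a, 'o, 'a) ftor"
    and q :: "'o \<Rightarrow> 'a"
  assumes "universe U"
    and "model_category U M Cof Fib W"
    and "cofibrantly_generated_by U M (Cof \<inter> W) Fib J"
    and "cofibrantly_generated_by U M L R (J \<union> K)"
    and "Cof \<inter> W \<subseteq> L" and "L \<subseteq> Cof"
    and "functorial_factorization M \<Phi> (cell U M (J \<union> K)) R"
    and "cofibrant_replacement M Cof Fib W Q q"
  shows
    "let Mcof = cof_cat M Cof;
         Mcf = cof_fib_cat M Cof R;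
         WL = local_equivalences M Cof R \<Phi> Q;
         A = quotient_cat Mcf (homotopy M \<Phi>);
         \<pi> = quotient_functor Mcf (homotopy M \<Phi>);
         B = localization Mcof (W \<union> L);
         \<gamma>B = localization_functor Mcof (W \<union> L);
         C = localization M WL;
         \<gamma>C = localization_functor M WL
     in
       (\<exists>F G H.
          is_unique_factorization Mcf A B \<pi> (\<gamma>B \<circ>\<^sub>F id_functor) F \<and>
          equivalence_of_categories A B F \<and>
          is_unique_factorization Mcof B C \<gamma>B (\<gamma>C \<circ>\<^sub>F id_functor) G \<and>
          equivalence_of_categories B C G \<and>
          is_unique_factorization M C A \<gamma>C (\<pi> \<circ>\<^sub>F (fibrant_replacement M \<Phi> \<circ>\<^sub>F Q)) H \<and>
          quasi_inverse A C (G \<circ>\<^sub>F F) H) \<and>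
       (\<exists>N. is_unique_factorization M (localization M W) C (localization_functor M W) \<gamma>C N)"
proof -
  interpret category M using assms(2) by (simp add: model_category_def)
  \<comment> \<open>Cells have the left lifting property, so the factorization is one for \<open>(L, R)\<close>.\<close>
  have "cell U M (J \<union> K) \<subseteq> L"
    using cell_subset_cof_class assms(4) unfolding cofibrantly_generated_by_def by blast
  then have "functorial_factorization M \<Phi> L R"
    using assms(7) unfolding functorial_factorization_def by blast
  then interpret relative_model_category M U Cof Fib W L R \<Phi> Q q
    using assms by unfold_locales (auto simp: universe_def cofibrantly_generated_by_def)
  show ?thesis unfolding Let_def by (rule localization_equivalences)
qed

end
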